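(* Let $p$ be a prime, $k$ an algebraically closed field of characteristic $p$, $W(k)$ its Witt vectors with Frobenius $\sigma$. Let $(M,\phi)$ be a supersingular Dieudonné module over $k$ of rank $2d$. Let $O$ be the $W(k)$-span in $\mathrm{End}(M)$ of $\{e\in\mathrm{End}(M)\mid\phi\circ e\circ\phi^{-1}=e\}$. Let $(N,\varphi)$ have $W(k)$-basis $\{x,y\}$ with $\varphi(x)=y$, $\varphi(y)=px$, and let $q\ge0$ be the smallest integer such that there is a monomorphism $j:(N^d,\varphi)\hookrightarrow(M,\phi)$ with $\phi^q(M)\subseteq j(N^d)$. Then $p^{q+1}\mathrm{End}(M)\subseteq O\subseteq\mathrm{End}(M)$; i.e. $m\le q+1$, where $m$ is the smallest natural number with $p^m\mathrm{End}(M)\subseteq O$.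
   Context: A Dieudonné module over $k$ is a free $W(k)$-module $M$ of finite rank with a $\sigma$-linear endomorphism $\phi$ satisfying $pM\subseteq\phi(M)$; it is supersingular if all slopes equal $\tfrac12$. $\phi$ acts on $\mathrm{End}(M[1/p])$ by $e\mapsto\phi\circ e\circ\phi^{-1}$. $(N^d,\varphi)$ is the direct sum of $d$ copies of $(N,\varphi)$; monomorphisms are injective $W(k)$-linear maps commuting with Frobenius. *)

theory Defs
  imports
    "HOL-Algebra.Module"
    "HOL-Library.Poly_Mapping"
    "HOL-Computational_Algebra.Polynomial"
    "HOL-Computational_Algebra.Primes"
begin

section \<open>Witt vectors\<close>

type_synonym 'v int_mpoly = "('v \<Rightarrow>\<^sub>0 nat) \<Rightarrow>\<^sub>0 int"

definition mpoly_var :: "'v \<Rightarrow> 'v int_mpoly" where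
  "mpoly_var v = Poly_Mapping.single (Poly_Mapping.single v 1) 1"

definition mpoly_eval :: "('v \<Rightarrow> 'a::comm_ring_1) \<Rightarrow> 'v int_mpoly \<Rightarrow> 'a" where
  "mpoly_eval \<rho> P =
     (\<Sum>t\<in>Poly_Mapping.keys P. of_int (Poly_Mapping.lookup P t) *
        (\<Prod>v\<in>Poly_Mapping.keys t. \<rho> v ^ Poly_Mapping.lookup t v))"

definition ghost :: "nat \<Rightarrow> (nat \<Rightarrow> 'a::comm_ring_1) \<Rightarrow> nat \<Rightarrow> 'a" where
  "ghost p x n = (\<Sum>i\<le>n. of_nat (p ^ i) * x i ^ (p ^ (n - i)))"

text \<open>For \<open>p\<close> prime, Witt's theorem gives unique integer polynomials in the variables
  \<open>X\<^sub>i = mpoly_var (Inl i)\<close> and \<open>Y\<^sub>i = mpoly_var (Inr i)\<close> whose ghost components are the sums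
  (respectively products) of the ghost components of \<open>X\<close> and \<open>Y\<close>.\<close>

definition witt_add_poly :: "nat \<Rightarrow> nat \<Rightarrow> (nat + nat) int_mpoly" where
  "witt_add_poly p = (THE S. \<forall>n. ghost p S n =
     ghost p (\<lambda>i. mpoly_var (Inl i)) n + ghost p (\<lambda>i. mpoly_var (Inr i)) n)"

definition witt_mult_poly :: "nat \<Rightarrow> nat \<Rightarrow> (nat + nat) int_mpoly" where
  "witt_mult_poly p = (THE P. \<forall>n. ghost p P n =
     ghost p (\<lambda>i. mpoly_var (Inl i)) n * ghost p (\<lambda>i. mpoly_var (Inr i)) n)"

definition Witt :: "nat \<Rightarrow> (nat \<Rightarrow> 'k::comm_ring_1) ring" where
  "Witt p =
     \<lparr>carrier = UNIV,
      monoid.mult = (\<lambda>x y n. mpoly_eval (case_sum x y) (witt_mult_poly p n)),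
      one = (\<lambda>n. if n = 0 then 1 else 0),
      zero = (\<lambda>n. 0),
      add = (\<lambda>x y n. mpoly_eval (case_sum x y) (witt_add_poly p n))\<rparr>"

text \<open>The coordinatewise formula is the Witt vector Frobenius for rings of characteristic \<open>p\<close>.\<close>

definition witt_frob :: "nat \<Rightarrow> (nat \<Rightarrow> 'k::comm_ring_1) \<Rightarrow> nat \<Rightarrow> 'k" where
  "witt_frob p x = (\<lambda>n. x n ^ p)"


section \<open>Modules and semilinear maps\<close>

definition is_basis :: "('r, 'x) ring_scheme \<Rightarrow> ('r, 'm) module \<Rightarrow> 'm set \<Rightarrow> bool" where
  "is_basis R M B \<longleftrightarrow> finite B \<and> B \<subseteq> carrier M \<and>
     (\<forall>m\<in>carrier M. \<exists>!c. c \<in> B \<rightarrow>\<^sub>E carrier R \<and> m = (\<Oplus>\<^bsub>M\<^esub>b\<in>B. c b \<odot>\<^bsub>M\<^esub> b))"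

definition free_of_rank :: "('r, 'x) ring_scheme \<Rightarrow> ('r, 'm) module \<Rightarrow> nat \<Rightarrow> bool" where
  "free_of_rank R M n \<longleftrightarrow> (\<exists>B. is_basis R M B \<and> card B = n)"

definition semilinear_maps ::
  "('r, 'x) ring_scheme \<Rightarrow> ('r \<Rightarrow> 'r) \<Rightarrow> ('r, 'm) module \<Rightarrow> ('r, 'n) module \<Rightarrow> ('m \<Rightarrow> 'n) set" where
  "semilinear_maps R s M N = {f \<in> carrier M \<rightarrow> carrier N.
     (\<forall>x\<in>carrier M. \<forall>y\<in>carrier M. f (x \<oplus>\<^bsub>M\<^esub> y) = f x \<oplus>\<^bsub>N\<^esub> f y) \<and>
     (\<forall>a\<in>carrier R. \<forall>x\<in>carrier M. f (a \<odot>\<^bsub>M\<^esub> x) = s a \<odot>\<^bsub>N\<^esub> f x)}"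

abbreviation linear_maps ::
  "('r, 'x) ring_scheme \<Rightarrow> ('r, 'm) module \<Rightarrow> ('r, 'n) module \<Rightarrow> ('m \<Rightarrow> 'n) set" where
  "linear_maps R \<equiv> semilinear_maps R (\<lambda>a. a)"

text \<open>Endomorphisms are taken to be extensional functions, so that equality of endomorphisms is
  equality on the carrier.\<close>

definition End_module :: "('r, 'x) ring_scheme \<Rightarrow> ('r, 'm) module \<Rightarrow> ('r, 'm \<Rightarrow> 'm) module" where
  "End_module R M =
     \<lparr>carrier = linear_maps R M M \<inter> extensional (carrier M),
      monoid.mult = compose (carrier M),
      one = (\<lambda>x\<in>carrier M. x),
      zero = (\<lambda>x\<in>carrier M. \<zero>\<^bsub>M\<^esub>),
      add = (\<lambda>f g. \<lambda>x\<in>carrier M. f x \<oplus>\<^bsub>M\<^esub> g x),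
      module.smult = (\<lambda>a f. \<lambda>x\<in>carrier M. a \<odot>\<^bsub>M\<^esub> f x)\<rparr>"

definition module_span :: "('r, 'x) ring_scheme \<Rightarrow> ('r, 'm) module \<Rightarrow> 'm set \<Rightarrow> 'm set" where
  "module_span R M A = \<Inter>{H. submodule H R M \<and> A \<subseteq> H}"

definition multiples :: "nat \<Rightarrow> ('r, 'm) module \<Rightarrow> 'm set" where
  "multiples n M = (\<lambda>x. [n] \<cdot>\<^bsub>M\<^esub> x) ` carrier M"


section \<open>Inverting \<open>p\<close>\<close>

text \<open>Elements of \<open>M[1/p]\<close> are classes of pairs \<open>(m, i)\<close>, standing for \<open>m / p\<^sup>i\<close>. The
  module \<open>M[1/p]\<close> is regarded as a module over the base ring \<open>R\<close> of \<open>M\<close>: additive maps between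
  such modules that are \<open>R\<close>-linear are automatically \<open>R[1/p]\<close>-linear. The ring fields
  \<open>mult\<close> and \<open>one\<close> of the module record play no role.\<close>

definition loc_rel :: "nat \<Rightarrow> ('r, 'm) module \<Rightarrow> (('m \<times> nat) \<times> ('m \<times> nat)) set" where
  "loc_rel p M = {((m, i), (m', i')). m \<in> carrier M \<and> m' \<in> carrier M \<and>
     (\<exists>l. [(p ^ (l + i'))] \<cdot>\<^bsub>M\<^esub> m = [(p ^ (l + i))] \<cdot>\<^bsub>M\<^esub> m')}"

definition loc_frac :: "nat \<Rightarrow> ('r, 'm) module \<Rightarrow> 'm \<Rightarrow> nat \<Rightarrow> ('m \<times> nat) set" where
  "loc_frac p M m i = loc_rel p M `` {(m, i)}"

definition loc :: "nat \<Rightarrow> ('r, 'm) module \<Rightarrow> ('r, ('m \<times> nat) set) module" where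
  "loc p M =
     \<lparr>carrier = (carrier M \<times> UNIV) // loc_rel p M,
      monoid.mult = undefined,
      one = undefined,
      zero = loc_frac p M \<zero>\<^bsub>M\<^esub> 0,
      add = (\<lambda>u v. \<Union>(m, i)\<in>u. \<Union>(m', i')\<in>v.
               loc_frac p M ([(p ^ i')] \<cdot>\<^bsub>M\<^esub> m \<oplus>\<^bsub>M\<^esub> [(p ^ i)] \<cdot>\<^bsub>M\<^esub> m') (i + i')),
      module.smult = (\<lambda>a u. \<Union>(m, i)\<in>u. loc_frac p M (a \<odot>\<^bsub>M\<^esub> m) i)\<rparr>"

definition loc_map ::
  "nat \<Rightarrow> ('r, 'm) module \<Rightarrow> ('r, 'n) module \<Rightarrow> ('m \<Rightarrow> 'n) \<Rightarrow> ('m \<times> nat) set \<Rightarrow> ('n \<times> nat) set" where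
  "loc_map p M N f = (\<lambda>u\<in>carrier (loc p M). \<Union>(m, i)\<in>u. loc_frac p N (f m) i)"


section \<open>Dieudonne modules\<close>

definition dieudonne_module ::
  "nat \<Rightarrow> (nat \<Rightarrow> 'k::comm_ring_1, 'm) module \<Rightarrow> ('m \<Rightarrow> 'm) \<Rightarrow> bool" where
  "dieudonne_module p M \<phi> \<longleftrightarrow>
     Module.module (Witt p) M \<and> (\<exists>n. free_of_rank (Witt p) M n) \<and>
     \<phi> \<in> semilinear_maps (Witt p) (witt_frob p) M M \<and>
     multiples p M \<subseteq> \<phi> ` carrier M"

text \<open>The action \<open>e \<mapsto> \<phi> \<circ> e \<circ> \<phi>\<^sup>-\<^sup>1\<close> on endomorphisms of \<open>M[1/p]\<close>, on which \<open>\<phi>\<close> is bijective.\<close>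

definition frob_conj ::
  "nat \<Rightarrow> (nat \<Rightarrow> 'k::comm_ring_1, 'm) module \<Rightarrow> ('m \<Rightarrow> 'm) \<Rightarrow>
   (('m \<times> nat) set \<Rightarrow> ('m \<times> nat) set) \<Rightarrow> ('m \<times> nat) set \<Rightarrow> ('m \<times> nat) set" where
  "frob_conj p M \<phi> e = (\<lambda>v\<in>carrier (loc p M).
     loc_map p M M \<phi> (e (inv_into (carrier (loc p M)) (loc_map p M M \<phi>) v)))"

definition invariant_span ::
  "nat \<Rightarrow> (nat \<Rightarrow> 'k::comm_ring_1, 'm) module \<Rightarrow> ('m \<Rightarrow> 'm) \<Rightarrow> ('m \<Rightarrow> 'm) set" where
  "invariant_span p M \<phi> = module_span (Witt p) (End_module (Witt p) M)
     {e \<in> carrier (End_module (Witt p) M). frob_conj p M \<phi> (loc_map p M M e) = loc_map p M M e}"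

text \<open>For a list of pairs \<open>(r\<^sub>i, s\<^sub>i)\<close> the direct sum of the standard modules \<open>N\<^bsub>r\<^sub>i,s\<^sub>i\<^esub>\<close>, where
  \<open>N\<^bsub>r,s\<^esub>\<close> has basis \<open>x\<^sub>0, \<dots>, x\<^bsub>s-1\<^esub>\<close> with \<open>\<phi>(x\<^sub>j) = x\<^bsub>j+1\<^esub>\<close> for \<open>j + 1 < s\<close> and
  \<open>\<phi>(x\<^bsub>s-1\<^esub>) = p\<^sup>r x\<^sub>0\<close>. An element is the family of its coordinates, the one at \<open>(i, j)\<close> belonging
  to the vector \<open>x\<^sub>j\<close> of the \<open>i\<close>-th summand. Inverting \<open>p\<close> in \<open>N\<^bsub>r,s\<^esub>\<close> gives, for coprime
  \<open>r, s\<close>, the simple isocrystal of slope \<open>r/s\<close>.\<close>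

definition std_index :: "(nat \<times> nat) list \<Rightarrow> (nat \<times> nat) set" where
  "std_index rs = {(i, j). i < length rs \<and> j < snd (rs ! i)}"

definition std_module ::
  "nat \<Rightarrow> (nat \<times> nat) list \<Rightarrow> (nat \<Rightarrow> 'k::comm_ring_1, nat \<times> nat \<Rightarrow> nat \<Rightarrow> 'k) module" where
  "std_module p rs =
     \<lparr>carrier = std_index rs \<rightarrow>\<^sub>E carrier (Witt p),
      monoid.mult = undefined,
      one = undefined,
      zero = (\<lambda>t\<in>std_index rs. \<zero>\<^bsub>Witt p\<^esub>),
      add = (\<lambda>f g. \<lambda>t\<in>std_index rs. f t \<oplus>\<^bsub>Witt p\<^esub> g t),
      module.smult = (\<lambda>a f. \<lambda>t\<in>std_index rs. a \<otimes>\<^bsub>Witt p\<^esub> f t)\<rparr>"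

definition std_frob ::
  "nat \<Rightarrow> (nat \<times> nat) list \<Rightarrow> (nat \<times> nat \<Rightarrow> nat \<Rightarrow> 'k::comm_ring_1) \<Rightarrow> nat \<times> nat \<Rightarrow> nat \<Rightarrow> 'k" where
  "std_frob p rs f = (\<lambda>(i, j)\<in>std_index rs.
     if j = 0 then [(p ^ fst (rs ! i))] \<cdot>\<^bsub>Witt p\<^esub> witt_frob p (f (i, snd (rs ! i) - 1))
     else witt_frob p (f (i, j - 1)))"

definition isocrystal_iso ::
  "nat \<Rightarrow> (nat \<Rightarrow> 'k::comm_ring_1, 'm) module \<Rightarrow> ('m \<Rightarrow> 'm) \<Rightarrow>
   (nat \<Rightarrow> 'k, 'n) module \<Rightarrow> ('n \<Rightarrow> 'n) \<Rightarrow> bool" where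
  "isocrystal_iso p M \<phi> N \<psi> \<longleftrightarrow> (\<exists>f \<in> linear_maps (Witt p) (loc p M) (loc p N).
     bij_betw f (carrier (loc p M)) (carrier (loc p N)) \<and>
     (\<forall>v\<in>carrier (loc p M). f (loc_map p M M \<phi> v) = loc_map p N N \<psi> (f v)))"

text \<open>Slopes are the numbers \<open>r\<^sub>i / s\<^sub>i\<close> occurring in the Dieudonne--Manin decomposition of
  \<open>(M[1/p], \<phi>)\<close>. Over an algebraically closed field the list \<open>rs\<close> exists and is unique up to
  order.\<close>

definition slope_decomposition ::
  "nat \<Rightarrow> (nat \<Rightarrow> 'k::comm_ring_1, 'm) module \<Rightarrow> ('m \<Rightarrow> 'm) \<Rightarrow> (nat \<times> nat) list \<Rightarrow> bool" where
  "slope_decomposition p M \<phi> rs \<longleftrightarrow>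
     (\<forall>(r, s)\<in>set rs. s > 0 \<and> coprime r s) \<and>
     isocrystal_iso p (std_module p rs) (std_frob p rs) M \<phi>"

definition supersingular ::
  "nat \<Rightarrow> (nat \<Rightarrow> 'k::comm_ring_1, 'm) module \<Rightarrow> ('m \<Rightarrow> 'm) \<Rightarrow> bool" where
  "supersingular p M \<phi> \<longleftrightarrow>
     (\<exists>rs. slope_decomposition p M \<phi> rs \<and> (\<forall>(r, s)\<in>set rs. of_nat r / of_nat s = (1 / 2 :: rat)))"

text \<open>\<open>(N, \<phi>)\<close> with basis \<open>x, y\<close> and \<open>\<phi>(x) = y\<close>, \<open>\<phi>(y) = p x\<close> is the standard module
  \<open>N\<^bsub>1,2\<^esub>\<close> with \<open>x = x\<^sub>0\<close>, \<open>y = x\<^sub>1\<close>; the following are \<open>N\<^sup>d\<close> and its Frobenius.\<close>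

abbreviation N_pow :: "nat \<Rightarrow> nat \<Rightarrow> (nat \<Rightarrow> 'k::comm_ring_1, nat \<times> nat \<Rightarrow> nat \<Rightarrow> 'k) module" where
  "N_pow p d \<equiv> std_module p (replicate d (1, 2))"

abbreviation N_pow_frob ::
  "nat \<Rightarrow> nat \<Rightarrow> (nat \<times> nat \<Rightarrow> nat \<Rightarrow> 'k::comm_ring_1) \<Rightarrow> nat \<times> nat \<Rightarrow> nat \<Rightarrow> 'k" where
  "N_pow_frob p d \<equiv> std_frob p (replicate d (1, 2))"

definition monomorphisms ::
  "nat \<Rightarrow> (nat \<Rightarrow> 'k::comm_ring_1, 'm) module \<Rightarrow> ('m \<Rightarrow> 'm) \<Rightarrow>
   (nat \<Rightarrow> 'k, 'n) module \<Rightarrow> ('n \<Rightarrow> 'n) \<Rightarrow> ('m \<Rightarrow> 'n) set" where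
  "monomorphisms p M \<phi> N \<psi> = {j \<in> linear_maps (Witt p) M N.
     inj_on j (carrier M) \<and> (\<forall>x\<in>carrier M. j (\<phi> x) = \<psi> (j x))}"

end

theory Submission
  imports Defs
begin

text \<open>Identify \<open>N\<^sup>d\<close> with its image under \<open>j\<close>, with basis \<open>x\<^sub>i\<close>, \<open>y\<^sub>i = \<phi> x\<^sub>i\<close>, and let
  \<open>s = \<lceil>q / 2\<rceil>\<close>. Since \<open>\<phi>\<^sup>2\<close> acts on \<open>N\<^sup>d\<close> as \<open>p\<close> times a bijection, \<open>\<phi>\<^sup>q M \<subseteq> N\<^sup>d\<close> gives
  \<open>p\<^sup>s M \<subseteq> N\<^sup>d\<close> and \<open>p\<^bsup>q+1-s\<^esup> M \<subseteq> \<phi> N\<^sup>d\<close>, the span of the \<open>p x\<^sub>i\<close> and \<open>y\<^sub>i\<close>. For \<open>e \<in> End(M)\<close> write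
  \<open>p\<^bsup>q+1\<^esup> e = (p\<^bsup>q+1-s\<^esup> e) \<circ> p\<^sup>s\<close>: the coordinates of \<open>p\<^sup>s u\<close> are linear functionals \<open>\<alpha>\<^sub>i\<close>, \<open>\<beta>\<^sub>i\<close> of
  \<open>u \<in> M\<close>, so \<open>p\<^bsup>q+1\<^esup> e\<close> is a combination of the rank one operators \<open>\<alpha>\<^sub>i x\<^sub>k\<close>, \<open>\<alpha>\<^sub>i y\<^sub>k\<close>, \<open>\<beta>\<^sub>i y\<^sub>k\<close> and
  \<open>p \<beta>\<^sub>i x\<^sub>k\<close>. If \<open>\<sigma>\<^sup>2 z = z\<close>, then \<open>z \<alpha>\<^sub>i x\<^sub>k + \<sigma>(z) \<beta>\<^sub>i y\<^sub>k\<close> and \<open>z \<alpha>\<^sub>i y\<^sub>k + \<sigma>(z) p \<beta>\<^sub>i x\<^sub>k\<close> commute with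
  \<open>\<phi>\<close>. Taking \<open>z = 1\<close> and a Teichmueller representative \<open>z\<close> of an element of \<open>GF(p\<^sup>2)\<close> outside \<open>GF(p)\<close>,
  for which \<open>z - \<sigma>(z)\<close> is a unit, the span of these contains all four operators.\<close>

section \<open>Witt vectors\<close>

text \<open>The definitions decide where the work lies. \<open>Witt p\<close> is built from
  polynomials picked by \<open>THE\<close>, so their unique existence has to be settled before
  anything can be computed; the ring axioms, on the other hand, come with the module structure on
  \<open>M\<close> and are not rederived. What remains to be supplied about \<open>W(k)\<close> is
  that \<open>p\<close> is regular, that a vector with nonzero zeroth coordinate is invertible, and
  that \<sigma> is bijective. Since \<open>q\<close> is a \<open>LEAST\<close>, some monomorphism
  with some exponent must be exhibited. The slopes only speak about \<open>M[1/p]\<close>: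
  denominators have to be cleared in both directions, and the number of copies of \<open>N\<close>
  obtained has to be matched with the rank \<open>2 * d\<close>. In the exponent
  \<open>q + 1\<close> the summand 1 pays for one asymmetry: the commuting operators give
  \<open>\<beta>\<^sub>i x\<^sub>k\<close> only with a factor \<open>p\<close>, so \<open>e\<close>
  is scaled by a power of \<open>p\<close> that carries \<open>M\<close> into
  \<open>\<phi> N\<^sup>d\<close> and not merely into \<open>N\<^sup>d\<close>.\<close>

locale comm_ring_map =
  fixes h :: "'a::comm_ring_1 \<Rightarrow> 'b::comm_ring_1"
  assumes map_add: "h (x + y) = h x + h y"
    and map_mult: "h (x * y) = h x * h y"
    and map_one: "h 1 = 1"
begin

lemma map_zero: "h 0 = 0"
  using map_add[of 0 0] by simp

lemma map_minus: "h (- x) = - h x"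
  using map_add[of x "- x"] map_zero by (simp add: eq_neg_iff_add_eq_0 add.commute)

lemma map_diff: "h (x - y) = h x - h y"
  using map_add[of x "- y"] map_minus by simp

lemma map_of_nat: "h (of_nat n) = of_nat n"
  by (induction n) (simp_all add: map_zero map_add map_one)

lemma map_of_int: "h (of_int z) = of_int z"
  by (cases z) (simp_all only: of_int_of_nat_eq of_int_minus map_of_nat map_minus)

lemma map_sum: "h (sum g A) = (\<Sum>i\<in>A. h (g i))"
  by (induction A rule: infinite_finite_induct) (simp_all add: map_zero map_add)

lemma map_prod: "h (prod g A) = (\<Prod>i\<in>A. h (g i))"
  by (induction A rule: infinite_finite_induct) (simp_all add: map_one map_mult)

lemma map_power: "h (x ^ n) = h x ^ n"
  by (induction n) (simp_all add: map_one map_mult)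

lemma map_mpoly_eval: "h (mpoly_eval \<rho> P) = mpoly_eval (\<lambda>v. h (\<rho> v)) P"
  by (simp add: mpoly_eval_def map_sum map_mult map_of_int map_prod map_power)

lemma map_ghost: "h (ghost p x n) = ghost p (\<lambda>i. h (x i)) n"
  unfolding ghost_def map_sum map_mult map_of_nat map_power ..

end

section \<open>Evaluation of integer polynomials and reduction to constants and variables\<close>

definition monom_eval :: "('v \<Rightarrow> 'a::comm_ring_1) \<Rightarrow> ('v \<Rightarrow>\<^sub>0 nat) \<Rightarrow> 'a" where
  "monom_eval \<rho> t = (\<Prod>v\<in>Poly_Mapping.keys t. \<rho> v ^ Poly_Mapping.lookup t v)"

lemma monom_eval_superset:
  "finite K \<Longrightarrow> Poly_Mapping.keys t \<subseteq> K \<Longrightarrow> monom_eval \<rho> t = (\<Prod>v\<in>K. \<rho> v ^ Poly_Mapping.lookup t v)"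
  unfolding monom_eval_def by (rule prod.mono_neutral_left) (auto simp: in_keys_iff)

lemma monom_eval_add: "monom_eval \<rho> (s + t) = monom_eval \<rho> s * monom_eval \<rho> t"
proof -
  let ?K = "Poly_Mapping.keys s \<union> Poly_Mapping.keys t"
  have "monom_eval \<rho> (s + t) = (\<Prod>v\<in>?K. \<rho> v ^ Poly_Mapping.lookup (s + t) v)"
    by (rule monom_eval_superset) (use keys_add[of s t] in auto)
  also have "\<dots> = (\<Prod>v\<in>?K. \<rho> v ^ Poly_Mapping.lookup s v) * (\<Prod>v\<in>?K. \<rho> v ^ Poly_Mapping.lookup t v)"
    by (simp add: lookup_add power_add prod.distrib)
  also have "\<dots> = monom_eval \<rho> s * monom_eval \<rho> t"
    by (simp add: monom_eval_superset[of ?K])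
  finally show ?thesis .
qed

lemma mpoly_eval_superset:
  "finite K \<Longrightarrow> Poly_Mapping.keys P \<subseteq> K \<Longrightarrow>
    mpoly_eval \<rho> P = (\<Sum>t\<in>K. of_int (Poly_Mapping.lookup P t) * monom_eval \<rho> t)"
  unfolding mpoly_eval_def monom_eval_def by (rule sum.mono_neutral_left) (auto simp: in_keys_iff)

lemma mpoly_eval_add: "mpoly_eval \<rho> (P + Q) = mpoly_eval \<rho> P + mpoly_eval \<rho> Q"
proof -
  let ?K = "Poly_Mapping.keys P \<union> Poly_Mapping.keys Q"
  have "mpoly_eval \<rho> (P + Q) = (\<Sum>t\<in>?K. of_int (Poly_Mapping.lookup (P + Q) t) * monom_eval \<rho> t)"
    by (rule mpoly_eval_superset) (use keys_add[of P Q] in auto)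
  also have "\<dots> = (\<Sum>t\<in>?K. of_int (Poly_Mapping.lookup P t) * monom_eval \<rho> t)
      + (\<Sum>t\<in>?K. of_int (Poly_Mapping.lookup Q t) * monom_eval \<rho> t)"
    by (simp add: lookup_add algebra_simps sum.distrib)
  also have "\<dots> = mpoly_eval \<rho> P + mpoly_eval \<rho> Q"
    by (simp add: mpoly_eval_superset[of ?K])
  finally show ?thesis .
qed

lemma mpoly_eval_single: "mpoly_eval \<rho> (Poly_Mapping.single t c) = of_int c * monom_eval \<rho> t"
  by (simp add: mpoly_eval_superset[of "{t}"])

lemma mpoly_eval_sum: "mpoly_eval \<rho> (sum f A) = (\<Sum>i\<in>A. mpoly_eval \<rho> (f i))"
proof (induction A rule: infinite_finite_induct)
  case (infinite A) then show ?case by (simp add: mpoly_eval_def)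
next
  case empty then show ?case by (simp add: mpoly_eval_def)
qed (simp add: mpoly_eval_add)

lemma poly_mapping_sum_single:
  "(\<Sum>t\<in>Poly_Mapping.keys P. Poly_Mapping.single t (Poly_Mapping.lookup P t)) = P"
  by (rule poly_mapping_eqI) (auto simp: lookup_sum lookup_single when_def in_keys_iff)

lemma mpoly_eval_mult: "mpoly_eval \<rho> (P * Q) = mpoly_eval \<rho> P * mpoly_eval \<rho> Q"
proof -
  let ?s = "\<lambda>P t. Poly_Mapping.single t (Poly_Mapping.lookup P t)"
  have "mpoly_eval \<rho> (P * Q) = mpoly_eval \<rho> ((\<Sum>t\<in>Poly_Mapping.keys P. ?s P t) * (\<Sum>t\<in>Poly_Mapping.keys Q. ?s Q t))"
    by (simp only: poly_mapping_sum_single)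
  also have "\<dots> = (\<Sum>s\<in>Poly_Mapping.keys P. mpoly_eval \<rho> (?s P s)) * (\<Sum>t\<in>Poly_Mapping.keys Q. mpoly_eval \<rho> (?s Q t))"
    by (simp add: sum_product mpoly_eval_sum mult_single mpoly_eval_single monom_eval_add algebra_simps)
  also have "\<dots> = mpoly_eval \<rho> P * mpoly_eval \<rho> Q"
    by (simp only: mpoly_eval_sum[symmetric] poly_mapping_sum_single)
  finally show ?thesis .
qed

lemma mpoly_eval_one: "mpoly_eval \<rho> 1 = 1"
  using mpoly_eval_single[of \<rho> 0 1] by (simp add: monom_eval_def)

lemma comm_ring_map_mpoly_eval: "comm_ring_map (mpoly_eval \<rho>)"
  by unfold_locales (simp_all add: mpoly_eval_add mpoly_eval_mult mpoly_eval_one)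

lemma mpoly_eval_var [simp]: "mpoly_eval \<rho> (mpoly_var v) = \<rho> v"
  by (simp add: mpoly_var_def mpoly_eval_single monom_eval_def)

text \<open>Every polynomial is a sum of integer multiples of products of variables. The rule serves
  the congruence between the \<open>p\<close>-th power map and the Frobenius lift.\<close>

lemma mpoly_induct [case_names add mult const var]:
  assumes "\<And>P Q. A P \<Longrightarrow> A Q \<Longrightarrow> A (P + Q)" and "\<And>P Q. A P \<Longrightarrow> A Q \<Longrightarrow> A (P * Q)"
    and "\<And>c. A (of_int c)" and "\<And>v. A (mpoly_var v)"
  shows "A (P :: 'v int_mpoly)"
proof -
  have A_sum: "(\<And>i. i \<in> I \<Longrightarrow> A (f i)) \<Longrightarrow> A (sum f I)" for f :: "('v \<Rightarrow>\<^sub>0 nat) \<Rightarrow> _" and I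
    using assms(1) assms(3)[of 0] by (induction I rule: infinite_finite_induct) auto
  have A_power: "A Q \<Longrightarrow> A (Q ^ n)" for Q n
    using assms(2) assms(3)[of 1] by (induction n) auto
  have var_power: "mpoly_var v ^ n = Poly_Mapping.single (Poly_Mapping.single v n) 1" for v :: 'v and n
    by (induction n) (simp_all add: mpoly_var_def mult_single flip: single_add)
  have single: "A (Poly_Mapping.single t 1)" for t
  proof (induction t rule: update_induct)
    case const
    then show ?case using assms(3)[of 1] by simp
  next
    case (update t v n)
    \<comment> \<open>The induction only adds variables outside the support of \<open>t\<close>, so
      overwriting the exponent of \<open>v\<close> is the same as adding it.\<close>
    have "Poly_Mapping.update v n t = t + Poly_Mapping.single v n"
      using update by (intro poly_mapping_eqI) (auto simp: lookup_update lookup_add lookup_single when_def in_keys_iff)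
    then have "Poly_Mapping.single (Poly_Mapping.update v n t) (1::int)
      = Poly_Mapping.single t 1 * mpoly_var v ^ n"
      by (simp add: var_power mult_single)
    then show ?case using update assms(2,4) A_power by metis
  qed
  have "Poly_Mapping.single t c = of_int c * Poly_Mapping.single t 1" for t :: "'v \<Rightarrow>\<^sub>0 nat" and c :: int
    by (simp add: mult_single flip: single_of_int)
  then have "A (Poly_Mapping.single t c)" for t c
    using single assms(2,3) by metis
  then show ?thesis
    using A_sum[of "Poly_Mapping.keys P"] poly_mapping_sum_single[of P] by metis
qed

text \<open>The coefficients are integers, so there is no torsion. This is why Witt identities are
  proved for generic variables first and evaluated afterwards: in characteristic \<open>p\<close>
  ghost components no longer determine the coordinates.\<close>

lemma mpoly_of_nat_mult_cancel:
  fixes P Q :: "'v int_mpoly"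
  assumes "n > 0" "of_nat n * P = of_nat n * Q"
  shows "P = Q"
proof -
  have lk: "Poly_Mapping.lookup (of_nat n * P) k = int n * Poly_Mapping.lookup P k" for P :: "'v int_mpoly" and k n
    by (induction n) (simp_all add: distrib_right lookup_add)
  show ?thesis
  proof (rule poly_mapping_eqI)
    fix k
    have "int n * Poly_Mapping.lookup P k = int n * Poly_Mapping.lookup Q k"
      using assms(2) by (metis lk)
    then show "Poly_Mapping.lookup P k = Poly_Mapping.lookup Q k" using assms(1) by simp
  qed
qed

section \<open>Congruences between \<open>p\<close>-th powers and between ghost components\<close>

text \<open>In the factorisation of \<open>a ^ p - b ^ p\<close> by \<open>a - b\<close>, the
  cofactor is \<open>p * b ^ (p - 1)\<close> modulo \<open>p\<close>, because \<open>a\<close> and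
  \<open>b\<close> agree there; so it contributes one more factor \<open>p\<close>.\<close>

lemma dvd_power_diff:
  fixes a b :: "'a::comm_ring_1"
  assumes "of_nat p dvd a - b" "of_nat c dvd a - b"
  shows "of_nat (c * p) dvd a ^ p - b ^ p"
proof -
  have "of_nat p dvd a ^ i - b ^ i" for i
    using assms(1) by (metis dvd_trans dvd_triv_left power_diff_sumr2)
  then have "of_nat p dvd (\<Sum>i<p. b ^ (p - Suc i) * (a ^ i - b ^ i))"
    by (intro dvd_sum dvd_mult)
  also have "(\<Sum>i<p. b ^ (p - Suc i) * (a ^ i - b ^ i)) = (\<Sum>i<p. b ^ (p - Suc i) * a ^ i) - (\<Sum>i<p. b ^ (p - 1))"
    unfolding sum_subtractf[symmetric]
    by (rule sum.cong) (auto simp: right_diff_distrib simp flip: power_add)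
  finally have "of_nat p dvd (\<Sum>i<p. b ^ (p - Suc i) * a ^ i)"
    using dvd_add[OF _ dvd_triv_left[of "of_nat p" "b ^ (p - Suc 0)"]] by fastforce
  then have "of_nat c * of_nat p dvd (a - b) * (\<Sum>i<p. b ^ (p - Suc i) * a ^ i)"
    using assms(2) by (intro mult_dvd_mono)
  then show ?thesis by (simp add: power_diff_sumr2)
qed

lemma dvd_prime_power_diff:
  fixes a b :: "'a::comm_ring_1"
  assumes "of_nat p dvd a - b"
  shows "of_nat (p ^ Suc k) dvd a ^ (p ^ k) - b ^ (p ^ k)"
proof (induction k)
  case 0
  then show ?case using assms by simp
next
  case (Suc k)
  have "of_nat p dvd a ^ (p ^ k) - b ^ (p ^ k)"
    using assms by (metis dvd_trans dvd_triv_left power_diff_sumr2)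
  then have "of_nat (p ^ Suc k * p) dvd (a ^ (p ^ k)) ^ p - (b ^ (p ^ k)) ^ p"
    using dvd_power_diff Suc.IH by blast
  then show ?case by (simp add: mult.commute flip: power_mult)
qed

lemma ghost_split: "ghost p x n = (\<Sum>i<n. of_nat (p ^ i) * x i ^ (p ^ (n - i))) + of_nat (p ^ n) * x n"
  by (simp add: ghost_def flip: lessThan_Suc_atMost)

text \<open>The earlier coordinates enter through their \<open>p\<close>-th powers. Modulo
  \<open>p\<close> these are Frobenius images, which is how a condition linking consecutive ghost
  components arises.\<close>

lemma ghost_Suc: "ghost p x (Suc n) = ghost p (\<lambda>i. x i ^ p) n + of_nat (p ^ Suc n) * x (Suc n)"
proof -
  have "(\<Sum>i<Suc n. of_nat (p ^ i) * x i ^ (p ^ (Suc n - i))) = ghost p (\<lambda>i. x i ^ p) n"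
    unfolding ghost_def lessThan_Suc_atMost by (rule sum.cong) (auto simp: Suc_diff_le simp flip: power_mult)
  then show ?thesis by (subst ghost_split) simp
qed

lemma ghost_cong: "(\<And>i. i \<le> n \<Longrightarrow> x i = y i) \<Longrightarrow> ghost p x n = ghost p y n"
  by (simp add: ghost_def)

text \<open>The system is triangular: once the earlier coordinates agree, the \<open>n\<close>-th
  ghost component leaves \<open>p ^ n\<close> times the \<open>n\<close>-th coordinate, and
  \<open>p ^ n\<close> cancels among integer polynomials.\<close>

lemma ghost_eq_imp_eq:
  fixes A B :: "nat \<Rightarrow> 'v int_mpoly"
  assumes "p > 0" "\<And>i. i \<le> n \<Longrightarrow> ghost p A i = ghost p B i"
  shows "A n = B n"
  using assms(2)
proof (induction n rule: less_induct)
  case (less n)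
  have "A i = B i" if "i < n" for i using that less by simp
  then have "of_nat (p ^ n) * A n = of_nat (p ^ n) * B n"
    using less.prems[of n] by (simp add: ghost_split)
  then show ?case using mpoly_of_nat_mult_cancel assms(1) by (metis zero_less_power)
qed

text \<open>Coordinates congruent modulo \<open>p\<close> have \<open>p ^ (n - i)\<close>-th powers
  congruent modulo \<open>p ^ (n - i + 1)\<close>, and the weight \<open>p ^ i\<close> raises this
  to \<open>p ^ (n + 1)\<close>. What is left of the \<open>n\<close>-th ghost component is
  \<open>p ^ n * (A n - B n)\<close>, which must be divisible by \<open>p ^ (n + 1)\<close>.\<close>

lemma ghost_cong_imp_cong:
  fixes A B :: "nat \<Rightarrow> 'v int_mpoly"
  assumes "p > 0" "\<And>i. i \<le> n \<Longrightarrow> of_nat (p ^ Suc i) dvd ghost p A i - ghost p B i"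
  shows "of_nat p dvd A n - B n"
  using assms(2)
proof (induction n rule: less_induct)
  case (less n)
  have "of_nat (p ^ Suc n) dvd of_nat (p ^ i) * (A i ^ (p ^ (n - i)) - B i ^ (p ^ (n - i)))" if "i < n" for i
  proof -
    have "of_nat (p ^ Suc (n - i)) dvd A i ^ (p ^ (n - i)) - B i ^ (p ^ (n - i))"
      using less that by (intro dvd_prime_power_diff) simp
    then have "of_nat (p ^ i) * of_nat (p ^ Suc (n - i)) dvd of_nat (p ^ i) * (A i ^ (p ^ (n - i)) - B i ^ (p ^ (n - i)))"
      by (rule mult_dvd_mono[OF dvd_refl])
    then show ?thesis using that by (simp flip: of_nat_mult power_add del: power_Suc)
  qed
  then have "of_nat (p ^ Suc n) dvd (\<Sum>i<n. of_nat (p ^ i) * (A i ^ (p ^ (n - i)) - B i ^ (p ^ (n - i))))"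
    by (intro dvd_sum) auto
  moreover have "ghost p A n - ghost p B n = (\<Sum>i<n. of_nat (p ^ i) * (A i ^ (p ^ (n - i)) - B i ^ (p ^ (n - i))))
     + of_nat (p ^ n) * (A n - B n)"
    by (simp only: ghost_split right_diff_distrib sum_subtractf add_diff_add)
  ultimately have "of_nat (p ^ Suc n) dvd of_nat (p ^ n) * (A n - B n)"
    using dvd_diff[OF less.prems[OF order_refl]] by fastforce
  then obtain C where "of_nat (p ^ n) * (A n - B n) = of_nat (p ^ Suc n) * C" by (auto elim: dvdE)
  then have "of_nat (p ^ n) * (A n - B n) = of_nat (p ^ n) * (of_nat p * C)"
    by (simp add: mult.assoc mult.commute mult.left_commute)
  then have "A n - B n = of_nat p * C"
    using mpoly_of_nat_mult_cancel assms(1) by (metis zero_less_power)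
  then show ?case by simp
qed

section \<open>Dwork's criterion and the existence of the Witt polynomials\<close>

text \<open>The lift of Frobenius to integer polynomials: a ring endomorphism that agrees with the
  \<open>p\<close>-th power map modulo \<open>p\<close>.\<close>

definition frob_subst :: "nat \<Rightarrow> 'v int_mpoly \<Rightarrow> 'v int_mpoly" where
  "frob_subst p = mpoly_eval (\<lambda>v. mpoly_var v ^ p)"

interpretation frob_subst: comm_ring_map "frob_subst p"
  unfolding frob_subst_def by (rule comm_ring_map_mpoly_eval)

lemma prime_dvd_add_power_diff:
  fixes a b :: "'a::comm_ring_1"
  assumes "prime p"
  shows "of_nat p dvd (a + b) ^ p - (a ^ p + b ^ p)"
proof -
  have p: "p > 0" using assms prime_gt_0_nat by blast
  have "(a + b) ^ p = (\<Sum>k\<le>p. of_nat (p choose k) * a ^ k * b ^ (p - k))" by (rule binomial_ring)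
  also have "{..p} = insert 0 (insert p {1..<p})" using p by auto
  also have "(\<Sum>k\<in>\<dots>. of_nat (p choose k) * a ^ k * b ^ (p - k)) =
     b ^ p + (a ^ p + (\<Sum>k=1..<p. of_nat (p choose k) * a ^ k * b ^ (p - k)))"
    using p by simp
  finally have "(a + b) ^ p - (a ^ p + b ^ p) = (\<Sum>k=1..<p. of_nat (p choose k) * a ^ k * b ^ (p - k))" by simp
  moreover have "of_nat p dvd (of_nat (p choose k) * a ^ k * b ^ (p - k) :: 'a)" if "k \<in> {1..<p}" for k
  proof -
    have "p dvd (p choose k)" using that assms by (intro dvd_choose_prime) auto
    then obtain c where "p choose k = p * c" by (auto elim: dvdE)
    then have "(of_nat p :: 'a) dvd of_nat (p choose k)" by simp
    then show ?thesis by (simp add: mult.assoc)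
  qed
  ultimately show ?thesis by (simp only: dvd_sum)
qed

lemma fermat_int:
  assumes "prime p"
  shows "int p dvd c ^ p - c"
proof -
  have p: "p > 0" using assms prime_gt_0_nat by blast
  have nat: "int p dvd int n ^ p - int n" for n
  proof (induction n)
    case 0
    then show ?case using p by (simp add: power_0_left)
  next
    case (Suc n)
    have "int p dvd ((int n + 1) ^ p - (int n ^ p + 1 ^ p)) + (int n ^ p - int n)"
      using prime_dvd_add_power_diff[OF assms, of "int n" 1] Suc.IH by (intro dvd_add) auto
    then show ?case by (simp add: algebra_simps)
  qed
  define n where "n = nat (c mod int p)"
  have n: "int n = c mod int p" using p by (simp add: n_def)
  have d: "int p dvd c - int n" by (simp add: n minus_mod_eq_mult_div)
  then have "int p dvd c ^ p - int n ^ p"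
    by (metis dvd_trans dvd_triv_left power_diff_sumr2)
  then have "int p dvd (c ^ p - int n ^ p) + (int n ^ p - int n) - (c - int n)"
    by (rule dvd_diff[OF dvd_add[OF _ nat] d])
  then show ?thesis by simp
qed

text \<open>Modulo \<open>p\<close> both sides are additive and multiplicative in \<open>P\<close>.
  On constants the claim is Fermat's little theorem, on variables it is an equality.\<close>

lemma dvd_power_diff_frob_subst:
  assumes "prime p"
  shows "of_nat p dvd P ^ p - frob_subst p P"
proof (induction P rule: mpoly_induct)
  case (add P Q)
  have "of_nat p dvd ((P + Q) ^ p - (P ^ p + Q ^ p)) + (P ^ p - frob_subst p P) + (Q ^ p - frob_subst p Q)"
    using add by (intro dvd_add prime_dvd_add_power_diff assms)
  then show ?case by (simp add: frob_subst.map_add algebra_simps)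
next
  case (mult P Q)
  have "of_nat p dvd (P ^ p - frob_subst p P) * Q ^ p + frob_subst p P * (Q ^ p - frob_subst p Q)"
    using mult by (intro dvd_add dvd_mult dvd_mult2)
  then show ?case by (simp add: frob_subst.map_mult algebra_simps power_mult_distrib)
next
  case (const c)
  obtain z where "c ^ p - c = int p * z" using fermat_int[OF assms, of c] by (auto elim: dvdE)
  then have "of_int (c ^ p - c) = (of_nat p * of_int z :: 'a int_mpoly)" by simp
  then show ?case by (simp add: frob_subst.map_of_int)
next
  case (var v)
  then show ?case by (simp add: frob_subst_def)
qed

lemma ghost_cong_frob_subst:
  fixes S :: "nat \<Rightarrow> 'v int_mpoly"
  assumes "prime p"
  shows "of_nat (p ^ Suc n) dvd ghost p (\<lambda>i. S i ^ p) n - frob_subst p (ghost p S n)"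
proof -
  have "of_nat (p ^ Suc n) dvd of_nat (p ^ i) * ((S i ^ p) ^ (p ^ (n - i)) - frob_subst p (S i) ^ (p ^ (n - i)))"
    if "i \<le> n" for i
  proof -
    have "of_nat (p ^ Suc (n - i)) dvd (S i ^ p) ^ (p ^ (n - i)) - frob_subst p (S i) ^ (p ^ (n - i))"
      by (intro dvd_prime_power_diff dvd_power_diff_frob_subst assms)
    then have "of_nat (p ^ i) * of_nat (p ^ Suc (n - i)) dvd
      of_nat (p ^ i) * ((S i ^ p) ^ (p ^ (n - i)) - frob_subst p (S i) ^ (p ^ (n - i)))"
      by (rule mult_dvd_mono[OF dvd_refl])
    then show ?thesis using that by (simp flip: of_nat_mult power_add del: power_Suc)
  qed
  then have "of_nat (p ^ Suc n) dvd
      (\<Sum>i\<le>n. of_nat (p ^ i) * ((S i ^ p) ^ (p ^ (n - i)) - frob_subst p (S i) ^ (p ^ (n - i))))"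
    by (intro dvd_sum) auto
  then show ?thesis
    unfolding frob_subst.map_ghost by (simp only: ghost_def right_diff_distrib sum_subtractf)
qed

text \<open>This is Dwork's criterion. With the coordinates up to \<open>N\<close> found, the
  congruence for \<open>frob_subst\<close> makes the defect
  \<open>T (Suc N) - ghost p (\<lambda>i. S i ^ p) N\<close> divisible by \<open>p ^ Suc N\<close>,
  and the quotient is the next coordinate.\<close>

lemma dwork_lemma:
  fixes T :: "nat \<Rightarrow> 'v int_mpoly"
  assumes "prime p" and T: "\<And>n. of_nat (p ^ Suc n) dvd T (Suc n) - frob_subst p (T n)"
  shows "\<exists>S. \<forall>n. ghost p S n = T n"
proof -
  have p: "p > 0" using assms prime_gt_0_nat by blast
  have "\<exists>S. \<forall>n\<le>N. ghost p S n = T n" for N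
  proof (induction N)
    case 0
    have "ghost p T 0 = T 0" by (simp add: ghost_def)
    then show ?case by auto
  next
    case (Suc N)
    then obtain S where S: "\<And>n. n \<le> N \<Longrightarrow> ghost p S n = T n" by auto
    have "of_nat (p ^ Suc N) dvd
      (T (Suc N) - frob_subst p (T N)) - (ghost p (\<lambda>i. S i ^ p) N - frob_subst p (ghost p S N))"
      using dvd_diff[OF T ghost_cong_frob_subst[OF assms(1)]] .
    then have "of_nat (p ^ Suc N) dvd T (Suc N) - ghost p (\<lambda>i. S i ^ p) N"
      using S by simp
    then obtain c where c: "T (Suc N) - ghost p (\<lambda>i. S i ^ p) N = of_nat (p ^ Suc N) * c" by (auto elim: dvdE)
    define S' where "S' = S(Suc N := c)"
    have "ghost p S' n = ghost p S n" if "n \<le> N" for n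
      using that by (intro ghost_cong) (auto simp: S'_def)
    moreover have "ghost p (\<lambda>i. S' i ^ p) N = ghost p (\<lambda>i. S i ^ p) N"
      by (intro ghost_cong) (auto simp: S'_def)
    then have "ghost p S' (Suc N) = T (Suc N)"
      using c by (simp add: ghost_Suc S'_def algebra_simps)
    ultimately show ?case using S by (metis le_Suc_eq)
  qed
  \<comment> \<open>Each \<open>S N\<close> is correct only up to \<open>N\<close>, and the choices
    for different \<open>N\<close> are unrelated until uniqueness identifies them on common indices;
    the diagonal is then correct everywhere.\<close>
  then have "\<exists>S. \<forall>N. \<forall>n\<le>N. ghost p (S N) n = T n" by (intro choice) blast
  then obtain S where S: "\<And>N n. n \<le> N \<Longrightarrow> ghost p (S N) n = T n" by blast
  have diag: "S n i = S i i" if "i \<le> n" for n i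
    by (rule ghost_eq_imp_eq[OF p, of i "S n" "S i"]) (use that S in auto)
  have "ghost p (\<lambda>i. S i i) n = ghost p (S n) n" for n
    by (rule ghost_cong) (rule diag[symmetric])
  then have "\<forall>n. ghost p (\<lambda>i. S i i) n = T n" using S by simp
  then show ?thesis by (intro exI[of _ "\<lambda>i. S i i"])
qed

lemma ex1_ghost_eq:
  fixes T :: "nat \<Rightarrow> 'v int_mpoly"
  assumes "prime p" and "\<And>n. of_nat (p ^ Suc n) dvd T (Suc n) - frob_subst p (T n)"
  shows "\<exists>!S. \<forall>n. ghost p S n = T n"
  using dwork_lemma[OF assms] ghost_eq_imp_eq[OF prime_gt_0_nat[OF assms(1)]]
  by (metis ext)

lemma ghost_var_Suc:
  "ghost p (\<lambda>i. mpoly_var (f i)) (Suc n) =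
    frob_subst p (ghost p (\<lambda>i. mpoly_var (f i)) n) + of_nat (p ^ Suc n) * mpoly_var (f (Suc n))"
  unfolding ghost_Suc frob_subst.map_ghost by (simp add: frob_subst_def)

text \<open>A definite description gives no information before existence and uniqueness are known.
  By \<open>ghost_var_Suc\<close> the Frobenius lift misses the next ghost component of generic
  variables by \<open>p ^ Suc n\<close> times the new variable, and this divisibility of the error
  survives addition.\<close>

lemma ghost_witt_add_poly:
  assumes "prime p"
  shows "ghost p (witt_add_poly p) n =
    ghost p (\<lambda>i. mpoly_var (Inl i)) n + ghost p (\<lambda>i. mpoly_var (Inr i)) n"
proof -
  let ?T = "\<lambda>n. ghost p (\<lambda>i. mpoly_var (Inl i)) n + ghost p (\<lambda>i. mpoly_var (Inr i)) n :: (nat + nat) int_mpoly"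
  have "?T (Suc n) - frob_subst p (?T n) = of_nat (p ^ Suc n) * (mpoly_var (Inl (Suc n)) + mpoly_var (Inr (Suc n)))" for n
  proof -
    have "(a + m * x + (b + m * y)) - (a + b) = m * (x + y)" for a b m x y :: "(nat + nat) int_mpoly"
      by (simp add: algebra_simps)
    then show ?thesis by (simp only: ghost_var_Suc frob_subst.map_add)
  qed
  then have "\<exists>!S. \<forall>n. ghost p S n = ?T n"
    by (intro ex1_ghost_eq assms) (metis dvd_triv_left)
  from theI'[OF this] show ?thesis unfolding witt_add_poly_def by blast
qed

lemma ghost_witt_mult_poly:
  assumes "prime p"
  shows "ghost p (witt_mult_poly p) n =
    ghost p (\<lambda>i. mpoly_var (Inl i)) n * ghost p (\<lambda>i. mpoly_var (Inr i)) n"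
proof -
  let ?X = "\<lambda>n. ghost p (\<lambda>i. mpoly_var (Inl i)) n :: (nat + nat) int_mpoly"
  let ?Y = "\<lambda>n. ghost p (\<lambda>i. mpoly_var (Inr i)) n :: (nat + nat) int_mpoly"
  let ?T = "\<lambda>n. ?X n * ?Y n"
  have "?T (Suc n) - frob_subst p (?T n) = of_nat (p ^ Suc n) *
     (mpoly_var (Inl (Suc n)) * ?Y (Suc n) + frob_subst p (?X n) * mpoly_var (Inr (Suc n)))" for n
  proof -
    \<comment> \<open>With \<open>m\<close> standing for \<open>p ^ Suc n\<close>, every term beyond
      \<open>a * b\<close> contains \<open>m\<close>, which is Dwork's condition for
      products.\<close>
    have "(a + m * x) * (b + m * y) - a * b = m * (x * (b + m * y) + a * y)" for a b m x y :: "(nat + nat) int_mpoly"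
      by (simp add: algebra_simps)
    then show ?thesis by (simp only: ghost_var_Suc frob_subst.map_mult)
  qed
  then have "\<exists>!S. \<forall>n. ghost p S n = ?T n"
    by (intro ex1_ghost_eq assms) (metis dvd_triv_left)
  from theI'[OF this] show ?thesis unfolding witt_mult_poly_def by blast
qed

section \<open>The ghost map, functoriality and multiplication by \<open>p\<close>\<close>

lemma carrier_Witt [simp]: "carrier (Witt p) = UNIV"
  by (simp add: Witt_def)

lemma ghost_Witt_add:
  fixes x y :: "nat \<Rightarrow> 'a::comm_ring_1"
  assumes "prime p"
  shows "ghost p (x \<oplus>\<^bsub>Witt p\<^esub> y) n = ghost p x n + ghost p y n"
proof -
  interpret h: comm_ring_map "mpoly_eval (case_sum x y)" by (rule comm_ring_map_mpoly_eval)
  have "ghost p (x \<oplus>\<^bsub>Witt p\<^esub> y) n = mpoly_eval (case_sum x y) (ghost p (witt_add_poly p) n)"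
    by (simp add: Witt_def h.map_ghost)
  also have "\<dots> = ghost p x n + ghost p y n"
    by (simp add: ghost_witt_add_poly[OF assms] h.map_add h.map_ghost)
  finally show ?thesis .
qed

lemma ghost_Witt_mult:
  fixes x y :: "nat \<Rightarrow> 'a::comm_ring_1"
  assumes "prime p"
  shows "ghost p (x \<otimes>\<^bsub>Witt p\<^esub> y) n = ghost p x n * ghost p y n"
proof -
  interpret h: comm_ring_map "mpoly_eval (case_sum x y)" by (rule comm_ring_map_mpoly_eval)
  have "ghost p (x \<otimes>\<^bsub>Witt p\<^esub> y) n = mpoly_eval (case_sum x y) (ghost p (witt_mult_poly p) n)"
    by (simp add: Witt_def h.map_ghost)
  also have "\<dots> = ghost p x n * ghost p y n"
    by (simp add: ghost_witt_mult_poly[OF assms] h.map_mult h.map_ghost)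
  finally show ?thesis .
qed

lemma case_sum_comp: "(\<lambda>v. h (case_sum x y v)) = case_sum (\<lambda>i. h (x i)) (\<lambda>i. h (y i))"
  by (auto simp: fun_eq_iff split: sum.split)

text \<open>The coordinates of a sum are fixed integer polynomials in the given coordinates. The
  uses are Frobenius in characteristic \<open>p\<close> and the evaluation of generic Witt
  vectors.\<close>

lemma (in comm_ring_map) map_Witt_add:
  "(\<lambda>n. h ((x \<oplus>\<^bsub>Witt p\<^esub> y) n)) = (\<lambda>n. h (x n)) \<oplus>\<^bsub>Witt p\<^esub> (\<lambda>n. h (y n))"
  by (simp add: Witt_def map_mpoly_eval case_sum_comp)

lemma (in comm_ring_map) map_Witt_mult:
  "(\<lambda>n. h ((x \<otimes>\<^bsub>Witt p\<^esub> y) n)) = (\<lambda>n. h (x n)) \<otimes>\<^bsub>Witt p\<^esub> (\<lambda>n. h (y n))"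
  by (simp add: Witt_def map_mpoly_eval case_sum_comp)

text \<open>Together with the successor form this unfolds multiples in an arbitrary record. No group
  axioms are assumed, so it applies to Witt vectors over polynomial rings.\<close>

lemma add_pow_0: "[(0::nat)] \<cdot>\<^bsub>R\<^esub> x = \<zero>\<^bsub>R\<^esub>"
  by (simp add: add_pow_def nat_pow_def)

lemma add_pow_Suc: "[Suc n] \<cdot>\<^bsub>R\<^esub> x = [n] \<cdot>\<^bsub>R\<^esub> x \<oplus>\<^bsub>R\<^esub> x"
  by (simp add: add_pow_def nat_pow_def)

lemma ghost_Witt_zero: "p > 0 \<Longrightarrow> ghost p \<zero>\<^bsub>Witt p\<^esub> n = 0"
  by (simp add: ghost_def Witt_def power_0_left)

lemma ghost_Witt_add_pow:
  "prime p \<Longrightarrow> ghost p ([k] \<cdot>\<^bsub>Witt p\<^esub> x) n = of_nat k * ghost p x n"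
  by (induction k) (simp_all add: add_pow_0 add_pow_Suc ghost_Witt_zero ghost_Witt_add prime_gt_0_nat algebra_simps)

lemma (in comm_ring_map) map_Witt_add_pow:
  "(\<lambda>n. h (([(k::nat)] \<cdot>\<^bsub>Witt p\<^esub> x) n)) = [k] \<cdot>\<^bsub>Witt p\<^esub> (\<lambda>n. h (x n))"
proof (induction k)
  case 0
  then show ?case by (simp add: add_pow_0 Witt_def map_zero)
qed (simp add: add_pow_Suc map_Witt_add)

text \<open>The identity \<open>p = VF\<close> in characteristic \<open>p\<close>. For generic
  coordinates the \<open>n\<close>-th ghost components of \<open>A\<close> and \<open>B\<close>
  differ by \<open>p ^ Suc n * X n\<close>, so the coordinates agree modulo \<open>p\<close>;
  evaluation in a ring where \<open>p\<close> vanishes gives equality.\<close>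

lemma Witt_prime_multiple:
  fixes x :: "nat \<Rightarrow> 'a::comm_ring_1"
  assumes p: "prime p" and char: "of_nat p = (0 :: 'a)"
  shows "[p] \<cdot>\<^bsub>Witt p\<^esub> x = case_nat 0 (\<lambda>n. x n ^ p)"
proof
  fix n
  interpret h: comm_ring_map "mpoly_eval x" by (rule comm_ring_map_mpoly_eval)
  define X :: "nat \<Rightarrow> nat int_mpoly" where "X = mpoly_var"
  define A where "A = [p] \<cdot>\<^bsub>Witt p\<^esub> X"
  define B where "B = case_nat 0 (\<lambda>n. X n ^ p)"
  have p0: "p > 0" using p prime_gt_0_nat by blast
  have "of_nat (p ^ Suc i) dvd ghost p A i - ghost p B i" for i
  proof (cases i)
    case 0
    then show ?thesis using p by (simp add: A_def ghost_Witt_add_pow B_def) (simp add: ghost_def)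
  next
    case (Suc m)
    have gB: "ghost p B (Suc m) = of_nat p * ghost p (\<lambda>i. X i ^ p) m"
      using p0 by (simp add: ghost_def B_def sum.atMost_Suc_shift sum_distrib_left mult.assoc del: sum.atMost_Suc)
    then have "ghost p A i - ghost p B i = of_nat (p ^ Suc i) * X i"
      unfolding Suc gB A_def by (simp only: ghost_Witt_add_pow p) (simp add: ghost_Suc algebra_simps)
    then show ?thesis by simp
  qed
  then have "of_nat p dvd A n - B n" by (intro ghost_cong_imp_cong[OF p0, of n A B])
  then obtain C where "A n - B n = of_nat p * C" by (auto elim: dvdE)
  then have "mpoly_eval x (A n) - mpoly_eval x (B n) = 0"
    by (simp add: h.map_mult h.map_of_nat char flip: h.map_diff)
  moreover have "mpoly_eval x (A n) = ([p] \<cdot>\<^bsub>Witt p\<^esub> x) n"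
    using fun_cong[OF h.map_Witt_add_pow[of p p X], of n] by (simp add: A_def X_def)
  moreover have "mpoly_eval x (B n) = case_nat 0 (\<lambda>n. x n ^ p) n"
    by (simp add: B_def X_def h.map_power h.map_zero split: nat.split)
  ultimately show "([p] \<cdot>\<^bsub>Witt p\<^esub> x) n = case_nat 0 (\<lambda>n. x n ^ p) n" by simp
qed

section \<open>Solving \<open>x y = z\<close> coordinate by coordinate\<close>

lemma Witt_add_0: "prime p \<Longrightarrow> (x \<oplus>\<^bsub>Witt p\<^esub> y) 0 = x 0 + y 0"
  using ghost_Witt_add[of p x y 0] by (simp add: ghost_def)

text \<open>Ghost components up to \<open>n\<close> do not see later coordinates, and over integer
  polynomials they determine the coordinates up to \<open>n\<close>. This lets an infinite vector be
  replaced by a finite stage of its construction.\<close>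

lemma Witt_mult_cong:
  fixes x y :: "nat \<Rightarrow> 'a::comm_ring_1"
  assumes p: "prime p" and eq: "\<And>i. i \<le> n \<Longrightarrow> y i = y' i"
  shows "(x \<otimes>\<^bsub>Witt p\<^esub> y) n = (x \<otimes>\<^bsub>Witt p\<^esub> y') n"
proof -
  define X :: "nat \<Rightarrow> (nat + nat) int_mpoly" where "X = (\<lambda>i. mpoly_var (Inl i))"
  define Y :: "nat \<Rightarrow> (nat + nat) int_mpoly" where "Y = (\<lambda>i. mpoly_var (Inr i))"
  define Z where "Z = (\<lambda>i. if i \<le> n then Y i else 0)"
  have "ghost p Y i = ghost p Z i" if "i \<le> n" for i
    using that by (intro ghost_cong) (auto simp: Z_def)
  then have XYZ: "(X \<otimes>\<^bsub>Witt p\<^esub> Y) n = (X \<otimes>\<^bsub>Witt p\<^esub> Z) n"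
    using p by (intro ghost_eq_imp_eq[OF prime_gt_0_nat, of p n "X \<otimes>\<^bsub>Witt p\<^esub> Y" "X \<otimes>\<^bsub>Witt p\<^esub> Z"]) (auto simp: ghost_Witt_mult)
  \<comment> \<open>The generic identity is evaluated at \<open>x\<close> and \<open>z\<close>; the
    truncated generic vector becomes the truncation of \<open>z\<close>.\<close>
  have trunc: "(x \<otimes>\<^bsub>Witt p\<^esub> z) n = (x \<otimes>\<^bsub>Witt p\<^esub> (\<lambda>i. if i \<le> n then z i else 0)) n" for z
  proof -
    interpret h: comm_ring_map "mpoly_eval (case_sum x z)" by (rule comm_ring_map_mpoly_eval)
    have "mpoly_eval (case_sum x z) ((X \<otimes>\<^bsub>Witt p\<^esub> Y) n) = (x \<otimes>\<^bsub>Witt p\<^esub> z) n"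
      using fun_cong[OF h.map_Witt_mult[of p X Y], of n] by (simp add: X_def Y_def)
    moreover have "(\<lambda>i. mpoly_eval (case_sum x z) (Z i)) = (\<lambda>i. if i \<le> n then z i else 0)"
      by (auto simp: Z_def Y_def h.map_zero)
    then have "mpoly_eval (case_sum x z) ((X \<otimes>\<^bsub>Witt p\<^esub> Z) n) = (x \<otimes>\<^bsub>Witt p\<^esub> (\<lambda>i. if i \<le> n then z i else 0)) n"
      using fun_cong[OF h.map_Witt_mult[of p X Z], of n] by (simp add: X_def)
    ultimately show ?thesis by (simp add: XYZ)
  qed
  have "(\<lambda>i. if i \<le> n then y i else 0) = (\<lambda>i. if i \<le> n then y' i else 0)" using eq by auto
  then show ?thesis using trunc[of y] trunc[of y'] by simp
qed

text \<open>Setting the \<open>n\<close>-th coordinate of \<open>y\<close> to zero lowers its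
  \<open>n\<close>-th ghost component by \<open>p ^ n * y n\<close> and leaves the earlier ones
  alone. Multiplying by the ghost component of \<open>x\<close> and cancelling \<open>p ^ n\<close>
  shows that \<open>y n\<close> enters linearly.\<close>

lemma Witt_mult_upd:
  fixes x y :: "nat \<Rightarrow> 'a::comm_ring_1"
  assumes p: "prime p"
  shows "(x \<otimes>\<^bsub>Witt p\<^esub> y) n = ghost p x n * y n + (x \<otimes>\<^bsub>Witt p\<^esub> y(n := 0)) n"
proof -
  interpret h: comm_ring_map "mpoly_eval (case_sum x y)" by (rule comm_ring_map_mpoly_eval)
  define X :: "nat \<Rightarrow> (nat + nat) int_mpoly" where "X = (\<lambda>i. mpoly_var (Inl i))"
  define Y :: "nat \<Rightarrow> (nat + nat) int_mpoly" where "Y = (\<lambda>i. mpoly_var (Inr i))"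
  let ?A = "X \<otimes>\<^bsub>Witt p\<^esub> Y" and ?B = "X \<otimes>\<^bsub>Witt p\<^esub> Y(n := 0)"
  have p0: "p > 0" using p prime_gt_0_nat by blast
  have gY: "ghost p Y i = ghost p (Y(n := 0)) i" if "i < n" for i
    using that by (intro ghost_cong) auto
  have AB: "?A i = ?B i" if "i < n" for i
    using that gY by (intro ghost_eq_imp_eq[OF p0, of i ?A ?B]) (auto simp: ghost_Witt_mult p)
  have "of_nat (p ^ n) * ?A n - of_nat (p ^ n) * ?B n = ghost p ?A n - ghost p ?B n"
    by (simp add: ghost_split AB)
  also have "\<dots> = ghost p X n * (ghost p Y n - ghost p (Y(n := 0)) n)"
    by (simp add: ghost_Witt_mult p algebra_simps)
  also have "\<dots> = of_nat (p ^ n) * (ghost p X n * Y n)"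
    by (simp add: ghost_split)
  finally have "of_nat (p ^ n) * ?A n = of_nat (p ^ n) * (ghost p X n * Y n + ?B n)"
    by (simp add: algebra_simps)
  then have "?A n = ghost p X n * Y n + ?B n"
    using mpoly_of_nat_mult_cancel p0 by (metis zero_less_power)
  then have "mpoly_eval (case_sum x y) (?A n) = mpoly_eval (case_sum x y) (ghost p X n * Y n + ?B n)" by simp
  moreover have "mpoly_eval (case_sum x y) (?A n) = (x \<otimes>\<^bsub>Witt p\<^esub> y) n"
    using fun_cong[OF h.map_Witt_mult[of p X Y], of n] by (simp add: X_def Y_def)
  moreover have "(\<lambda>i. mpoly_eval (case_sum x y) ((Y(n := 0)) i)) = y(n := 0)"
    by (auto simp: Y_def h.map_zero)
  then have "mpoly_eval (case_sum x y) (?B n) = (x \<otimes>\<^bsub>Witt p\<^esub> y(n := 0)) n"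
    using fun_cong[OF h.map_Witt_mult[of p X "Y(n := 0)"], of n] by (simp add: X_def)
  ultimately show ?thesis by (simp add: h.map_add h.map_mult h.map_ghost) (simp add: X_def Y_def)
qed

lemma Witt_right_inverse:
  fixes x :: "nat \<Rightarrow> 'a::field"
  assumes p: "prime p" and char: "of_nat p = (0 :: 'a)" and x: "x 0 \<noteq> 0"
  shows "\<exists>y. x \<otimes>\<^bsub>Witt p\<^esub> y = z"
proof -
  \<comment> \<open>In characteristic \<open>p\<close> only the term with index 0 survives, which is
    a power of \<open>x 0\<close>.\<close>
  have g: "ghost p x n \<noteq> 0" for n
  proof -
    have "{..n} = insert 0 {1..n}" by auto
    then have "ghost p x n = x 0 ^ (p ^ n) + (\<Sum>i=1..n. of_nat (p ^ i) * x i ^ (p ^ (n - i)))"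
      unfolding ghost_def by (simp del: of_nat_power)
    also have "(\<Sum>i=1..n. of_nat (p ^ i) * x i ^ (p ^ (n - i))) = 0"
      by (rule sum.neutral) (auto simp: char)
    finally show ?thesis using x by simp
  qed
  \<comment> \<open>\<open>a n\<close> holds the first \<open>n\<close> coordinates of the quotient
    and zeros beyond. The zero in position \<open>n\<close> makes \<open>a n\<close> the vector
    without the linear term, so the new coordinate solves one linear equation with coefficient
    \<open>ghost p x n\<close>.\<close>
  define a where "a = rec_nat (\<lambda>_. 0) (\<lambda>n y. y(n := (z n - (x \<otimes>\<^bsub>Witt p\<^esub> y) n) / ghost p x n))"
  have a_Suc: "a (Suc n) = (a n)(n := (z n - (x \<otimes>\<^bsub>Witt p\<^esub> a n) n) / ghost p x n)" for n
    by (simp add: a_def)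
  have a_ge: "a n i = 0" if "n \<le> i" for n i
    using that by (induction n) (auto simp: a_Suc, simp add: a_def)
  have a_lt: "a (Suc m) i = a (Suc i) i" if "i \<le> m" for m i
    using that by (induction m) (auto simp: a_Suc le_Suc_eq)
  have "(x \<otimes>\<^bsub>Witt p\<^esub> (\<lambda>i. a (Suc i) i)) n = z n" for n
  proof -
    have "(x \<otimes>\<^bsub>Witt p\<^esub> (\<lambda>i. a (Suc i) i)) n = (x \<otimes>\<^bsub>Witt p\<^esub> a (Suc n)) n"
      using a_lt by (intro Witt_mult_cong p) metis
    also have "\<dots> = ghost p x n * a (Suc n) n + (x \<otimes>\<^bsub>Witt p\<^esub> (a (Suc n))(n := 0)) n"
      by (rule Witt_mult_upd[OF p])
    also have "(a (Suc n))(n := 0) = a n" using a_ge[of n n] by (auto simp: a_Suc)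
    also have "ghost p x n * a (Suc n) n + (x \<otimes>\<^bsub>Witt p\<^esub> a n) n = z n"
      using g[of n] by (simp add: a_Suc)
    finally show ?thesis .
  qed
  then show ?thesis by blast
qed

section \<open>Frobenius in characteristic \<open>p\<close> and over algebraically closed
  fields\<close>

lemma comm_ring_map_power_char:
  assumes "prime p" "CHAR('a::comm_ring_1) = p"
  shows "comm_ring_map (\<lambda>x::'a. x ^ p)"
proof
  fix x y :: 'a
  obtain c where "(x + y) ^ p - (x ^ p + y ^ p) = of_nat p * c"
    using prime_dvd_add_power_diff[OF assms(1), of x y] by (auto elim: dvdE)
  then show "(x + y) ^ p = x ^ p + y ^ p" using assms(2) of_nat_CHAR[where 'a='a] by simp
qed (auto simp: power_mult_distrib)

lemma witt_frob_add:
  assumes "prime p" "CHAR('a::comm_ring_1) = p"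
  shows "witt_frob p (x \<oplus>\<^bsub>Witt p\<^esub> y) = witt_frob p x \<oplus>\<^bsub>Witt p\<^esub> (witt_frob p (y :: nat \<Rightarrow> 'a))"
  using comm_ring_map.map_Witt_add[OF comm_ring_map_power_char[OF assms]] by (simp add: witt_frob_def)

lemma witt_frob_mult:
  assumes "prime p" "CHAR('a::comm_ring_1) = p"
  shows "witt_frob p (x \<otimes>\<^bsub>Witt p\<^esub> y) = witt_frob p x \<otimes>\<^bsub>Witt p\<^esub> (witt_frob p (y :: nat \<Rightarrow> 'a))"
  using comm_ring_map.map_Witt_mult[OF comm_ring_map_power_char[OF assms]] by (simp add: witt_frob_def)

lemma witt_frob_one: "p > 0 \<Longrightarrow> witt_frob p \<one>\<^bsub>Witt p\<^esub> = \<one>\<^bsub>Witt p\<^esub>"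
  by (auto simp: witt_frob_def Witt_def power_0_left fun_eq_iff)

lemma poly_surj:
  fixes P :: "'a::alg_closed_field poly"
  assumes "degree P > 0"
  shows "\<exists>x. poly P x = c"
proof -
  have "degree (P - [:c:]) > 0" using assms by (cases P) (auto split: if_splits)
  then obtain x where "poly (P - [:c:]) x = 0" using alg_closed_imp_poly_has_root by blast
  then show ?thesis by auto
qed

lemma power_surj: "n > 0 \<Longrightarrow> \<exists>x. x ^ n = (c :: 'a::alg_closed_field)"
  using poly_surj[of "monom 1 n" c] by (auto simp: degree_monom_eq poly_monom)

lemma power_char_inj:
  assumes "prime p" "CHAR('a::field) = p" "x ^ p = (y :: 'a) ^ p"
  shows "x = y"
proof -
  interpret comm_ring_map "\<lambda>x::'a. x ^ p" using assms by (intro comm_ring_map_power_char)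
  have "(x - y) ^ p = 0" using assms(3) map_diff[of x y] by simp
  then show ?thesis by simp
qed

lemma bij_witt_frob:
  assumes "prime p" "CHAR('a::alg_closed_field) = p"
  shows "bij (witt_frob p :: (nat \<Rightarrow> 'a) \<Rightarrow> _)"
proof (rule bijI)
  show "inj (witt_frob p :: (nat \<Rightarrow> 'a) \<Rightarrow> _)"
    by (rule injI) (auto simp: witt_frob_def fun_eq_iff intro: power_char_inj[OF assms])
  show "surj (witt_frob p :: (nat \<Rightarrow> 'a) \<Rightarrow> _)"
  proof (rule surjI)
    fix y :: "nat \<Rightarrow> 'a"
    show "witt_frob p (\<lambda>n. SOME x. x ^ p = y n) = y"
      using someI_ex[OF power_surj[OF prime_gt_0_nat[OF assms(1)]]] by (auto simp: witt_frob_def)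
  qed
qed

text \<open>The element comes from an Artin-Schreier equation. If \<open>e ^ (p - 1) = -1\<close>,
  then \<open>e ^ p = - e\<close>; a root of \<open>z ^ p - z = e\<close> satisfies
  \<open>z ^ p = z + e\<close>, and a second Frobenius takes \<open>e\<close> away again. As
  \<open>e\<close> is nonzero, the first one moves \<open>z\<close>.\<close>

lemma ex_frobenius_order_two:
  assumes p: "prime p" "CHAR('a::alg_closed_field) = p"
  shows "\<exists>z::'a. (z ^ p) ^ p = z \<and> z ^ p \<noteq> z"
proof -
  interpret comm_ring_map "\<lambda>x::'a. x ^ p" using p by (intro comm_ring_map_power_char)
  have p1: "p > 1" using p prime_gt_1_nat by blast
  obtain e :: 'a where e: "e ^ (p - 1) = -1" using power_surj[of "p - 1"] p1 by auto
  have ep: "e ^ p = - e" using e p1 power_Suc[of e "p - 1"] by simp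
  have e0: "e \<noteq> 0" using e p1 by (auto simp: power_0_left)
  have "degree (monom 1 p - monom 1 1 :: 'a poly) = p"
    using p1 by (intro antisym degree_le le_degree) (auto simp: coeff_diff)
  then obtain z where "poly (monom 1 p - monom 1 1) z = e"
    using poly_surj[of "monom 1 p - monom 1 1" e] p1 by auto
  then have z: "z ^ p - z = e" by (simp add: poly_monom)
  then have "z ^ p = z + e" by (simp add: algebra_simps)
  moreover have "(z + e) ^ p = z ^ p + e ^ p" using map_add by simp
  ultimately have "(z ^ p) ^ p = z" using ep by simp
  then show ?thesis using z e0 by auto
qed

section \<open>The lattice argument\<close>

lemma semilinear_mapsI:
  assumes "\<And>u. u \<in> carrier M \<Longrightarrow> f u \<in> carrier N"
    and "\<And>u v. u \<in> carrier M \<Longrightarrow> v \<in> carrier M \<Longrightarrow> f (u \<oplus>\<^bsub>M\<^esub> v) = f u \<oplus>\<^bsub>N\<^esub> f v"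
    and "\<And>a u. a \<in> carrier R \<Longrightarrow> u \<in> carrier M \<Longrightarrow> f (a \<odot>\<^bsub>M\<^esub> u) = s a \<odot>\<^bsub>N\<^esub> f u"
  shows "f \<in> semilinear_maps R s M N"
  using assms by (auto simp: semilinear_maps_def)

lemma semilinear_mapsD:
  assumes "f \<in> semilinear_maps R s M N"
  shows "u \<in> carrier M \<Longrightarrow> f u \<in> carrier N"
    and "u \<in> carrier M \<Longrightarrow> v \<in> carrier M \<Longrightarrow> f (u \<oplus>\<^bsub>M\<^esub> v) = f u \<oplus>\<^bsub>N\<^esub> f v"
    and "a \<in> carrier R \<Longrightarrow> u \<in> carrier M \<Longrightarrow> f (a \<odot>\<^bsub>M\<^esub> u) = s a \<odot>\<^bsub>N\<^esub> f u"
  using assms by (auto simp: semilinear_maps_def)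

lemma End_memI:
  assumes "f \<in> extensional (carrier M)"
    and "\<And>u. u \<in> carrier M \<Longrightarrow> f u \<in> carrier M"
    and "\<And>u v. u \<in> carrier M \<Longrightarrow> v \<in> carrier M \<Longrightarrow> f (u \<oplus>\<^bsub>M\<^esub> v) = f u \<oplus>\<^bsub>M\<^esub> f v"
    and "\<And>a u. a \<in> carrier R \<Longrightarrow> u \<in> carrier M \<Longrightarrow> f (a \<odot>\<^bsub>M\<^esub> u) = a \<odot>\<^bsub>M\<^esub> f u"
  shows "f \<in> carrier (End_module R M)"
  using assms by (auto simp: End_module_def intro: semilinear_mapsI)

lemma End_memD:
  assumes "f \<in> carrier (End_module R M)"
  shows "f \<in> extensional (carrier M)"
    and "u \<in> carrier M \<Longrightarrow> f u \<in> carrier M"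
    and "u \<in> carrier M \<Longrightarrow> v \<in> carrier M \<Longrightarrow> f (u \<oplus>\<^bsub>M\<^esub> v) = f u \<oplus>\<^bsub>M\<^esub> f v"
    and "a \<in> carrier R \<Longrightarrow> u \<in> carrier M \<Longrightarrow> f (a \<odot>\<^bsub>M\<^esub> u) = a \<odot>\<^bsub>M\<^esub> f u"
  using assms semilinear_mapsD[of f R "\<lambda>a. a" M M] by (auto simp: End_module_def)

lemma End_simps:
  "\<zero>\<^bsub>End_module R M\<^esub> = (\<lambda>x\<in>carrier M. \<zero>\<^bsub>M\<^esub>)"
  "f \<oplus>\<^bsub>End_module R M\<^esub> g = (\<lambda>x\<in>carrier M. f x \<oplus>\<^bsub>M\<^esub> g x)"
  "a \<odot>\<^bsub>End_module R M\<^esub> f = (\<lambda>x\<in>carrier M. a \<odot>\<^bsub>M\<^esub> f x)"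
  by (simp_all add: End_module_def)

lemma module_End:
  fixes M :: "('r, 'm) module" (structure) and R (structure)
  assumes "Module.module R M"
  shows "Module.module R (End_module R M)"
proof -
  interpret Module.module R M by fact
  let ?E = "End_module R M"
  have eqI: "f = g" if "f \<in> carrier ?E" "g \<in> carrier ?E" "\<And>u. u \<in> carrier M \<Longrightarrow> f u = g u" for f g
    using that by (meson End_memD(1) extensionalityI)
  have add: "f \<oplus>\<^bsub>?E\<^esub> g \<in> carrier ?E" if "f \<in> carrier ?E" "g \<in> carrier ?E" for f g
    using End_memD[OF that(1)] End_memD[OF that(2)]
    by (intro End_memI) (simp_all add: End_simps M.a_ac smult_r_distr)
  have smult: "a \<odot>\<^bsub>?E\<^esub> f \<in> carrier ?E" if "a \<in> carrier R" "f \<in> carrier ?E" for a f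
    using that(1) End_memD[OF that(2)]
    by (intro End_memI) (simp_all add: End_simps smult_r_distr R.m_comm flip: smult_assoc1)
  have zero: "\<zero>\<^bsub>?E\<^esub> \<in> carrier ?E"
    by (intro End_memI) (simp_all add: End_simps)
  show ?thesis
  proof (rule moduleI)
    show "abelian_group ?E"
    proof (rule abelian_groupI)
      fix f assume f: "f \<in> carrier ?E"
      have "(\<ominus>\<^bsub>R\<^esub> \<one>\<^bsub>R\<^esub>) \<odot>\<^bsub>?E\<^esub> f \<oplus>\<^bsub>?E\<^esub> f = \<zero>\<^bsub>?E\<^esub>"
        using End_memD[OF f] by (intro eqI add smult zero f) (simp_all add: End_simps smult_l_minus M.l_neg)
      then show "\<exists>g\<in>carrier ?E. g \<oplus>\<^bsub>?E\<^esub> f = \<zero>\<^bsub>?E\<^esub>" using smult f by blast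
    next
      fix f g h assume "f \<in> carrier ?E" "g \<in> carrier ?E" "h \<in> carrier ?E"
      then show "f \<oplus>\<^bsub>?E\<^esub> g \<oplus>\<^bsub>?E\<^esub> h = f \<oplus>\<^bsub>?E\<^esub> (g \<oplus>\<^bsub>?E\<^esub> h)"
        using End_memD(2)[of f R M] End_memD(2)[of g R M] End_memD(2)[of h R M]
        by (intro eqI add) (simp_all add: End_simps M.a_assoc)
    next
      fix f g assume "f \<in> carrier ?E" "g \<in> carrier ?E"
      then show "f \<oplus>\<^bsub>?E\<^esub> g = g \<oplus>\<^bsub>?E\<^esub> f"
        using End_memD(2)[of f R M] End_memD(2)[of g R M]
        by (intro eqI add) (simp_all add: End_simps M.a_comm)
    next
      fix f assume "f \<in> carrier ?E"
      then show "\<zero>\<^bsub>?E\<^esub> \<oplus>\<^bsub>?E\<^esub> f = f"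
        using End_memD(2)[of f R M] by (intro eqI add zero) (simp_all add: End_simps)
    qed (use add zero in auto)
  next
    fix a b f assume "a \<in> carrier R" "b \<in> carrier R" "f \<in> carrier ?E"
    then show "(a \<oplus>\<^bsub>R\<^esub> b) \<odot>\<^bsub>?E\<^esub> f = a \<odot>\<^bsub>?E\<^esub> f \<oplus>\<^bsub>?E\<^esub> b \<odot>\<^bsub>?E\<^esub> f"
      using End_memD(2)[of f R M] by (intro eqI add smult) (simp_all add: End_simps smult_l_distr)
  next
    fix a b f assume "a \<in> carrier R" "b \<in> carrier R" "f \<in> carrier ?E"
    then show "(a \<otimes>\<^bsub>R\<^esub> b) \<odot>\<^bsub>?E\<^esub> f = a \<odot>\<^bsub>?E\<^esub> (b \<odot>\<^bsub>?E\<^esub> f)"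
      using End_memD(2)[of f R M] by (intro eqI add smult) (simp_all add: End_simps smult_assoc1)
  next
    fix a f g assume "a \<in> carrier R" "f \<in> carrier ?E" "g \<in> carrier ?E"
    then show "a \<odot>\<^bsub>?E\<^esub> (f \<oplus>\<^bsub>?E\<^esub> g) = a \<odot>\<^bsub>?E\<^esub> f \<oplus>\<^bsub>?E\<^esub> a \<odot>\<^bsub>?E\<^esub> g"
      using End_memD(2)[of f R M] End_memD(2)[of g R M] by (intro eqI add smult) (simp_all add: End_simps smult_r_distr)
  next
    fix f assume "f \<in> carrier ?E"
    then show "\<one>\<^bsub>R\<^esub> \<odot>\<^bsub>?E\<^esub> f = f"
      using End_memD(2)[of f R M] by (intro eqI smult) (simp_all add: End_simps)
  qed (use smult R.is_cring in auto)
qed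

lemma (in Module.module) submodule_finsum:
  assumes "submodule H R M" "\<And>i. i \<in> A \<Longrightarrow> f i \<in> H" "finite A"
  shows "(\<Oplus>\<^bsub>M\<^esub>i\<in>A. f i) \<in> H"
  using assms(3,2)
proof (induction A)
  case empty
  then show ?case using submoduleE(2,5,6)[OF assms(1)] submoduleE(1)[OF assms(1)]
    by (metis M.finsum_empty M.r_neg equals0I subsetD)
next
  case (insert i A)
  then show ?case using submoduleE(1,5)[OF assms(1)]
    by (subst M.finsum_insert) auto
qed

lemma End_finsum_apply:
  fixes M :: "('r, 'm) module" (structure) and R (structure)
  assumes "Module.module R M" "finite A" "\<And>i. i \<in> A \<Longrightarrow> f i \<in> carrier (End_module R M)" "u \<in> carrier M"
  shows "(\<Oplus>\<^bsub>End_module R M\<^esub>i\<in>A. f i) u = (\<Oplus>\<^bsub>M\<^esub>i\<in>A. f i u)"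
proof -
  interpret Module.module R M by fact
  interpret E: Module.module R "End_module R M" by (rule module_End) fact
  show ?thesis
    using assms(2,3)
  proof (induction A)
    case empty
    then show ?case using assms(4) by (simp add: End_simps)
  next
    case (insert i A)
    then have "(\<Oplus>\<^bsub>End_module R M\<^esub>j\<in>insert i A. f j) = f i \<oplus>\<^bsub>End_module R M\<^esub> (\<Oplus>\<^bsub>End_module R M\<^esub>j\<in>A. f j)"
      by (intro E.finsum_insert) auto
    moreover have "(\<Oplus>\<^bsub>M\<^esub>j\<in>insert i A. f j u) = f i u \<oplus>\<^bsub>M\<^esub> (\<Oplus>\<^bsub>M\<^esub>j\<in>A. f j u)"
      using insert assms(4) End_memD(2) by (intro M.finsum_insert) fastforce+
    ultimately show ?case using insert assms(4) by (simp add: End_simps)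
  qed
qed

text \<open>The ring \<open>R\<close> plays the role of \<open>W(k)\<close>, with \<open>\<sigma>\<close> its Frobenius, \<open>\<tau>\<close> the inverse of \<open>\<sigma>\<close> and \<open>\<pi>\<close>
  the image of \<open>p\<close>; the vectors \<open>X i\<close> and \<open>Y i\<close> for \<open>i < d\<close> are the images of the basis of \<open>N\<^sup>d\<close>.\<close>

locale frob_lattice = Module.module R M
  for R (structure) and M :: "('a, 'm) module" (structure) +
  fixes \<sigma> \<tau> :: "'a \<Rightarrow> 'a" and \<pi> :: 'a and \<phi> :: "'m \<Rightarrow> 'm" and d :: nat and X Y :: "nat \<Rightarrow> 'm"
  assumes \<sigma>_hom: "\<sigma> \<in> ring_hom R R"
    and \<tau>_closed: "a \<in> carrier R \<Longrightarrow> \<tau> a \<in> carrier R"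
    and \<sigma>_\<tau>: "a \<in> carrier R \<Longrightarrow> \<sigma> (\<tau> a) = a"
    and \<tau>_\<sigma>: "a \<in> carrier R \<Longrightarrow> \<tau> (\<sigma> a) = a"
    and \<pi>_closed [simp]: "\<pi> \<in> carrier R"
    and \<sigma>_\<pi> [simp]: "\<sigma> \<pi> = \<pi>"
    and \<pi>_regular: "a \<in> carrier R \<Longrightarrow> \<pi> \<otimes>\<^bsub>R\<^esub> a = \<zero>\<^bsub>R\<^esub> \<Longrightarrow> a = \<zero>\<^bsub>R\<^esub>"
    and \<pi>_torsion_free: "u \<in> carrier M \<Longrightarrow> \<pi> \<odot>\<^bsub>M\<^esub> u = \<zero>\<^bsub>M\<^esub> \<Longrightarrow> u = \<zero>\<^bsub>M\<^esub>"
    and \<phi>_semilinear: "\<phi> \<in> semilinear_maps R \<sigma> M M"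
    and X_closed [simp]: "X i \<in> carrier M"
    and Y_closed [simp]: "Y i \<in> carrier M"
    and \<phi>_X: "\<phi> (X i) = Y i"
    and \<phi>_Y: "\<phi> (Y i) = \<pi> \<odot>\<^bsub>M\<^esub> X i"
    and independent: "\<And>a b i. (\<And>i. a i \<in> carrier R) \<Longrightarrow> (\<And>i. b i \<in> carrier R) \<Longrightarrow>
      (\<Oplus>\<^bsub>M\<^esub>i\<in>{..<d}. a i \<odot>\<^bsub>M\<^esub> X i \<oplus>\<^bsub>M\<^esub> b i \<odot>\<^bsub>M\<^esub> Y i) = \<zero>\<^bsub>M\<^esub> \<Longrightarrow> i < d \<Longrightarrow>
      a i = \<zero>\<^bsub>R\<^esub> \<and> b i = \<zero>\<^bsub>R\<^esub>"
begin

section \<open>Frobenius, powers of \<pi> and combinations of the lattice basis\<close>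

lemma \<sigma>_simps [simp]:
  "a \<in> carrier R \<Longrightarrow> \<sigma> a \<in> carrier R"
  "a \<in> carrier R \<Longrightarrow> b \<in> carrier R \<Longrightarrow> \<sigma> (a \<oplus>\<^bsub>R\<^esub> b) = \<sigma> a \<oplus>\<^bsub>R\<^esub> \<sigma> b"
  "a \<in> carrier R \<Longrightarrow> b \<in> carrier R \<Longrightarrow> \<sigma> (a \<otimes>\<^bsub>R\<^esub> b) = \<sigma> a \<otimes>\<^bsub>R\<^esub> \<sigma> b"
  "\<sigma> \<one>\<^bsub>R\<^esub> = \<one>\<^bsub>R\<^esub>"
  "\<sigma> \<zero>\<^bsub>R\<^esub> = \<zero>\<^bsub>R\<^esub>"
  using \<sigma>_hom ring_hom_zero[OF \<sigma>_hom R.ring_axioms R.ring_axioms] by (auto simp: ring_hom_def)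

declare \<tau>_closed [simp] \<sigma>_\<tau> [simp] \<tau>_\<sigma> [simp]

lemma \<sigma>_inj: "a \<in> carrier R \<Longrightarrow> b \<in> carrier R \<Longrightarrow> \<sigma> a = \<sigma> b \<Longrightarrow> a = b"
  by (metis \<tau>_\<sigma>)

lemma \<tau>_mult_\<pi>: "a \<in> carrier R \<Longrightarrow> \<tau> (\<pi> \<otimes>\<^bsub>R\<^esub> a) = \<pi> \<otimes>\<^bsub>R\<^esub> \<tau> a"
  by (rule \<sigma>_inj) auto

lemma \<sigma>_\<pi>_pow [simp]: "\<sigma> (\<pi> [^]\<^bsub>R\<^esub> (n::nat)) = \<pi> [^]\<^bsub>R\<^esub> n"
  by (induction n) auto

lemma \<phi>_simps [simp]:
  "u \<in> carrier M \<Longrightarrow> \<phi> u \<in> carrier M"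
  "u \<in> carrier M \<Longrightarrow> v \<in> carrier M \<Longrightarrow> \<phi> (u \<oplus>\<^bsub>M\<^esub> v) = \<phi> u \<oplus>\<^bsub>M\<^esub> \<phi> v"
  "a \<in> carrier R \<Longrightarrow> u \<in> carrier M \<Longrightarrow> \<phi> (a \<odot>\<^bsub>M\<^esub> u) = \<sigma> a \<odot>\<^bsub>M\<^esub> \<phi> u"
  using semilinear_mapsD[OF \<phi>_semilinear] by auto

lemma \<phi>_zero [simp]: "\<phi> \<zero>\<^bsub>M\<^esub> = \<zero>\<^bsub>M\<^esub>"
  using \<phi>_simps(3)[of "\<zero>\<^bsub>R\<^esub>" "\<zero>\<^bsub>M\<^esub>"] by simp

lemma \<phi>_pow_closed [simp]: "u \<in> carrier M \<Longrightarrow> (\<phi> ^^ n) u \<in> carrier M"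
  by (induction n) auto

lemma \<phi>_pow_\<pi>_pow: "u \<in> carrier M \<Longrightarrow> (\<phi> ^^ n) (\<pi> [^]\<^bsub>R\<^esub> (m::nat) \<odot>\<^bsub>M\<^esub> u) = \<pi> [^]\<^bsub>R\<^esub> m \<odot>\<^bsub>M\<^esub> (\<phi> ^^ n) u"
  by (induction n) auto

lemma \<pi>_pow_torsion_free:
  "u \<in> carrier M \<Longrightarrow> \<pi> [^]\<^bsub>R\<^esub> (n::nat) \<odot>\<^bsub>M\<^esub> u = \<zero>\<^bsub>M\<^esub> \<Longrightarrow> u = \<zero>\<^bsub>M\<^esub>"
proof (induction n arbitrary: u)
  case (Suc n)
  then have "\<pi> \<odot>\<^bsub>M\<^esub> u = \<zero>\<^bsub>M\<^esub>" by (simp add: smult_assoc1)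
  then show ?case using Suc.prems \<pi>_torsion_free by blast
qed auto

lemma \<pi>_pow_inj:
  assumes "u \<in> carrier M" "v \<in> carrier M" "\<pi> [^]\<^bsub>R\<^esub> (n::nat) \<odot>\<^bsub>M\<^esub> u = \<pi> [^]\<^bsub>R\<^esub> n \<odot>\<^bsub>M\<^esub> v"
  shows "u = v"
proof -
  have "\<pi> [^]\<^bsub>R\<^esub> n \<odot>\<^bsub>M\<^esub> (u \<ominus>\<^bsub>M\<^esub> v) = \<zero>\<^bsub>M\<^esub>"
    using assms by (simp add: M.minus_eq smult_r_distr smult_r_minus M.r_neg)
  then have "u \<ominus>\<^bsub>M\<^esub> v = \<zero>\<^bsub>M\<^esub>" using \<pi>_pow_torsion_free assms by auto
  then show ?thesis using assms by (metis M.a_inv_closed M.minus_eq M.minus_equality M.minus_minus)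
qed

text \<open>Families are indexed by all naturals although only indices below \<open>d\<close> enter
  \<open>comb\<close>; closedness then needs no side conditions, and equality of coefficients is
  asserted only below \<open>d\<close>.\<close>

definition scalars :: "(nat \<Rightarrow> 'a) set" where
  "scalars = {a. \<forall>i. a i \<in> carrier R}"

lemma scalarsI: "(\<And>i. a i \<in> carrier R) \<Longrightarrow> a \<in> scalars"
  by (simp add: scalars_def)

lemma scalarsD [simp]: "a \<in> scalars \<Longrightarrow> a i \<in> carrier R"
  by (simp add: scalars_def)

definition comb :: "(nat \<Rightarrow> 'a) \<Rightarrow> (nat \<Rightarrow> 'a) \<Rightarrow> 'm" where
  "comb a b = (\<Oplus>\<^bsub>M\<^esub>i\<in>{..<d}. a i \<odot>\<^bsub>M\<^esub> X i \<oplus>\<^bsub>M\<^esub> b i \<odot>\<^bsub>M\<^esub> Y i)"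

lemma comb_closed [simp]: "a \<in> scalars \<Longrightarrow> b \<in> scalars \<Longrightarrow> comb a b \<in> carrier M"
  by (auto simp: comb_def)

lemma comb_add:
  assumes "a \<in> scalars" "b \<in> scalars" "a' \<in> scalars" "b' \<in> scalars"
  shows "comb a b \<oplus>\<^bsub>M\<^esub> comb a' b' = comb (\<lambda>i. a i \<oplus>\<^bsub>R\<^esub> a' i) (\<lambda>i. b i \<oplus>\<^bsub>R\<^esub> b' i)"
  unfolding comb_def using assms
  by (subst M.finsum_addf[symmetric]) (auto intro!: M.finsum_cong' simp: smult_l_distr M.a_ac)

lemma comb_smult:
  assumes "a \<in> scalars" "b \<in> scalars" "c \<in> carrier R"
  shows "c \<odot>\<^bsub>M\<^esub> comb a b = comb (\<lambda>i. c \<otimes>\<^bsub>R\<^esub> a i) (\<lambda>i. c \<otimes>\<^bsub>R\<^esub> b i)"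
  unfolding comb_def using assms
  by (subst finsum_smult_ldistr) (auto intro!: M.finsum_cong' simp: smult_assoc1 smult_r_distr)

lemma \<phi>_comb:
  assumes "a \<in> scalars" "b \<in> scalars"
  shows "\<phi> (comb a b) = comb (\<lambda>i. \<pi> \<otimes>\<^bsub>R\<^esub> \<sigma> (b i)) (\<lambda>i. \<sigma> (a i))"
proof -
  have "\<phi> (\<Oplus>\<^bsub>M\<^esub>i\<in>A. a i \<odot>\<^bsub>M\<^esub> X i \<oplus>\<^bsub>M\<^esub> b i \<odot>\<^bsub>M\<^esub> Y i) =
    (\<Oplus>\<^bsub>M\<^esub>i\<in>A. (\<pi> \<otimes>\<^bsub>R\<^esub> \<sigma> (b i)) \<odot>\<^bsub>M\<^esub> X i \<oplus>\<^bsub>M\<^esub> \<sigma> (a i) \<odot>\<^bsub>M\<^esub> Y i)" if "finite A" for A :: "nat set"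
    using that
  proof (induction A)
    case (insert j A)
    have "\<pi> \<otimes>\<^bsub>R\<^esub> \<sigma> (b j) = \<sigma> (b j) \<otimes>\<^bsub>R\<^esub> \<pi>" using assms by (intro R.m_comm) auto
    then show ?case using insert assms
      by (subst (1 2) M.finsum_insert) (auto simp: \<phi>_X \<phi>_Y smult_assoc1 M.a_comm)
  qed auto
  then show ?thesis by (simp add: comb_def)
qed

lemma comb_eqD:
  assumes "a \<in> scalars" "b \<in> scalars" "a' \<in> scalars" "b' \<in> scalars" "comb a b = comb a' b'" "i < d"
  shows "a i = a' i \<and> b i = b' i"
proof -
  have n: "(\<lambda>i. \<ominus>\<^bsub>R\<^esub> a' i) \<in> scalars" "(\<lambda>i. \<ominus>\<^bsub>R\<^esub> b' i) \<in> scalars" using assms by (auto intro: scalarsI)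
  have "comb (\<lambda>i. \<ominus>\<^bsub>R\<^esub> a' i) (\<lambda>i. \<ominus>\<^bsub>R\<^esub> b' i) = comb (\<lambda>i. \<ominus>\<^bsub>R\<^esub> \<one>\<^bsub>R\<^esub> \<otimes>\<^bsub>R\<^esub> a' i) (\<lambda>i. \<ominus>\<^bsub>R\<^esub> \<one>\<^bsub>R\<^esub> \<otimes>\<^bsub>R\<^esub> b' i)"
    using assms by (simp add: R.l_minus)
  also have "\<dots> = \<ominus>\<^bsub>R\<^esub> \<one>\<^bsub>R\<^esub> \<odot>\<^bsub>M\<^esub> comb a' b'" using assms by (simp add: comb_smult)
  also have "\<dots> = \<ominus>\<^bsub>M\<^esub> comb a b" using assms by (simp add: smult_l_minus)
  finally have "comb (\<lambda>i. a i \<oplus>\<^bsub>R\<^esub> \<ominus>\<^bsub>R\<^esub> a' i) (\<lambda>i. b i \<oplus>\<^bsub>R\<^esub> \<ominus>\<^bsub>R\<^esub> b' i) = \<zero>\<^bsub>M\<^esub>"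
    using assms n by (simp add: M.r_neg flip: comb_add)
  then have "a i \<oplus>\<^bsub>R\<^esub> \<ominus>\<^bsub>R\<^esub> a' i = \<zero>\<^bsub>R\<^esub> \<and> b i \<oplus>\<^bsub>R\<^esub> \<ominus>\<^bsub>R\<^esub> b' i = \<zero>\<^bsub>R\<^esub>"
    using assms n independent[of "\<lambda>i. a i \<oplus>\<^bsub>R\<^esub> \<ominus>\<^bsub>R\<^esub> a' i" "\<lambda>i. b i \<oplus>\<^bsub>R\<^esub> \<ominus>\<^bsub>R\<^esub> b' i" i]
    by (simp add: comb_def)
  then show ?thesis using assms
    by (metis R.minus_equality R.minus_minus R.a_inv_closed scalarsD)
qed

lemma comb_cong:
  assumes "\<And>i. i < d \<Longrightarrow> a i = a' i" "\<And>i. i < d \<Longrightarrow> b i = b' i" "a' \<in> scalars" "b' \<in> scalars"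
  shows "comb a b = comb a' b'"
  unfolding comb_def using assms by (intro M.finsum_cong') auto

lemma \<phi>2_comb:
  assumes "a \<in> scalars" "b \<in> scalars"
  shows "\<phi> (\<phi> (comb a b)) = \<pi> \<odot>\<^bsub>M\<^esub> comb (\<lambda>i. \<sigma> (\<sigma> (a i))) (\<lambda>i. \<sigma> (\<sigma> (b i)))"
  using assms by (simp add: \<phi>_comb scalarsI comb_smult)

lemma \<phi>_pow_comb:
  assumes "a \<in> scalars" "b \<in> scalars"
  shows "\<exists>a'\<in>scalars. \<exists>b'\<in>scalars. (\<phi> ^^ (2 * n)) (comb a b) = \<pi> [^]\<^bsub>R\<^esub> n \<odot>\<^bsub>M\<^esub> comb a' b'"
proof (induction n)
  case 0
  then show ?case using assms by auto
next
  case (Suc n)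
  then obtain a' b' where *: "a' \<in> scalars" "b' \<in> scalars" "(\<phi> ^^ (2 * n)) (comb a b) = \<pi> [^]\<^bsub>R\<^esub> n \<odot>\<^bsub>M\<^esub> comb a' b'"
    by blast
  then have "(\<phi> ^^ (2 * Suc n)) (comb a b) = \<pi> [^]\<^bsub>R\<^esub> Suc n \<odot>\<^bsub>M\<^esub> comb (\<lambda>i. \<sigma> (\<sigma> (a' i))) (\<lambda>i. \<sigma> (\<sigma> (b' i)))"
    by (simp add: \<phi>2_comb smult_assoc1 scalarsI)
  then show ?case using * by (intro bexI[of _ "\<lambda>i. \<sigma> (\<sigma> (a' i))"] bexI[of _ "\<lambda>i. \<sigma> (\<sigma> (b' i))"]) (auto intro: scalarsI)
qed

text \<open>On the lattice each square of \<phi> carries a factor \<pi>, so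
  \<open>\<phi> ^^ (2 * n)\<close> sends \<open>\<pi> [^] n \<odot> u\<close> to
  \<open>\<pi> [^] n\<close> times a lattice element, and torsion-freeness cancels the factor. In
  this direction a bound by a power of \<open>p\<close> yields an admissible exponent
  \<open>q\<close>.\<close>

lemma \<phi>_pow_in_comb:
  assumes "\<And>u. u \<in> carrier M \<Longrightarrow> \<exists>a\<in>scalars. \<exists>b\<in>scalars. \<pi> [^]\<^bsub>R\<^esub> n \<odot>\<^bsub>M\<^esub> u = comb a b" "u \<in> carrier M"
  shows "\<exists>a\<in>scalars. \<exists>b\<in>scalars. (\<phi> ^^ (2 * n)) u = comb a b"
proof -
  obtain a b where *: "a \<in> scalars" "b \<in> scalars" "\<pi> [^]\<^bsub>R\<^esub> n \<odot>\<^bsub>M\<^esub> u = comb a b" using assms by blast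
  obtain a' b' where **: "a' \<in> scalars" "b' \<in> scalars" "(\<phi> ^^ (2 * n)) (comb a b) = \<pi> [^]\<^bsub>R\<^esub> n \<odot>\<^bsub>M\<^esub> comb a' b'"
    using \<phi>_pow_comb *(1,2) by blast
  then have "\<pi> [^]\<^bsub>R\<^esub> n \<odot>\<^bsub>M\<^esub> (\<phi> ^^ (2 * n)) u = \<pi> [^]\<^bsub>R\<^esub> n \<odot>\<^bsub>M\<^esub> comb a' b'"
    using *(3) assms(2) \<phi>_pow_\<pi>_pow by metis
  then have "(\<phi> ^^ (2 * n)) u = comb a' b'"
    using **(1,2) assms(2) by (auto intro: \<pi>_pow_inj[of _ _ n])
  then show ?thesis using ** by blast
qed

end

context frob_lattice
begin

lemma \<phi>_minus: "u \<in> carrier M \<Longrightarrow> \<phi> (\<ominus>\<^bsub>M\<^esub> u) = \<ominus>\<^bsub>M\<^esub> \<phi> u"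
  using \<phi>_simps(2)[of "\<ominus>\<^bsub>M\<^esub> u" u] M.minus_equality[of "\<phi> (\<ominus>\<^bsub>M\<^esub> u)" "\<phi> u"] by (simp add: M.l_neg)

lemma \<tau>_pow_closed [simp]: "a \<in> carrier R \<Longrightarrow> (\<tau> ^^ n) a \<in> carrier R"
  by (induction n) auto

lemma \<tau>_pow_mult_\<pi>: "a \<in> carrier R \<Longrightarrow> (\<tau> ^^ n) (\<pi> \<otimes>\<^bsub>R\<^esub> a) = \<pi> \<otimes>\<^bsub>R\<^esub> (\<tau> ^^ n) a"
  by (induction n) (auto simp: \<tau>_mult_\<pi>)

section \<open>Linear functionals and rank one operators\<close>

definition op :: "('m \<Rightarrow> 'a) \<Rightarrow> 'm \<Rightarrow> 'm \<Rightarrow> 'm" where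
  "op f w = (\<lambda>u\<in>carrier M. f u \<odot>\<^bsub>M\<^esub> w)"

definition functional :: "('m \<Rightarrow> 'a) \<Rightarrow> bool" where
  "functional f \<longleftrightarrow> (\<forall>u\<in>carrier M. f u \<in> carrier R) \<and>
    (\<forall>u\<in>carrier M. \<forall>v\<in>carrier M. f (u \<oplus>\<^bsub>M\<^esub> v) = f u \<oplus>\<^bsub>R\<^esub> f v) \<and>
    (\<forall>a\<in>carrier R. \<forall>u\<in>carrier M. f (a \<odot>\<^bsub>M\<^esub> u) = a \<otimes>\<^bsub>R\<^esub> f u)"

lemma functionalD:
  assumes "functional f"
  shows "u \<in> carrier M \<Longrightarrow> f u \<in> carrier R"
    and "u \<in> carrier M \<Longrightarrow> v \<in> carrier M \<Longrightarrow> f (u \<oplus>\<^bsub>M\<^esub> v) = f u \<oplus>\<^bsub>R\<^esub> f v"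
    and "a \<in> carrier R \<Longrightarrow> u \<in> carrier M \<Longrightarrow> f (a \<odot>\<^bsub>M\<^esub> u) = a \<otimes>\<^bsub>R\<^esub> f u"
  using assms by (auto simp: functional_def)

abbreviation E :: "('a, 'm \<Rightarrow> 'm) module" where
  "E \<equiv> End_module R M"

lemma module_E: "Module.module R E"
  by (rule module_End) (rule module_axioms)

lemma op_closed:
  assumes "functional f" "w \<in> carrier M"
  shows "op f w \<in> carrier E"
  using functionalD[OF assms(1)] assms(2)
  by (intro End_memI) (auto simp: op_def smult_l_distr smult_assoc1)

lemma op_add:
  assumes "functional f" "v \<in> carrier M" "w \<in> carrier M"
  shows "op f (v \<oplus>\<^bsub>M\<^esub> w) = op f v \<oplus>\<^bsub>E\<^esub> op f w"
  using functionalD(1)[OF assms(1)] assms(2,3) by (auto simp: op_def End_simps smult_r_distr)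

lemma op_smult:
  assumes "functional f" "w \<in> carrier M" "a \<in> carrier R"
  shows "op f (a \<odot>\<^bsub>M\<^esub> w) = a \<odot>\<^bsub>E\<^esub> op f w"
  using functionalD(1)[OF assms(1)] assms(2,3)
  by (auto simp: op_def End_simps R.m_comm simp flip: smult_assoc1)

text \<open>\<open>op f\<close> is linear in its vector. Membership of \<open>op f w\<close> in
  \<open>H\<close> therefore needs checking only on vectors that generate.\<close>

lemma submodule_op_preimage:
  assumes "functional f" "submodule H R E"
  shows "submodule {w \<in> carrier M. op f w \<in> H} R M"
proof -
  interpret E: Module.module R E by (rule module_E)
  have smult: "a \<odot>\<^bsub>M\<^esub> w \<in> {w \<in> carrier M. op f w \<in> H}"
    if "a \<in> carrier R" "w \<in> {w \<in> carrier M. op f w \<in> H}" for a w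
    using that assms E.submoduleE(4)[OF assms(2)] by (auto simp: op_smult)
  show ?thesis
  proof (rule submoduleI)
    have "op f \<zero>\<^bsub>M\<^esub> = \<zero>\<^bsub>E\<^esub>"
      using functionalD(1)[OF assms(1)] by (auto simp: op_def End_simps)
    moreover have "\<zero>\<^bsub>E\<^esub> \<in> H" using E.submodule_finsum[OF assms(2), of "{}"] by simp
    ultimately show "\<zero>\<^bsub>M\<^esub> \<in> {w \<in> carrier M. op f w \<in> H}" by simp
  next
    fix w assume w: "w \<in> {w \<in> carrier M. op f w \<in> H}"
    then have "\<ominus>\<^bsub>M\<^esub> w = \<ominus>\<^bsub>R\<^esub> \<one>\<^bsub>R\<^esub> \<odot>\<^bsub>M\<^esub> w" by (simp add: smult_l_minus)
    then show "\<ominus>\<^bsub>M\<^esub> w \<in> {w \<in> carrier M. op f w \<in> H}" using smult w by simp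
  qed (use smult assms E.submoduleE(5)[OF assms(2)] in \<open>auto simp: op_add\<close>)
qed

text \<open>The coefficients stay attached to the \<open>X i\<close> but not to the
  \<open>Y i\<close>: for the functionals \<beta>, membership is available for the
  \<open>Y i\<close> themselves but for the \<open>X i\<close> only after multiplication by
  \<pi>.\<close>

lemma comb_in_submodule:
  assumes "submodule K R M" "a \<in> scalars" "b \<in> scalars"
    and "\<And>i. i < d \<Longrightarrow> a i \<odot>\<^bsub>M\<^esub> X i \<in> K" "\<And>i. i < d \<Longrightarrow> Y i \<in> K"
  shows "comb a b \<in> K"
  unfolding comb_def
  using assms submoduleE(4,5)[OF assms(1)] by (intro submodule_finsum) auto

lemma End_comb:
  assumes "e \<in> carrier E" "a \<in> scalars" "b \<in> scalars"
  shows "e (comb a b) = (\<Oplus>\<^bsub>M\<^esub>i\<in>{..<d}. a i \<odot>\<^bsub>M\<^esub> e (X i) \<oplus>\<^bsub>M\<^esub> b i \<odot>\<^bsub>M\<^esub> e (Y i))"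
proof -
  note e = End_memD[OF assms(1)]
  have e0: "e \<zero>\<^bsub>M\<^esub> = \<zero>\<^bsub>M\<^esub>" using e(4)[of "\<zero>\<^bsub>R\<^esub>" "\<zero>\<^bsub>M\<^esub>"] e(2)[of "\<zero>\<^bsub>M\<^esub>"] by simp
  have "e (\<Oplus>\<^bsub>M\<^esub>i\<in>A. a i \<odot>\<^bsub>M\<^esub> X i \<oplus>\<^bsub>M\<^esub> b i \<odot>\<^bsub>M\<^esub> Y i) =
    (\<Oplus>\<^bsub>M\<^esub>i\<in>A. a i \<odot>\<^bsub>M\<^esub> e (X i) \<oplus>\<^bsub>M\<^esub> b i \<odot>\<^bsub>M\<^esub> e (Y i))" if "finite A" for A :: "nat set"
    using that
  proof (induction A)
    case (insert j A)
    then show ?case using assms(2,3) e(2)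
      by (subst (1 2) M.finsum_insert) (auto simp: e(3,4))
  qed (auto simp: e0)
  then show ?thesis by (simp add: comb_def)
qed

end

section \<open>Even powers of Frobenius against powers of \<open>p\<close>\<close>

locale frob_lattice_bound = frob_lattice R M \<sigma> \<tau> \<pi> \<phi> d X Y
  for R (structure) and M :: "('a, 'm) module" (structure) and \<sigma> \<tau> \<pi> \<phi> d X Y +
  fixes q :: nat
  assumes \<pi>_mult_in_range: "\<And>u. u \<in> carrier M \<Longrightarrow> \<exists>v\<in>carrier M. \<pi> \<odot>\<^bsub>M\<^esub> u = \<phi> v"
    and \<phi>_pow_q: "\<And>u. u \<in> carrier M \<Longrightarrow> \<exists>a\<in>scalars. \<exists>b\<in>scalars. (\<phi> ^^ q) u = comb a b"
begin

lemma \<pi>_pow_mult_in_range: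
  "u \<in> carrier M \<Longrightarrow> \<exists>v\<in>carrier M. \<pi> [^]\<^bsub>R\<^esub> (n::nat) \<odot>\<^bsub>M\<^esub> u = (\<phi> ^^ n) v"
proof (induction n arbitrary: u)
  case (Suc n)
  obtain v where v: "v \<in> carrier M" "\<pi> \<odot>\<^bsub>M\<^esub> u = \<phi> v" using \<pi>_mult_in_range Suc.prems by blast
  obtain w where w: "w \<in> carrier M" "\<pi> [^]\<^bsub>R\<^esub> n \<odot>\<^bsub>M\<^esub> v = (\<phi> ^^ n) w" using Suc.IH v(1) by blast
  have "\<pi> [^]\<^bsub>R\<^esub> Suc n \<odot>\<^bsub>M\<^esub> u = \<phi> (\<pi> [^]\<^bsub>R\<^esub> n \<odot>\<^bsub>M\<^esub> v)"
    using Suc.prems v by (simp add: smult_assoc1)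
  then show ?case using w by auto
qed auto

text \<open>Injectivity of \<phi> is not part of the definition of a Dieudonne module. The multiple
  \<open>\<pi> [^] q \<odot> u\<close> is in the range of \<open>\<phi> ^^ q\<close>, hence in the
  lattice, where independence shows that \<phi> kills nothing; torsion-freeness brings this back to
  \<open>u\<close>.\<close>

lemma \<phi>_eq_zero:
  assumes u: "u \<in> carrier M" "\<phi> u = \<zero>\<^bsub>M\<^esub>"
  shows "u = \<zero>\<^bsub>M\<^esub>"
proof -
  obtain v where v: "v \<in> carrier M" "\<pi> [^]\<^bsub>R\<^esub> q \<odot>\<^bsub>M\<^esub> u = (\<phi> ^^ q) v" using \<pi>_pow_mult_in_range u by blast
  then obtain a b where ab: "a \<in> scalars" "b \<in> scalars" "\<pi> [^]\<^bsub>R\<^esub> q \<odot>\<^bsub>M\<^esub> u = comb a b"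
    using \<phi>_pow_q by metis
  let ?z = "\<lambda>_::nat. \<zero>\<^bsub>R\<^esub>"
  have z: "?z \<in> scalars" by (auto intro: scalarsI)
  have z0: "comb ?z ?z = \<zero>\<^bsub>M\<^esub>"
    using comb_smult[OF z z, of "\<zero>\<^bsub>R\<^esub>"] z by simp
  have "comb (\<lambda>i. \<pi> \<otimes>\<^bsub>R\<^esub> \<sigma> (b i)) (\<lambda>i. \<sigma> (a i)) = \<phi> (\<pi> [^]\<^bsub>R\<^esub> q \<odot>\<^bsub>M\<^esub> u)"
    using ab by (simp add: \<phi>_comb)
  also have "\<dots> = comb ?z ?z" using u by (simp add: z0)
  finally have "comb (\<lambda>i. \<pi> \<otimes>\<^bsub>R\<^esub> \<sigma> (b i)) (\<lambda>i. \<sigma> (a i)) = comb ?z ?z" .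
  moreover have "(\<lambda>i. \<pi> \<otimes>\<^bsub>R\<^esub> \<sigma> (b i)) \<in> scalars" "(\<lambda>i. \<sigma> (a i)) \<in> scalars"
    using ab by (auto intro: scalarsI)
  ultimately have "\<pi> \<otimes>\<^bsub>R\<^esub> \<sigma> (b i) = \<zero>\<^bsub>R\<^esub> \<and> \<sigma> (a i) = \<zero>\<^bsub>R\<^esub>" if "i < d" for i
    using comb_eqD[OF _ _ z z _ that] by blast
  then have "\<sigma> (b i) = \<sigma> \<zero>\<^bsub>R\<^esub> \<and> \<sigma> (a i) = \<sigma> \<zero>\<^bsub>R\<^esub>" if "i < d" for i
    using that \<pi>_regular ab by simp
  then have "b i = \<zero>\<^bsub>R\<^esub> \<and> a i = \<zero>\<^bsub>R\<^esub>" if "i < d" for i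
    using that \<sigma>_inj ab by (meson R.zero_closed scalarsD)
  then have "comb a b = comb ?z ?z" using z by (intro comb_cong) auto
  then show ?thesis using ab z0 u \<pi>_pow_torsion_free by simp
qed

lemma \<phi>_inj:
  assumes "u \<in> carrier M" "v \<in> carrier M" "\<phi> u = \<phi> v"
  shows "u = v"
proof -
  have "\<phi> (u \<ominus>\<^bsub>M\<^esub> v) = \<zero>\<^bsub>M\<^esub>" using assms by (simp add: M.minus_eq \<phi>_minus M.r_neg)
  then have "u \<ominus>\<^bsub>M\<^esub> v = \<zero>\<^bsub>M\<^esub>" using \<phi>_eq_zero assms by auto
  then show ?thesis using assms by (metis M.a_inv_closed M.minus_eq M.minus_equality M.minus_minus)
qed

text \<open>On the lattice spanned by the \<open>X i\<close> and \<open>Y i\<close> the square of \<open>\<phi>\<close> is \<open>p\<close> times a bijection, so an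
  even power of \<open>\<phi>\<close> can be traded for half that power of \<open>p\<close>.\<close>

lemma \<pi>_pow_comb_of_\<phi>_pow:
  assumes "u \<in> carrier M" "a \<in> scalars" "b \<in> scalars" "(\<phi> ^^ (2 * s)) u = comb a b"
  shows "\<pi> [^]\<^bsub>R\<^esub> s \<odot>\<^bsub>M\<^esub> u = comb (\<lambda>i. (\<tau> ^^ (2 * s)) (a i)) (\<lambda>i. (\<tau> ^^ (2 * s)) (b i))"
  using assms
proof (induction s arbitrary: u a b)
  case (Suc s)
  let ?a = "\<lambda>i. \<tau> (\<tau> (a i))" and ?b = "\<lambda>i. \<tau> (\<tau> (b i))"
  have sc: "?a \<in> scalars" "?b \<in> scalars" using Suc.prems by (auto intro: scalarsI)
  have "\<phi> (\<phi> (comb ?a ?b)) = \<pi> \<odot>\<^bsub>M\<^esub> comb a b"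
    using sc Suc.prems by (simp add: \<phi>2_comb)
  also have "\<dots> = \<phi> (\<phi> (\<pi> \<odot>\<^bsub>M\<^esub> (\<phi> ^^ (2 * s)) u))"
    using Suc.prems by (simp flip: Suc.prems(4))
  finally have eq: "\<phi> (\<phi> (comb ?a ?b)) = \<phi> (\<phi> (\<pi> \<odot>\<^bsub>M\<^esub> (\<phi> ^^ (2 * s)) u))" .
  have cl: "comb ?a ?b \<in> carrier M" "\<pi> \<odot>\<^bsub>M\<^esub> (\<phi> ^^ (2 * s)) u \<in> carrier M"
    using sc Suc.prems(1) by auto
  have "comb ?a ?b = \<pi> \<odot>\<^bsub>M\<^esub> (\<phi> ^^ (2 * s)) u"
    by (rule \<phi>_inj[OF cl \<phi>_inj[OF \<phi>_simps(1)[OF cl(1)] \<phi>_simps(1)[OF cl(2)] eq]])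
  \<comment> \<open>Two Frobenius steps have been cancelled against one factor \<pi>, which is moved
    inside so that the induction hypothesis applies to \<open>\<pi> \<odot> u\<close>.\<close>
  then have "(\<phi> ^^ (2 * s)) (\<pi> \<odot>\<^bsub>M\<^esub> u) = comb ?a ?b"
    using \<phi>_pow_\<pi>_pow[OF Suc.prems(1), of "2 * s" 1] by simp
  then have "\<pi> [^]\<^bsub>R\<^esub> s \<odot>\<^bsub>M\<^esub> (\<pi> \<odot>\<^bsub>M\<^esub> u) = comb (\<lambda>i. (\<tau> ^^ (2 * s)) (?a i)) (\<lambda>i. (\<tau> ^^ (2 * s)) (?b i))"
    using Suc.IH Suc.prems(1) sc by simp
  then show ?case using Suc.prems(1) by (simp add: smult_assoc1 funpow_swap1)
qed simp

definition s :: nat where "s = (q + 1) div 2"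
definition r :: nat where "r = q + 1 - s"

text \<open>For even \<open>q\<close> the power \<open>\<phi> ^^ q\<close> itself lands in the
  lattice, and one further \<pi> makes all coordinates divisible. For odd \<open>q\<close> one more
  \<phi> completes the power to an even one and puts a factor \<pi> on the
  \<open>X\<close>-coordinates; \<tau> commutes with multiplication by \<pi>, so the factor survives
  and one exponent serves both claims. Hence \<open>r\<close> is \<open>s + 1\<close> for even and
  \<open>s\<close> for odd \<open>q\<close>.\<close>

lemma \<pi>_pow_s: "u \<in> carrier M \<Longrightarrow> \<exists>a\<in>scalars. \<exists>b\<in>scalars. \<pi> [^]\<^bsub>R\<^esub> s \<odot>\<^bsub>M\<^esub> u = comb a b"
  and \<pi>_pow_r: "u \<in> carrier M \<Longrightarrow> \<exists>a\<in>scalars. \<exists>b\<in>scalars. \<pi> [^]\<^bsub>R\<^esub> r \<odot>\<^bsub>M\<^esub> u = comb (\<lambda>i. \<pi> \<otimes>\<^bsub>R\<^esub> a i) b"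
proof -
  assume u: "u \<in> carrier M"
  obtain a b where ab: "a \<in> scalars" "b \<in> scalars" "(\<phi> ^^ q) u = comb a b" using \<phi>_pow_q u by blast
  have "(\<exists>a\<in>scalars. \<exists>b\<in>scalars. \<pi> [^]\<^bsub>R\<^esub> s \<odot>\<^bsub>M\<^esub> u = comb a b) \<and>
    (\<exists>a\<in>scalars. \<exists>b\<in>scalars. \<pi> [^]\<^bsub>R\<^esub> r \<odot>\<^bsub>M\<^esub> u = comb (\<lambda>i. \<pi> \<otimes>\<^bsub>R\<^esub> a i) b)"
  proof (cases "even q")
    case True
    then have q: "q = 2 * s" "r = Suc s" by (auto simp: s_def r_def)
    let ?a = "\<lambda>i. (\<tau> ^^ (2 * s)) (a i)" and ?b = "\<lambda>i. (\<tau> ^^ (2 * s)) (b i)"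
    have sc: "?a \<in> scalars" "?b \<in> scalars" using ab by (auto intro: scalarsI)
    have *: "\<pi> [^]\<^bsub>R\<^esub> s \<odot>\<^bsub>M\<^esub> u = comb ?a ?b"
      using \<pi>_pow_comb_of_\<phi>_pow[OF u ab(1,2)] ab(3) q by simp
    have "\<pi> [^]\<^bsub>R\<^esub> r \<odot>\<^bsub>M\<^esub> u = \<pi> \<odot>\<^bsub>M\<^esub> (\<pi> [^]\<^bsub>R\<^esub> s \<odot>\<^bsub>M\<^esub> u)"
      using u by (simp add: q(2) R.m_comm flip: smult_assoc1)
    also have "\<dots> = comb (\<lambda>i. \<pi> \<otimes>\<^bsub>R\<^esub> ?a i) (\<lambda>i. \<pi> \<otimes>\<^bsub>R\<^esub> ?b i)"
      unfolding * using sc by (intro comb_smult) auto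
    finally have "\<pi> [^]\<^bsub>R\<^esub> r \<odot>\<^bsub>M\<^esub> u = comb (\<lambda>i. \<pi> \<otimes>\<^bsub>R\<^esub> ?a i) (\<lambda>i. \<pi> \<otimes>\<^bsub>R\<^esub> ?b i)" .
    moreover have "(\<lambda>i. \<pi> \<otimes>\<^bsub>R\<^esub> ?b i) \<in> scalars" using ab by (auto intro: scalarsI)
    ultimately have "\<exists>b\<in>scalars. \<pi> [^]\<^bsub>R\<^esub> r \<odot>\<^bsub>M\<^esub> u = comb (\<lambda>i. \<pi> \<otimes>\<^bsub>R\<^esub> ?a i) b" by blast
    then have "\<exists>a\<in>scalars. \<exists>b\<in>scalars. \<pi> [^]\<^bsub>R\<^esub> r \<odot>\<^bsub>M\<^esub> u = comb (\<lambda>i. \<pi> \<otimes>\<^bsub>R\<^esub> a i) b"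
      using sc(1) by (rule bexI[of _ ?a])
    then show ?thesis using * sc by blast
  next
    case False
    then have q: "2 * s = Suc q" "r = s" by (auto simp: s_def r_def elim!: oddE)
    let ?a = "\<lambda>i. \<pi> \<otimes>\<^bsub>R\<^esub> \<sigma> (b i)" and ?b = "\<lambda>i. \<sigma> (a i)"
    have sc: "?a \<in> scalars" "?b \<in> scalars" using ab by (auto intro: scalarsI)
    have "(\<phi> ^^ (2 * s)) u = comb ?a ?b" unfolding q using ab by (simp add: \<phi>_comb)
    then have "\<pi> [^]\<^bsub>R\<^esub> s \<odot>\<^bsub>M\<^esub> u = comb (\<lambda>i. (\<tau> ^^ (2 * s)) (?a i)) (\<lambda>i. (\<tau> ^^ (2 * s)) (?b i))"
      by (rule \<pi>_pow_comb_of_\<phi>_pow[OF u sc])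
    then have *: "\<pi> [^]\<^bsub>R\<^esub> s \<odot>\<^bsub>M\<^esub> u =
        comb (\<lambda>i. \<pi> \<otimes>\<^bsub>R\<^esub> (\<tau> ^^ (2 * s)) (\<sigma> (b i))) (\<lambda>i. (\<tau> ^^ (2 * s)) (?b i))"
      using ab by (simp add: \<tau>_pow_mult_\<pi>)
    have "(\<lambda>i. (\<tau> ^^ (2 * s)) (\<sigma> (b i))) \<in> scalars" "(\<lambda>i. (\<tau> ^^ (2 * s)) (?b i)) \<in> scalars"
      "(\<lambda>i. \<pi> \<otimes>\<^bsub>R\<^esub> (\<tau> ^^ (2 * s)) (\<sigma> (b i))) \<in> scalars"
      using ab by (auto intro: scalarsI)
    note sc' = this
    have "\<exists>a\<in>scalars. \<exists>b\<in>scalars. \<pi> [^]\<^bsub>R\<^esub> r \<odot>\<^bsub>M\<^esub> u = comb (\<lambda>i. \<pi> \<otimes>\<^bsub>R\<^esub> a i) b"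
      unfolding q(2) * by (rule bexI[OF bexI[OF refl sc'(2)] sc'(1)])
    then show ?thesis using * sc' by blast
  qed
  then show "\<exists>a\<in>scalars. \<exists>b\<in>scalars. \<pi> [^]\<^bsub>R\<^esub> s \<odot>\<^bsub>M\<^esub> u = comb a b"
    and "\<exists>a\<in>scalars. \<exists>b\<in>scalars. \<pi> [^]\<^bsub>R\<^esub> r \<odot>\<^bsub>M\<^esub> u = comb (\<lambda>i. \<pi> \<otimes>\<^bsub>R\<^esub> a i) b" by auto
qed

section \<open>Coordinate functionals and the span of the commuting endomorphisms\<close>

definition coords :: "'m \<Rightarrow> (nat \<Rightarrow> 'a) \<times> (nat \<Rightarrow> 'a)" where
  "coords u = (SOME (a, b). a \<in> scalars \<and> b \<in> scalars \<and> \<pi> [^]\<^bsub>R\<^esub> s \<odot>\<^bsub>M\<^esub> u = comb a b)"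

text \<open>Up to the scaling by \<open>\<pi> [^] s\<close>, \<alpha> and \<beta> are the dual basis
  of the \<open>X i\<close> and \<open>Y i\<close>; the scaling gives them values in
  \<open>R\<close> on all of \<open>M\<close>. From index \<open>d\<close> on the values are
  arbitrary.\<close>

definition \<alpha> :: "nat \<Rightarrow> 'm \<Rightarrow> 'a" where "\<alpha> i u = fst (coords u) i"
definition \<beta> :: "nat \<Rightarrow> 'm \<Rightarrow> 'a" where "\<beta> i u = snd (coords u) i"

lemma \<alpha>_\<beta>:
  assumes "u \<in> carrier M"
  shows "(\<lambda>i. \<alpha> i u) \<in> scalars" "(\<lambda>i. \<beta> i u) \<in> scalars"
    "\<pi> [^]\<^bsub>R\<^esub> s \<odot>\<^bsub>M\<^esub> u = comb (\<lambda>i. \<alpha> i u) (\<lambda>i. \<beta> i u)"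
proof -
  have "\<exists>ab. case ab of (a, b) \<Rightarrow> a \<in> scalars \<and> b \<in> scalars \<and> \<pi> [^]\<^bsub>R\<^esub> s \<odot>\<^bsub>M\<^esub> u = comb a b"
    using \<pi>_pow_s[OF assms] by auto
  from someI_ex[OF this] have
    "case coords u of (a, b) \<Rightarrow> a \<in> scalars \<and> b \<in> scalars \<and> \<pi> [^]\<^bsub>R\<^esub> s \<odot>\<^bsub>M\<^esub> u = comb a b"
    unfolding coords_def .
  then show "(\<lambda>i. \<alpha> i u) \<in> scalars" "(\<lambda>i. \<beta> i u) \<in> scalars"
    "\<pi> [^]\<^bsub>R\<^esub> s \<odot>\<^bsub>M\<^esub> u = comb (\<lambda>i. \<alpha> i u) (\<lambda>i. \<beta> i u)"
    by (simp_all add: \<alpha>_def \<beta>_def case_prod_unfold)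
qed

lemma \<alpha>_\<beta>_unique:
  assumes "u \<in> carrier M" "a \<in> scalars" "b \<in> scalars" "\<pi> [^]\<^bsub>R\<^esub> s \<odot>\<^bsub>M\<^esub> u = comb a b" "i < d"
  shows "\<alpha> i u = a i \<and> \<beta> i u = b i"
  using comb_eqD[OF \<alpha>_\<beta>(1,2)[OF assms(1)] assms(2,3) _ assms(5)] \<alpha>_\<beta>(3)[OF assms(1)] assms(4) by simp

text \<open>Although chosen by \<open>SOME\<close>, the coordinates are linear: sums and multiples
  of coordinate families are admissible choices, and below \<open>d\<close> the coordinates are
  unique.\<close>

lemma functional_\<alpha>_\<beta>:
  assumes "i < d"
  shows "functional (\<alpha> i)" "functional (\<beta> i)"
proof -
  have add: "\<alpha> i (u \<oplus>\<^bsub>M\<^esub> v) = \<alpha> i u \<oplus>\<^bsub>R\<^esub> \<alpha> i v \<and> \<beta> i (u \<oplus>\<^bsub>M\<^esub> v) = \<beta> i u \<oplus>\<^bsub>R\<^esub> \<beta> i v"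
    if "u \<in> carrier M" "v \<in> carrier M" for u v
    using that \<alpha>_\<beta>[OF that(1)] \<alpha>_\<beta>[OF that(2)] assms
    by (intro \<alpha>_\<beta>_unique) (auto simp: smult_r_distr comb_add intro!: scalarsI intro: scalarsD)
  have smult: "\<alpha> i (a \<odot>\<^bsub>M\<^esub> u) = a \<otimes>\<^bsub>R\<^esub> \<alpha> i u \<and> \<beta> i (a \<odot>\<^bsub>M\<^esub> u) = a \<otimes>\<^bsub>R\<^esub> \<beta> i u"
    if "a \<in> carrier R" "u \<in> carrier M" for a u
  proof (rule \<alpha>_\<beta>_unique)
    have "\<pi> [^]\<^bsub>R\<^esub> s \<odot>\<^bsub>M\<^esub> (a \<odot>\<^bsub>M\<^esub> u) = a \<odot>\<^bsub>M\<^esub> (\<pi> [^]\<^bsub>R\<^esub> s \<odot>\<^bsub>M\<^esub> u)"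
      using that by (simp add: R.m_comm flip: smult_assoc1)
    then show "\<pi> [^]\<^bsub>R\<^esub> s \<odot>\<^bsub>M\<^esub> (a \<odot>\<^bsub>M\<^esub> u) = comb (\<lambda>i. a \<otimes>\<^bsub>R\<^esub> \<alpha> i u) (\<lambda>i. a \<otimes>\<^bsub>R\<^esub> \<beta> i u)"
      using \<alpha>_\<beta>[OF that(2)] that by (simp add: comb_smult)
  qed (use that \<alpha>_\<beta>[OF that(2)] assms in \<open>auto intro!: scalarsI intro: scalarsD\<close>)
  have "\<alpha> i u \<in> carrier R \<and> \<beta> i u \<in> carrier R" if "u \<in> carrier M" for u
    using scalarsD[OF \<alpha>_\<beta>(1)[OF that], of i] scalarsD[OF \<alpha>_\<beta>(2)[OF that], of i] by simp
  then show "functional (\<alpha> i)" "functional (\<beta> i)"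
    using add smult by (auto simp: functional_def)
qed

text \<open>\<phi> commutes with \<open>\<pi> [^] s\<close>, so the coordinates of
  \<open>\<phi> u\<close> are read off by applying \<phi> to the combination for
  \<open>u\<close>.\<close>

lemma \<alpha>_\<beta>_\<phi>:
  assumes "u \<in> carrier M" "i < d"
  shows "\<alpha> i (\<phi> u) = \<pi> \<otimes>\<^bsub>R\<^esub> \<sigma> (\<beta> i u) \<and> \<beta> i (\<phi> u) = \<sigma> (\<alpha> i u)"
proof (rule \<alpha>_\<beta>_unique)
  note ab = \<alpha>_\<beta>[OF assms(1)]
  have "\<pi> [^]\<^bsub>R\<^esub> s \<odot>\<^bsub>M\<^esub> \<phi> u = \<phi> (\<pi> [^]\<^bsub>R\<^esub> s \<odot>\<^bsub>M\<^esub> u)" using assms by simp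
  then show "\<pi> [^]\<^bsub>R\<^esub> s \<odot>\<^bsub>M\<^esub> \<phi> u = comb (\<lambda>i. \<pi> \<otimes>\<^bsub>R\<^esub> \<sigma> (\<beta> i u)) (\<lambda>i. \<sigma> (\<alpha> i u))"
    using ab by (simp add: \<phi>_comb)
  show "(\<lambda>i. \<pi> \<otimes>\<^bsub>R\<^esub> \<sigma> (\<beta> i u)) \<in> scalars" "(\<lambda>i. \<sigma> (\<alpha> i u)) \<in> scalars"
    using scalarsD[OF ab(1)] scalarsD[OF ab(2)] by (auto intro: scalarsI)
qed (use assms in auto)

text \<open>The pairs \<open>(X k, Y k)\<close> and \<open>(Y k, \<pi> \<odot> X k)\<close> satisfy
  the same relations as \<open>(v, w)\<close>, so one statement yields all four kinds of operator.
  \<open>H\<close> is arbitrary because the span is an intersection of submodules.\<close>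

lemma op_in_submodule:
  assumes H: "submodule H R E"
    and inv: "\<And>e. e \<in> carrier E \<Longrightarrow> (\<And>u. u \<in> carrier M \<Longrightarrow> e (\<phi> u) = \<phi> (e u)) \<Longrightarrow> e \<in> H"
    and z: "z \<in> carrier R" "\<sigma> (\<sigma> z) = z" and c: "c \<in> carrier R" "c \<otimes>\<^bsub>R\<^esub> (z \<ominus>\<^bsub>R\<^esub> \<sigma> z) = \<one>\<^bsub>R\<^esub>"
    and vw: "v \<in> carrier M" "w \<in> carrier M" "\<phi> v = w" "\<phi> w = \<pi> \<odot>\<^bsub>M\<^esub> v"
    and i: "i < d"
  shows "op (\<alpha> i) v \<in> H" "op (\<beta> i) w \<in> H"
proof -
  interpret E: Module.module R E by (rule module_E)
  let ?P = "op (\<alpha> i) v" and ?T = "op (\<beta> i) w"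
  note f = functional_\<alpha>_\<beta>[OF i]
  have P: "?P \<in> carrier E" and T: "?T \<in> carrier E" using f vw op_closed by auto
  \<comment> \<open>\<phi> turns the coefficient \<open>\<sigma> a\<close> at \<open>w\<close> into
    \<open>\<sigma> (\<sigma> a)\<close> at \<open>\<pi> \<odot> v\<close>; that this is
    \<open>a\<close> again makes \<open>g a\<close> commute with \<phi>.\<close>
  define g where "g a = a \<odot>\<^bsub>E\<^esub> ?P \<oplus>\<^bsub>E\<^esub> \<sigma> a \<odot>\<^bsub>E\<^esub> ?T" for a
  have gH: "g a \<in> H" if a: "a \<in> carrier R" "\<sigma> (\<sigma> a) = a" for a
  proof (rule inv)
    show "g a \<in> carrier E" using P T a by (auto simp: g_def)
    fix u assume u: "u \<in> carrier M"
    note cl = functionalD(1)[OF f(1) u] functionalD(1)[OF f(2) u]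
    have ga: "g a u = (a \<otimes>\<^bsub>R\<^esub> \<alpha> i u) \<odot>\<^bsub>M\<^esub> v \<oplus>\<^bsub>M\<^esub> (\<sigma> a \<otimes>\<^bsub>R\<^esub> \<beta> i u) \<odot>\<^bsub>M\<^esub> w" if "u \<in> carrier M" for u
      using that a vw functionalD(1)[OF f(1) that] functionalD(1)[OF f(2) that]
      by (simp add: g_def End_simps op_def smult_assoc1)
    have "g a (\<phi> u) = (a \<otimes>\<^bsub>R\<^esub> (\<pi> \<otimes>\<^bsub>R\<^esub> \<sigma> (\<beta> i u))) \<odot>\<^bsub>M\<^esub> v \<oplus>\<^bsub>M\<^esub> (\<sigma> a \<otimes>\<^bsub>R\<^esub> \<sigma> (\<alpha> i u)) \<odot>\<^bsub>M\<^esub> w"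
      using ga[of "\<phi> u"] u \<alpha>_\<beta>_\<phi>[OF u i] by simp
    also have "a \<otimes>\<^bsub>R\<^esub> (\<pi> \<otimes>\<^bsub>R\<^esub> \<sigma> (\<beta> i u)) = (a \<otimes>\<^bsub>R\<^esub> \<sigma> (\<beta> i u)) \<otimes>\<^bsub>R\<^esub> \<pi>"
      using a cl by (simp add: R.m_ac)
    also have "\<dots> \<odot>\<^bsub>M\<^esub> v \<oplus>\<^bsub>M\<^esub> (\<sigma> a \<otimes>\<^bsub>R\<^esub> \<sigma> (\<alpha> i u)) \<odot>\<^bsub>M\<^esub> w = \<phi> (g a u)"
      using a cl vw ga[OF u] by (simp add: smult_assoc1 M.a_comm)
    finally show "g a (\<phi> u) = \<phi> (g a u)" .
  qed
  note Hcl = E.submoduleE(4,5)[OF H]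
  \<comment> \<open>Subtracting \<open>\<sigma> z\<close> times \<open>g \<one>\<close> from
    \<open>g z\<close> removes \<open>?T\<close> and leaves the coefficient
    \<open>z \<ominus> \<sigma> z\<close> at \<open>?P\<close>; multiplication by \<open>c\<close>
    normalises it.\<close>
  let ?k = "\<ominus>\<^bsub>R\<^esub> (c \<otimes>\<^bsub>R\<^esub> \<sigma> z)"
  have k: "?k \<in> carrier R" using c z by simp
  have "c \<odot>\<^bsub>E\<^esub> g z \<oplus>\<^bsub>E\<^esub> ?k \<odot>\<^bsub>E\<^esub> g \<one>\<^bsub>R\<^esub> =
    (c \<otimes>\<^bsub>R\<^esub> z \<oplus>\<^bsub>R\<^esub> ?k) \<odot>\<^bsub>E\<^esub> ?P \<oplus>\<^bsub>E\<^esub> (c \<otimes>\<^bsub>R\<^esub> \<sigma> z \<oplus>\<^bsub>R\<^esub> ?k) \<odot>\<^bsub>E\<^esub> ?T"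
    using c z P T k by (simp add: g_def E.smult_l_distr E.smult_r_distr E.smult_assoc1 E.M.a_ac)
  also have "c \<otimes>\<^bsub>R\<^esub> z \<oplus>\<^bsub>R\<^esub> ?k = \<one>\<^bsub>R\<^esub>"
    using c z by (simp add: R.minus_eq R.r_distr R.r_minus)
  also have "c \<otimes>\<^bsub>R\<^esub> \<sigma> z \<oplus>\<^bsub>R\<^esub> ?k = \<zero>\<^bsub>R\<^esub>"
    using c z by (simp add: R.r_neg)
  also have "\<one>\<^bsub>R\<^esub> \<odot>\<^bsub>E\<^esub> ?P \<oplus>\<^bsub>E\<^esub> \<zero>\<^bsub>R\<^esub> \<odot>\<^bsub>E\<^esub> ?T = ?P" using P T by simp
  finally have "?P = c \<odot>\<^bsub>E\<^esub> g z \<oplus>\<^bsub>E\<^esub> ?k \<odot>\<^bsub>E\<^esub> g \<one>\<^bsub>R\<^esub>" ..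
  then show PH: "?P \<in> H" using gH Hcl c z k by simp
  have "g \<one>\<^bsub>R\<^esub> \<oplus>\<^bsub>E\<^esub> (\<ominus>\<^bsub>R\<^esub> \<one>\<^bsub>R\<^esub>) \<odot>\<^bsub>E\<^esub> ?P = ?T"
    using P T E.M.a_comm[OF P T] by (simp add: g_def E.smult_l_minus E.M.a_assoc E.M.r_neg)
  then show "?T \<in> H" using gH[of "\<one>\<^bsub>R\<^esub>"] Hcl(1)[OF _ PH, of "\<ominus>\<^bsub>R\<^esub> \<one>\<^bsub>R\<^esub>"] Hcl(2) by fastforce
qed

theorem \<pi>_pow_End_in_submodule:
  assumes H: "submodule H R E"
    and inv: "\<And>e. e \<in> carrier E \<Longrightarrow> (\<And>u. u \<in> carrier M \<Longrightarrow> e (\<phi> u) = \<phi> (e u)) \<Longrightarrow> e \<in> H"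
    and z: "z \<in> carrier R" "\<sigma> (\<sigma> z) = z" and c: "c \<in> carrier R" "c \<otimes>\<^bsub>R\<^esub> (z \<ominus>\<^bsub>R\<^esub> \<sigma> z) = \<one>\<^bsub>R\<^esub>"
    and e: "e \<in> carrier E"
  shows "\<pi> [^]\<^bsub>R\<^esub> (q + 1) \<odot>\<^bsub>E\<^esub> e \<in> H"
proof -
  interpret E: Module.module R E by (rule module_E)
  note op_H = op_in_submodule[OF H inv z c]
  have \<alpha>H: "op (\<alpha> i) (comb (\<lambda>i. \<pi> \<otimes>\<^bsub>R\<^esub> a i) b) \<in> H" if "i < d" "a \<in> scalars" "b \<in> scalars" for i a b
  proof -
    have sub: "submodule {w \<in> carrier M. op (\<alpha> i) w \<in> H} R M"
      by (rule submodule_op_preimage[OF functional_\<alpha>_\<beta>(1)[OF that(1)] H])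
    have "op (\<alpha> i) (X k) \<in> H" "op (\<alpha> i) (Y k) \<in> H" for k
      using op_H(1)[of "X k" "Y k" i] op_H(1)[of "Y k" "\<pi> \<odot>\<^bsub>M\<^esub> X k" i] that by (simp_all add: \<phi>_X \<phi>_Y)
    then have "comb (\<lambda>i. \<pi> \<otimes>\<^bsub>R\<^esub> a i) b \<in> {w \<in> carrier M. op (\<alpha> i) w \<in> H}"
      using that by (intro comb_in_submodule sub submoduleE(4)[OF sub]) (auto intro: scalarsI)
    then show ?thesis by simp
  qed
  have \<beta>H: "op (\<beta> i) (comb (\<lambda>i. \<pi> \<otimes>\<^bsub>R\<^esub> a i) b) \<in> H" if "i < d" "a \<in> scalars" "b \<in> scalars" for i a b
  proof -
    have sub: "submodule {w \<in> carrier M. op (\<beta> i) w \<in> H} R M"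
      by (rule submodule_op_preimage[OF functional_\<alpha>_\<beta>(2)[OF that(1)] H])
    have *: "op (\<beta> i) (Y k) \<in> H" "op (\<beta> i) (\<pi> \<odot>\<^bsub>M\<^esub> X k) \<in> H" for k
      using op_H(2)[of "X k" "Y k" i] op_H(2)[of "Y k" "\<pi> \<odot>\<^bsub>M\<^esub> X k" i] that by (simp_all add: \<phi>_X \<phi>_Y)
    \<comment> \<open>\<open>op (\<beta> i)\<close> is known to be in \<open>H\<close> at
      \<open>\<pi> \<odot> X k\<close>, so the factor \<pi> is moved from the coefficient to the
      vector.\<close>
    have "(\<pi> \<otimes>\<^bsub>R\<^esub> a k) \<odot>\<^bsub>M\<^esub> X k = a k \<odot>\<^bsub>M\<^esub> (\<pi> \<odot>\<^bsub>M\<^esub> X k)" for k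
      using that by (simp add: R.m_comm flip: smult_assoc1)
    then have "(\<pi> \<otimes>\<^bsub>R\<^esub> a k) \<odot>\<^bsub>M\<^esub> X k \<in> {w \<in> carrier M. op (\<beta> i) w \<in> H}" for k
      using submoduleE(4)[OF sub, of "a k" "\<pi> \<odot>\<^bsub>M\<^esub> X k"] that * by simp
    then have "comb (\<lambda>i. \<pi> \<otimes>\<^bsub>R\<^esub> a i) b \<in> {w \<in> carrier M. op (\<beta> i) w \<in> H}"
      using that * by (intro comb_in_submodule sub) (auto intro: scalarsI)
    then show ?thesis by simp
  qed
  define e' where "e' = \<pi> [^]\<^bsub>R\<^esub> r \<odot>\<^bsub>E\<^esub> e"
  have e': "e' \<in> carrier E" using e by (simp add: e'_def)
  have e'_apply: "e' u = \<pi> [^]\<^bsub>R\<^esub> r \<odot>\<^bsub>M\<^esub> e u" if "u \<in> carrier M" for u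
    using that by (simp add: e'_def End_simps)
  have e'_comb: "\<exists>a\<in>scalars. \<exists>b\<in>scalars. e' u = comb (\<lambda>i. \<pi> \<otimes>\<^bsub>R\<^esub> a i) b" if "u \<in> carrier M" for u
    unfolding e'_apply[OF that] by (rule \<pi>_pow_r) (rule End_memD(2)[OF e that])
  \<comment> \<open>\<open>e'\<close> is evaluated at \<open>\<pi> [^] s \<odot> u\<close>, expanded
    with coefficients \<open>\<alpha> i u\<close> and \<open>\<beta> i u\<close>. By the choice of
    \<open>r\<close> its values are combinations of the \<open>\<pi> \<odot> X k\<close> and
    \<open>Y k\<close>, so each \<open>G i\<close> is in \<open>H\<close>.\<close>
  define G where "G i = op (\<alpha> i) (e' (X i)) \<oplus>\<^bsub>E\<^esub> op (\<beta> i) (e' (Y i))" for i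
  have GH: "G i \<in> H" if "i < d" for i
    using e'_comb[of "X i"] e'_comb[of "Y i"] \<alpha>H[OF that] \<beta>H[OF that] E.submoduleE(5)[OF H]
    by (auto simp: G_def)
  have "\<pi> [^]\<^bsub>R\<^esub> (q + 1) \<odot>\<^bsub>E\<^esub> e = (\<Oplus>\<^bsub>E\<^esub>i\<in>{..<d}. G i)"
  proof (rule extensionalityI)
    have "G i \<in> carrier E" if "i < d" for i using GH[OF that] E.submoduleE(1)[OF H] by blast
    note G = this
    show "(\<Oplus>\<^bsub>E\<^esub>i\<in>{..<d}. G i) \<in> extensional (carrier M)"
      by (rule End_memD(1)[of _ R]) (use G in auto)
    show "\<pi> [^]\<^bsub>R\<^esub> (q + 1) \<odot>\<^bsub>E\<^esub> e \<in> extensional (carrier M)"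
      using e by (intro End_memD(1)[of _ R] E.smult_closed) auto
    fix u assume u: "u \<in> carrier M"
    have rs: "q + 1 = r + s" by (simp add: r_def s_def)
    have "(\<pi> [^]\<^bsub>R\<^esub> (q + 1) \<odot>\<^bsub>E\<^esub> e) u = \<pi> [^]\<^bsub>R\<^esub> (q + 1) \<odot>\<^bsub>M\<^esub> e u"
      using u by (simp add: End_simps)
    also have "\<dots> = \<pi> [^]\<^bsub>R\<^esub> r \<odot>\<^bsub>M\<^esub> (\<pi> [^]\<^bsub>R\<^esub> s \<odot>\<^bsub>M\<^esub> e u)"
      unfolding rs using u End_memD(2)[OF e] by (simp add: R.nat_pow_mult[symmetric] smult_assoc1)
    also have "\<dots> = e' (comb (\<lambda>i. \<alpha> i u) (\<lambda>i. \<beta> i u))"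
      using u End_memD(2,4)[OF e] \<alpha>_\<beta>[OF u] by (simp add: e'_apply flip: \<alpha>_\<beta>(3)[OF u])
    also have "\<dots> = (\<Oplus>\<^bsub>M\<^esub>i\<in>{..<d}. \<alpha> i u \<odot>\<^bsub>M\<^esub> e' (X i) \<oplus>\<^bsub>M\<^esub> \<beta> i u \<odot>\<^bsub>M\<^esub> e' (Y i))"
      by (rule End_comb[OF e' \<alpha>_\<beta>(1,2)[OF u]])
    also have "\<dots> = (\<Oplus>\<^bsub>M\<^esub>i\<in>{..<d}. G i u)"
      using u scalarsD[OF \<alpha>_\<beta>(1)[OF u]] scalarsD[OF \<alpha>_\<beta>(2)[OF u]] End_memD(2)[OF e']
      by (intro M.finsum_cong') (auto simp: G_def End_simps op_def)
    also have "\<dots> = (\<Oplus>\<^bsub>E\<^esub>i\<in>{..<d}. G i) u"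
      using G u by (intro End_finsum_apply[symmetric] module_axioms) auto
    finally show "(\<pi> [^]\<^bsub>R\<^esub> (q + 1) \<odot>\<^bsub>E\<^esub> e) u = (\<Oplus>\<^bsub>E\<^esub>i\<in>{..<d}. G i) u" .
  qed
  then show ?thesis using GH E.submodule_finsum[OF H, of "{..<d}" G] by auto
qed

end

section \<open>Inverting \<open>p\<close>\<close>

lemma (in abelian_group) add_pow_additive:
  fixes N (structure)
  assumes "abelian_group N" "\<And>u. u \<in> carrier G \<Longrightarrow> f u \<in> carrier N"
    and "\<And>u v. u \<in> carrier G \<Longrightarrow> v \<in> carrier G \<Longrightarrow> f (u \<oplus> v) = f u \<oplus>\<^bsub>N\<^esub> f v"
    and "u \<in> carrier G"
  shows "f ([(n::nat)] \<cdot> u) = [n] \<cdot>\<^bsub>N\<^esub> f u"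
proof -
  interpret N: abelian_group N by fact
  have "f \<zero> \<oplus>\<^bsub>N\<^esub> f \<zero> = f \<zero>" using assms(3)[of \<zero> \<zero>] by simp
  then have "f \<zero> = \<zero>\<^bsub>N\<^esub>" using assms(2)[of \<zero>] by (metis N.add.r_cancel_one' zero_closed)
  then show ?thesis using assms(2-4) by (induction n) (simp_all add: add_pow_0 add_pow_Suc)
qed

section \<open>Fractions, their operations and induced maps\<close>

locale loc_module = abelian_group M for M :: "('a, 'm) module" (structure) +
  fixes p :: nat
begin

lemma pow_pow: "u \<in> carrier M \<Longrightarrow> [(p ^ i)] \<cdot> ([(p ^ j)] \<cdot> u) = [(p ^ (i + j))] \<cdot> u"
  by (simp add: add.nat_pow_pow power_add mult.commute)

lemma equiv_loc_rel: "equiv (carrier M \<times> UNIV) (loc_rel p M)"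
proof (rule equivI)
  show "loc_rel p M \<subseteq> (carrier M \<times> UNIV) \<times> (carrier M \<times> UNIV)" by (auto simp: loc_rel_def)
  show "refl_on (carrier M \<times> UNIV) (loc_rel p M)" by (auto simp: refl_on_def loc_rel_def)
  show "sym (loc_rel p M)" by (rule symI) (auto simp: loc_rel_def intro: sym)
  show "trans (loc_rel p M)"
  proof (rule transI, clarify)
    fix m i m' i' m'' i''
    assume "((m, i), (m', i')) \<in> loc_rel p M" "((m', i'), (m'', i'')) \<in> loc_rel p M"
    then obtain l l' where *: "m \<in> carrier M" "m' \<in> carrier M" "m'' \<in> carrier M"
      "[(p ^ (l + i'))] \<cdot> m = [(p ^ (l + i))] \<cdot> m'" "[(p ^ (l' + i''))] \<cdot> m' = [(p ^ (l' + i'))] \<cdot> m''"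
      by (auto simp: loc_rel_def)
    have "[(p ^ (l + l' + i' + i''))] \<cdot> m = [(p ^ (l' + i''))] \<cdot> ([(p ^ (l + i'))] \<cdot> m)"
      using *(1-3) by (simp add: pow_pow add.commute add.left_commute)
    also have "\<dots> = [(p ^ (l + i))] \<cdot> ([(p ^ (l' + i''))] \<cdot> m')"
      unfolding *(4)
      using *(1-3) by (simp add: pow_pow add.commute add.left_commute)
    also have "\<dots> = [(p ^ (l + l' + i' + i))] \<cdot> m''"
      unfolding *(5)
      using *(1-3) by (simp add: pow_pow add.commute add.left_commute)
    finally show "((m, i), (m'', i'')) \<in> loc_rel p M"
      using * unfolding loc_rel_def by (auto intro: exI[of _ "l + l' + i'"])
  qed
qed

lemma loc_frac_eq_iff:
  assumes "m \<in> carrier M" "m' \<in> carrier M"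
  shows "loc_frac p M m i = loc_frac p M m' i' \<longleftrightarrow> (\<exists>l. [(p ^ (l + i'))] \<cdot> m = [(p ^ (l + i))] \<cdot> m')"
  using eq_equiv_class_iff[OF equiv_loc_rel, of "(m, i)" "(m', i')"] assms
  by (auto simp: loc_frac_def loc_rel_def)

lemma loc_frac_cancel:
  assumes "m \<in> carrier M"
  shows "loc_frac p M ([(p ^ k)] \<cdot> m) (i + k) = loc_frac p M m i"
  using assms by (auto simp: loc_frac_eq_iff pow_pow add.commute add.left_commute)

lemma carrier_loc: "carrier (loc p M) = {loc_frac p M m i | m i. m \<in> carrier M}"
  by (auto simp: loc_def quotient_def loc_frac_def)

lemma loc_frac_closed: "m \<in> carrier M \<Longrightarrow> loc_frac p M m i \<in> carrier (loc p M)"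
  by (auto simp: carrier_loc)

text \<open>Operations on \<open>loc p M\<close> are unions over representatives; a function
  constant on a class collapses the union to one value. The hypothesis has the form in which
  equality of fractions is available.\<close>

lemma UN_loc_frac:
  assumes "m \<in> carrier M"
    and "\<And>m i m' i' l. m \<in> carrier M \<Longrightarrow> m' \<in> carrier M \<Longrightarrow> [(p ^ (l + i'))] \<cdot> m = [(p ^ (l + i))] \<cdot> m' \<Longrightarrow> F m i = F m' i'"
  shows "(\<Union>(m, i)\<in>loc_frac p M m i. F m i) = F m i"
proof -
  have "(\<lambda>(m, i). F m i) respects loc_rel p M"
  proof (rule congruentI, clarify)
    fix n j n' j'
    assume "((n, j), (n', j')) \<in> loc_rel p M"
    then obtain l where "n \<in> carrier M" "n' \<in> carrier M" "[(p ^ (l + j'))] \<cdot> n = [(p ^ (l + j))] \<cdot> n'"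
      by (auto simp: loc_rel_def)
    then show "F n j = F n' j'" by (rule assms(2))
  qed
  then show ?thesis
    using UN_equiv_class[OF equiv_loc_rel, of "\<lambda>(m, i). F m i" "(m, i)"] assms(1)
    by (simp add: loc_frac_def)
qed

text \<open>Independence of representatives is computed by cross multiplication in the left argument
  and transported to the right one by commutativity.\<close>

lemma loc_add_frac:
  assumes "m \<in> carrier M" "m' \<in> carrier M"
  shows "loc_frac p M m i \<oplus>\<^bsub>loc p M\<^esub> loc_frac p M m' i' = loc_frac p M ([(p ^ i')] \<cdot> m \<oplus> [(p ^ i)] \<cdot> m') (i + i')"
proof -
  define F where "F m i m' i' = loc_frac p M ([(p ^ i')] \<cdot> m \<oplus> [(p ^ i)] \<cdot> m') (i + i')" for m i m' i'
  have F_left: "F m i n j = F m' i' n j"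
    if "m \<in> carrier M" "m' \<in> carrier M" "n \<in> carrier M" "[(p ^ (l + i'))] \<cdot> m = [(p ^ (l + i))] \<cdot> m'" for m i m' i' n j l
  proof -
    have "[(p ^ (l + (i' + j)))] \<cdot> ([(p ^ j)] \<cdot> m \<oplus> [(p ^ i)] \<cdot> n) = [(p ^ (2 * j))] \<cdot> ([(p ^ (l + i'))] \<cdot> m) \<oplus> [(p ^ (l + i' + i + j))] \<cdot> n"
      using that(1-3) by (simp add: add.nat_pow_distrib pow_pow add.commute add.left_commute mult_2)
    also have "\<dots> = [(p ^ (l + (i + j)))] \<cdot> ([(p ^ j)] \<cdot> m' \<oplus> [(p ^ i')] \<cdot> n)"
      unfolding that(4) using that(1-3) by (simp add: add.nat_pow_distrib pow_pow add.commute add.left_commute mult_2)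
    finally show ?thesis
      unfolding F_def using that by (subst loc_frac_eq_iff) auto
  qed
  have F_swap: "F m i m' i' = F m' i' m i" if "m \<in> carrier M" "m' \<in> carrier M" for m i m' i'
    using that by (simp add: F_def a_comm add.commute)
  have "loc_frac p M m i \<oplus>\<^bsub>loc p M\<^esub> loc_frac p M m' i' =
    (\<Union>(m, i)\<in>loc_frac p M m i. \<Union>(m', i')\<in>loc_frac p M m' i'. F m i m' i')"
    by (simp add: loc_def F_def)
  also have "\<dots> = (\<Union>(m', i')\<in>loc_frac p M m' i'. F m i m' i')"
  proof (rule UN_loc_frac[OF assms(1)])
    fix n j n' j' l assume *: "n \<in> carrier M" "n' \<in> carrier M" "[(p ^ (l + j'))] \<cdot> n = [(p ^ (l + j))] \<cdot> n'"
    have "F n j m' i' = F n' j' m' i'" if "(m', i') \<in> loc_frac p M m' i'" for m' i'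
      using F_left[of n n' m' l j' j i'] * that by (auto simp: loc_frac_def loc_rel_def)
    moreover have "m' \<in> carrier M" if "(m', i') \<in> loc_frac p M n i" for m' i' n i
      using that by (auto simp: loc_frac_def loc_rel_def)
    ultimately show "(\<Union>(m', i')\<in>loc_frac p M m' i'. F n j m' i') = (\<Union>(m', i')\<in>loc_frac p M m' i'. F n' j' m' i')"
      using F_left[of n n' _ l j' j] * by (intro SUP_cong refl) auto
  qed
  also have "\<dots> = F m i m' i'"
  proof (rule UN_loc_frac[OF assms(2)])
    fix n j n' j' l assume *: "n \<in> carrier M" "n' \<in> carrier M" "[(p ^ (l + j'))] \<cdot> n = [(p ^ (l + j))] \<cdot> n'"
    then show "F m i n j = F m i n' j'"
      using F_left[OF *(1,2) assms(1) *(3)] F_swap assms(1) by metis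
  qed
  finally show ?thesis by (simp add: F_def)
qed

lemma loc_add_frac_same:
  assumes "m \<in> carrier M" "m' \<in> carrier M"
  shows "loc_frac p M m i \<oplus>\<^bsub>loc p M\<^esub> loc_frac p M m' i = loc_frac p M (m \<oplus> m') i"
  using assms loc_frac_cancel[of "m \<oplus> m'" i i] by (simp add: loc_add_frac add.nat_pow_distrib)

lemma loc_map_frac:
  assumes "abelian_group N" "m \<in> carrier M" "\<And>u. u \<in> carrier M \<Longrightarrow> f u \<in> carrier N"
    and "\<And>u v. u \<in> carrier M \<Longrightarrow> v \<in> carrier M \<Longrightarrow> f (u \<oplus> v) = f u \<oplus>\<^bsub>N\<^esub> f v"
  shows "loc_map p M N f (loc_frac p M m i) = loc_frac p N (f m) i"
proof -
  interpret N: loc_module N p using assms(1) by (rule loc_module.intro)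
  have "(\<Union>(m, i)\<in>loc_frac p M m i. loc_frac p N (f m) i) = loc_frac p N (f m) i"
  proof (rule UN_loc_frac[OF assms(2)])
    fix n j n' j' l assume *: "n \<in> carrier M" "n' \<in> carrier M" "[(p ^ (l + j'))] \<cdot> n = [(p ^ (l + j))] \<cdot> n'"
    then have "f ([(p ^ (l + j'))] \<cdot> n) = f ([(p ^ (l + j))] \<cdot> n')" by simp
    then have "[(p ^ (l + j'))] \<cdot>\<^bsub>N\<^esub> f n = [(p ^ (l + j))] \<cdot>\<^bsub>N\<^esub> f n'"
      using *(1,2) by (simp add: add_pow_additive[OF assms(1,3,4)])
    then show "loc_frac p N (f n) j = loc_frac p N (f n') j'"
      using assms(3) * by (auto simp: N.loc_frac_eq_iff)
  qed
  then show ?thesis using loc_frac_closed[OF assms(2)] by (simp add: loc_map_def)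
qed

end

lemma loc_smult_frac:
  fixes R (structure) and M :: "('a, 'm) module" (structure)
  assumes "Module.module R M" "m \<in> carrier M" "a \<in> carrier R"
  shows "a \<odot>\<^bsub>loc p M\<^esub> loc_frac p M m i = loc_frac p M (a \<odot>\<^bsub>M\<^esub> m) i"
proof -
  interpret Module.module R M by fact
  interpret M: loc_module M p by (rule loc_module.intro) (rule M.abelian_group_axioms)
  have "(\<Union>(m, i)\<in>loc_frac p M m i. loc_frac p M (a \<odot>\<^bsub>M\<^esub> m) i) = loc_frac p M (a \<odot>\<^bsub>M\<^esub> m) i"
  proof (rule M.UN_loc_frac[OF assms(2)])
    fix n j n' j' l assume *: "n \<in> carrier M" "n' \<in> carrier M" "[(p ^ (l + j'))] \<cdot>\<^bsub>M\<^esub> n = [(p ^ (l + j))] \<cdot>\<^bsub>M\<^esub> n'"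
    then have "a \<odot>\<^bsub>M\<^esub> ([(p ^ (l + j'))] \<cdot>\<^bsub>M\<^esub> n) = a \<odot>\<^bsub>M\<^esub> ([(p ^ (l + j))] \<cdot>\<^bsub>M\<^esub> n')" by simp
    then have "[(p ^ (l + j'))] \<cdot>\<^bsub>M\<^esub> (a \<odot>\<^bsub>M\<^esub> n) = [(p ^ (l + j))] \<cdot>\<^bsub>M\<^esub> (a \<odot>\<^bsub>M\<^esub> n')"
      using *(1,2) assms(3)
      by (simp add: M.add_pow_additive[of M "\<lambda>u. a \<odot>\<^bsub>M\<^esub> u"] smult_r_distr M.abelian_group_axioms)
    then show "loc_frac p M (a \<odot>\<^bsub>M\<^esub> n) j = loc_frac p M (a \<odot>\<^bsub>M\<^esub> n') j'"
      using assms(3) * by (auto simp: M.loc_frac_eq_iff)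
  qed
  then show ?thesis by (simp add: loc_def)
qed

text \<open>\<open>inv_into\<close> returns some preimage \<open>w\<close> of \<open>v\<close> under
  Frobenius; one exists because \<open>m / p ^ i = (p m) / p ^ (i + 1)\<close> and
  \<open>p m\<close> is in the range of \<phi>. Then
  \<open>\<phi> (e w) = e (\<phi> w) = e v\<close>.\<close>

lemma frob_conj_loc_map:
  fixes M :: "(nat \<Rightarrow> 'k::comm_ring_1, 'm) module" (structure)
  assumes "abelian_group M" "multiples p M \<subseteq> \<phi> ` carrier M"
    and \<phi>: "\<And>u. u \<in> carrier M \<Longrightarrow> \<phi> u \<in> carrier M"
      "\<And>u v. u \<in> carrier M \<Longrightarrow> v \<in> carrier M \<Longrightarrow> \<phi> (u \<oplus> v) = \<phi> u \<oplus> \<phi> v"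
    and e: "\<And>u. u \<in> carrier M \<Longrightarrow> e u \<in> carrier M"
      "\<And>u v. u \<in> carrier M \<Longrightarrow> v \<in> carrier M \<Longrightarrow> e (u \<oplus> v) = e u \<oplus> e v"
    and comm: "\<And>u. u \<in> carrier M \<Longrightarrow> e (\<phi> u) = \<phi> (e u)"
  shows "frob_conj p M \<phi> (loc_map p M M e) = loc_map p M M e"
proof -
  interpret M: loc_module M p by (rule loc_module.intro) fact
  note \<phi>_frac = M.loc_map_frac[OF assms(1) _ \<phi>] and e_frac = M.loc_map_frac[OF assms(1) _ e]
  have surj: "v \<in> loc_map p M M \<phi> ` carrier (loc p M)" if v: "v \<in> carrier (loc p M)" for v
  proof -
    obtain m i where m: "m \<in> carrier M" "v = loc_frac p M m i" using v by (auto simp: M.carrier_loc)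
    have "[p] \<cdot> m \<in> \<phi> ` carrier M" using assms(2) m(1) by (auto simp: multiples_def)
    then obtain n where n: "n \<in> carrier M" "[p] \<cdot> m = \<phi> n" by auto
    have "v = loc_frac p M ([p] \<cdot> m) (i + 1)" using M.loc_frac_cancel[OF m(1), of 1 i] m(2) by simp
    also have "\<dots> = loc_map p M M \<phi> (loc_frac p M n (i + 1))" using n \<phi>_frac by simp
    finally show ?thesis using M.loc_frac_closed[OF n(1)] by blast
  qed
  have comm': "loc_map p M M \<phi> (loc_map p M M e v) = loc_map p M M e (loc_map p M M \<phi> v)"
    if "v \<in> carrier (loc p M)" for v
    using that \<phi>(1) e(1) comm by (auto simp: M.carrier_loc \<phi>_frac e_frac)
  show ?thesis
  proof
    fix v
    show "frob_conj p M \<phi> (loc_map p M M e) v = loc_map p M M e v"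
    proof (cases "v \<in> carrier (loc p M)")
      case True
      let ?w = "inv_into (carrier (loc p M)) (loc_map p M M \<phi>) v"
      have "?w \<in> carrier (loc p M)" "loc_map p M M \<phi> ?w = v"
        using surj[OF True] by (rule inv_into_into, rule f_inv_into_f)
      then show ?thesis using True comm' by (simp add: frob_conj_def)
    qed (simp add: frob_conj_def loc_map_def)
  qed
qed

section \<open>Clearing denominators in an isomorphism after inverting \<open>p\<close>\<close>

text \<open>Encoded as an induction principle, so that arguments about linear maps need no
  coefficients; a basis and the standard unit vectors both satisfy it.\<close>

definition generates :: "('a, 'r) ring_scheme \<Rightarrow> ('a, 'm) module \<Rightarrow> 'm set \<Rightarrow> bool" where
  "generates R M B \<longleftrightarrow> finite B \<and> B \<subseteq> carrier M \<and> (\<forall>S. \<zero>\<^bsub>M\<^esub> \<in> S \<longrightarrow>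
     (\<forall>u\<in>S \<inter> carrier M. \<forall>v\<in>S \<inter> carrier M. u \<oplus>\<^bsub>M\<^esub> v \<in> S) \<longrightarrow>
     (\<forall>a\<in>carrier R. \<forall>u\<in>S \<inter> carrier M. a \<odot>\<^bsub>M\<^esub> u \<in> S) \<longrightarrow> B \<subseteq> S \<longrightarrow> carrier M \<subseteq> S)"

lemma generates_induct [consumes 2, case_names zero add smult base]:
  assumes "generates R M B" "u \<in> carrier M" "P \<zero>\<^bsub>M\<^esub>"
    "\<And>u v. u \<in> carrier M \<Longrightarrow> v \<in> carrier M \<Longrightarrow> P u \<Longrightarrow> P v \<Longrightarrow> P (u \<oplus>\<^bsub>M\<^esub> v)"
    "\<And>a u. a \<in> carrier R \<Longrightarrow> u \<in> carrier M \<Longrightarrow> P u \<Longrightarrow> P (a \<odot>\<^bsub>M\<^esub> u)"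
    "\<And>b. b \<in> B \<Longrightarrow> P b"
  shows "P u"
  using assms(1)[unfolded generates_def, THEN conjunct2, THEN conjunct2, rule_format, of "Collect P"] assms(2-)
  by blast

text \<open>Finitely many generators have finitely many denominators, and the elements whose image
  can be written over \<open>p ^ n\<close> are closed under addition and scalars.\<close>

lemma common_denominator:
  fixes R (structure) and N :: "('a, 'n) module" and M :: "('a, 'm) module"
  assumes "Module.module R N" "Module.module R M" "generates R N B"
    and f: "f \<in> linear_maps R (loc p N) (loc p M)"
  shows "\<exists>n. \<forall>v\<in>carrier N. \<exists>m\<in>carrier M. f (loc_frac p N v 0) = loc_frac p M m n"
proof -
  interpret N: Module.module R N by fact
  interpret M: Module.module R M by fact
  interpret N': loc_module N p by (rule loc_module.intro) (rule N.M.abelian_group_axioms)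
  interpret M': loc_module M p by (rule loc_module.intro) (rule M.M.abelian_group_axioms)
  note f' = semilinear_mapsD[OF f]
  have B: "finite B" "B \<subseteq> carrier N" using assms(3) by (auto simp: generates_def)
  have "\<forall>b\<in>B. \<exists>n m. m \<in> carrier M \<and> f (loc_frac p N b 0) = loc_frac p M m n"
  proof
    fix b assume "b \<in> B"
    then have "f (loc_frac p N b 0) \<in> carrier (loc p M)" using B by (intro f' N'.loc_frac_closed) auto
    then show "\<exists>n m. m \<in> carrier M \<and> f (loc_frac p N b 0) = loc_frac p M m n" by (auto simp: M'.carrier_loc)
  qed
  then obtain k where k: "\<And>b. b \<in> B \<Longrightarrow> \<exists>m. m \<in> carrier M \<and> f (loc_frac p N b 0) = loc_frac p M m (k b)"
    by metis
  \<comment> \<open>Any upper bound of the exponents works; the sum also covers an empty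
    \<open>B\<close>.\<close>
  define n where "n = sum k B"
  have "\<exists>m\<in>carrier M. f (loc_frac p N v 0) = loc_frac p M m n" if "v \<in> carrier N" for v
    using assms(3) that
  proof (induction v rule: generates_induct)
    case zero
    obtain m i where m: "m \<in> carrier M" "f (loc_frac p N \<zero>\<^bsub>N\<^esub> 0) = loc_frac p M m i"
      using f'(1)[OF N'.loc_frac_closed[of "\<zero>\<^bsub>N\<^esub>" 0]] by (auto simp: M'.carrier_loc)
    have "f (loc_frac p N \<zero>\<^bsub>N\<^esub> 0) = f (\<zero> \<odot>\<^bsub>loc p N\<^esub> loc_frac p N \<zero>\<^bsub>N\<^esub> 0)"
      by (simp add: loc_smult_frac[OF assms(1)])
    also have "\<dots> = loc_frac p M \<zero>\<^bsub>M\<^esub> i"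
      using m f'(3)[OF N.R.zero_closed N'.loc_frac_closed[of "\<zero>\<^bsub>N\<^esub>" 0]] by (simp add: loc_smult_frac[OF assms(2)])
    also have "\<dots> = loc_frac p M \<zero>\<^bsub>M\<^esub> n" by (auto simp: M'.loc_frac_eq_iff)
    finally show ?case by blast
  next
    case (add u v)
    then obtain m m' where "m \<in> carrier M" "f (loc_frac p N u 0) = loc_frac p M m n"
      "m' \<in> carrier M" "f (loc_frac p N v 0) = loc_frac p M m' n" by blast
    then have "f (loc_frac p N (u \<oplus>\<^bsub>N\<^esub> v) 0) = loc_frac p M (m \<oplus>\<^bsub>M\<^esub> m') n"
      using add f'(2)[OF N'.loc_frac_closed N'.loc_frac_closed, of u v 0 0]
      by (simp add: N'.loc_add_frac_same M'.loc_add_frac_same)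
    then show ?case using \<open>m \<in> carrier M\<close> \<open>m' \<in> carrier M\<close> by blast
  next
    case (smult a u)
    then obtain m where "m \<in> carrier M" "f (loc_frac p N u 0) = loc_frac p M m n" by blast
    then have "f (loc_frac p N (a \<odot>\<^bsub>N\<^esub> u) 0) = loc_frac p M (a \<odot>\<^bsub>M\<^esub> m) n"
      using smult f'(3)[OF smult(1) N'.loc_frac_closed, of u 0]
      by (simp add: loc_smult_frac[OF assms(1)] loc_smult_frac[OF assms(2)])
    then show ?case using \<open>m \<in> carrier M\<close> smult by blast
  next
    case (base b)
    then obtain m where m: "m \<in> carrier M" "f (loc_frac p N b 0) = loc_frac p M m (k b)" using k by blast
    have "k b + (n - k b) = n" using base B(1) by (simp add: n_def member_le_sum)
    then have "f (loc_frac p N b 0) = loc_frac p M ([(p ^ (n - k b))] \<cdot>\<^bsub>M\<^esub> m) n"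
      using M'.loc_frac_cancel[OF m(1), of "n - k b" "k b"] m(2) by simp
    then show ?case using m(1) by blast
  qed
  then show ?thesis by blast
qed

lemma (in Module.module) nat_smult:
  assumes "u \<in> carrier M"
  shows "[(n::nat)] \<cdot>\<^bsub>M\<^esub> u = ([n] \<cdot>\<^bsub>R\<^esub> \<one>\<^bsub>R\<^esub>) \<odot>\<^bsub>M\<^esub> u"
  using assms by (induction n) (simp_all add: add_pow_0 add_pow_Suc smult_l_distr)

text \<open>With a common denominator \<open>p ^ n\<close>, the map \<open>j\<close> is
  \<open>p ^ n\<close> times \<open>f\<close> on \<open>N\<close>. Torsion-freeness makes numerators
  over a fixed denominator unique, so linearity and commutation with Frobenius descend from
  \<open>f\<close> to \<open>j\<close>. The inverse of \<open>f\<close> has its own denominator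
  \<open>p ^ n'\<close>, whence \<open>p ^ (n' + n)\<close> carries \<open>M\<close> into the
  image.\<close>

lemma ex_embedding_of_loc_iso:
  fixes R (structure) and N :: "('a, 'n) module" and M :: "('a, 'm) module"
  assumes N: "Module.module R N" and M: "Module.module R M" and gN: "generates R N B" and gM: "generates R M C"
    and tN: "\<And>u n. u \<in> carrier N \<Longrightarrow> [(p ^ n)] \<cdot>\<^bsub>N\<^esub> u = \<zero>\<^bsub>N\<^esub> \<Longrightarrow> u = \<zero>\<^bsub>N\<^esub>"
    and tM: "\<And>u n. u \<in> carrier M \<Longrightarrow> [(p ^ n)] \<cdot>\<^bsub>M\<^esub> u = \<zero>\<^bsub>M\<^esub> \<Longrightarrow> u = \<zero>\<^bsub>M\<^esub>"
    and \<psi>: "\<psi> \<in> semilinear_maps R \<sigma> N N" and \<phi>: "\<phi> \<in> semilinear_maps R \<sigma> M M"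
    and f: "f \<in> linear_maps R (loc p N) (loc p M)" "bij_betw f (carrier (loc p N)) (carrier (loc p M))"
    and comm: "\<And>v. v \<in> carrier (loc p N) \<Longrightarrow> f (loc_map p N N \<psi> v) = loc_map p M M \<phi> (f v)"
  shows "\<exists>j n. j \<in> linear_maps R N M \<and> inj_on j (carrier N) \<and> (\<forall>x\<in>carrier N. j (\<psi> x) = \<phi> (j x)) \<and>
    (\<forall>u\<in>carrier M. [(p ^ n)] \<cdot>\<^bsub>M\<^esub> u \<in> j ` carrier N)"
proof -
  interpret N: Module.module R N by fact
  interpret M: Module.module R M by fact
  interpret N': loc_module N p by (rule loc_module.intro) (rule N.M.abelian_group_axioms)
  interpret M': loc_module M p by (rule loc_module.intro) (rule M.M.abelian_group_axioms)
  have cancel: "u = v" if G: "abelian_group G" "\<And>u n. u \<in> carrier G \<Longrightarrow> [(p ^ n)] \<cdot>\<^bsub>G\<^esub> u = \<zero>\<^bsub>G\<^esub> \<Longrightarrow> u = \<zero>\<^bsub>G\<^esub>"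
    "u \<in> carrier G" "v \<in> carrier G" "loc_frac p G u i = loc_frac p G v i"
    for G :: "('a, 'g) module" and u v i
  proof -
    interpret G: loc_module G p by (rule loc_module.intro) fact
    obtain l where "[(p ^ (l + i))] \<cdot>\<^bsub>G\<^esub> u = [(p ^ (l + i))] \<cdot>\<^bsub>G\<^esub> v"
      using G(5) G.loc_frac_eq_iff[OF G(3,4), of i i] by blast
    then have "[(p ^ (l + i))] \<cdot>\<^bsub>G\<^esub> (u \<ominus>\<^bsub>G\<^esub> v) = \<zero>\<^bsub>G\<^esub>"
      using that by (simp add: G.minus_eq G.add.nat_pow_distrib G.add.nat_pow_inv G.r_neg)
    then have "u \<ominus>\<^bsub>G\<^esub> v = \<zero>\<^bsub>G\<^esub>" using that by auto
    then show ?thesis using that by (metis G.a_inv_closed G.minus_eq G.minus_equality G.minus_minus)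
  qed
  have cancelN: "u = v" if "u \<in> carrier N" "v \<in> carrier N" "loc_frac p N u i = loc_frac p N v i" for u v i
    by (rule cancel[OF N.M.abelian_group_axioms tN that])
  have cancelM: "u = v" if "u \<in> carrier M" "v \<in> carrier M" "loc_frac p M u i = loc_frac p M v i" for u v i
    by (rule cancel[OF M.M.abelian_group_axioms tM that])
  obtain n where n: "\<And>v. v \<in> carrier N \<Longrightarrow> \<exists>m\<in>carrier M. f (loc_frac p N v 0) = loc_frac p M m n"
    using common_denominator[OF N M gN f(1)] by blast
  then obtain j where j: "\<And>v. v \<in> carrier N \<Longrightarrow> j v \<in> carrier M"
    "\<And>v. v \<in> carrier N \<Longrightarrow> f (loc_frac p N v 0) = loc_frac p M (j v) n"
    by metis
  note f' = semilinear_mapsD[OF f(1)] and \<psi>' = semilinear_mapsD[OF \<psi>] and \<phi>' = semilinear_mapsD[OF \<phi>]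
  have lin: "j \<in> linear_maps R N M"
  proof (rule semilinear_mapsI)
    fix u v assume uv: "u \<in> carrier N" "v \<in> carrier N"
    have "loc_frac p M (j (u \<oplus>\<^bsub>N\<^esub> v)) n = loc_frac p M (j u \<oplus>\<^bsub>M\<^esub> j v) n"
      using f'(2)[OF N'.loc_frac_closed[OF uv(1), of 0] N'.loc_frac_closed[OF uv(2), of 0]] uv j
      by (simp add: N'.loc_add_frac_same M'.loc_add_frac_same)
    then show "j (u \<oplus>\<^bsub>N\<^esub> v) = j u \<oplus>\<^bsub>M\<^esub> j v"
      by (rule cancelM[rotated 2]) (use uv j(1) in auto)
  next
    fix a u assume au: "a \<in> carrier R" "u \<in> carrier N"
    have "loc_frac p M (j (a \<odot>\<^bsub>N\<^esub> u)) n = loc_frac p M (a \<odot>\<^bsub>M\<^esub> j u) n"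
      using f'(3)[OF au(1) N'.loc_frac_closed[OF au(2), of 0]] au j
      by (simp add: loc_smult_frac[OF N] loc_smult_frac[OF M])
    then show "j (a \<odot>\<^bsub>N\<^esub> u) = a \<odot>\<^bsub>M\<^esub> j u"
      by (rule cancelM[rotated 2]) (use au j(1) in auto)
  qed (use j in auto)
  moreover have "inj_on j (carrier N)"
  proof (rule inj_onI)
    fix u v assume uv: "u \<in> carrier N" "v \<in> carrier N" "j u = j v"
    then have "f (loc_frac p N u 0) = f (loc_frac p N v 0)" using j by simp
    then have "loc_frac p N u 0 = loc_frac p N v 0"
      using f(2) uv N'.loc_frac_closed by (meson bij_betw_imp_inj_on inj_onD)
    then show "u = v" by (rule cancelN[rotated 2]) (use uv in auto)
  qed
  moreover have "j (\<psi> u) = \<phi> (j u)" if u: "u \<in> carrier N" for u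
  proof -
    have "loc_frac p M (j (\<psi> u)) n = f (loc_map p N N \<psi> (loc_frac p N u 0))"
      using u \<psi>' j N'.loc_map_frac[OF N.M.abelian_group_axioms u \<psi>'(1,2)] by simp
    also have "\<dots> = loc_frac p M (\<phi> (j u)) n"
      using u j comm[OF N'.loc_frac_closed[OF u]] M'.loc_map_frac[OF M.M.abelian_group_axioms j(1)[OF u] \<phi>'(1,2)] by simp
    finally show ?thesis by (rule cancelM[rotated 2]) (use u j(1) \<psi>'(1) \<phi>'(1) in auto)
  qed
  moreover
  define g where "g = inv_into (carrier (loc p N)) f"
  have fg: "g w \<in> carrier (loc p N)" "f (g w) = w" if "w \<in> carrier (loc p M)" for w
    using f(2) that by (auto simp: g_def bij_betw_def inv_into_into f_inv_into_f)
  have gf: "g (f w) = w" if "w \<in> carrier (loc p N)" for w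
    using f(2) that by (auto simp: g_def bij_betw_def)
  have addN: "v \<oplus>\<^bsub>loc p N\<^esub> w \<in> carrier (loc p N)" if "v \<in> carrier (loc p N)" "w \<in> carrier (loc p N)" for v w
    using that by (auto simp: N'.carrier_loc N'.loc_add_frac) blast
  have smultN: "a \<odot>\<^bsub>loc p N\<^esub> w \<in> carrier (loc p N)" if "a \<in> carrier R" "w \<in> carrier (loc p N)" for a w
    using that by (auto simp: N'.carrier_loc loc_smult_frac[OF N]) blast
  have "g \<in> linear_maps R (loc p M) (loc p N)"
  proof (rule semilinear_mapsI)
    fix u v assume uv: "u \<in> carrier (loc p M)" "v \<in> carrier (loc p M)"
    then show "g (u \<oplus>\<^bsub>loc p M\<^esub> v) = g u \<oplus>\<^bsub>loc p N\<^esub> g v"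
      using gf[OF addN[OF fg(1)[OF uv(1)] fg(1)[OF uv(2)]]] f'(2)[OF fg(1)[OF uv(1)] fg(1)[OF uv(2)]] fg by simp
  next
    fix a u assume au: "a \<in> carrier R" "u \<in> carrier (loc p M)"
    then show "g (a \<odot>\<^bsub>loc p M\<^esub> u) = a \<odot>\<^bsub>loc p N\<^esub> g u"
      using gf[OF smultN[OF au(1) fg(1)[OF au(2)]]] f'(3)[OF au(1) fg(1)[OF au(2)]] fg by simp
  qed (use fg in auto)
  then obtain n' where n': "\<And>u. u \<in> carrier M \<Longrightarrow> \<exists>v\<in>carrier N. g (loc_frac p M u 0) = loc_frac p N v n'"
    using common_denominator[OF M N gM] by blast
  have "[(p ^ (n' + n))] \<cdot>\<^bsub>M\<^esub> u \<in> j ` carrier N" if u: "u \<in> carrier M" for u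
  proof -
    obtain v where v: "v \<in> carrier N" "g (loc_frac p M u 0) = loc_frac p N v n'" using n' u by blast
    \<comment> \<open>The integer \<open>p ^ n'\<close> as an element of \<open>R\<close>, so that
      linearity of \<open>f\<close> moves it across.\<close>
    let ?a = "[(p ^ n')] \<cdot>\<^bsub>R\<^esub> \<one>\<^bsub>R\<^esub>"
    have "loc_frac p M (?a \<odot>\<^bsub>M\<^esub> u) 0 = ?a \<odot>\<^bsub>loc p M\<^esub> f (loc_frac p N v n')"
      using fg(2)[OF M'.loc_frac_closed[OF u, of 0]] v u by (simp add: loc_smult_frac[OF M])
    also have "\<dots> = f (loc_frac p N (?a \<odot>\<^bsub>N\<^esub> v) n')"
      using v f'(3)[OF _ N'.loc_frac_closed[OF v(1), of n'], of ?a] by (simp add: loc_smult_frac[OF N])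
    also have "loc_frac p N (?a \<odot>\<^bsub>N\<^esub> v) n' = loc_frac p N v 0"
      using N'.loc_frac_cancel[OF v(1), of n' 0] v by (simp add: N.nat_smult)
    also have "f \<dots> = loc_frac p M (j v) n" using j v by simp
    finally have "loc_frac p M ([(p ^ n)] \<cdot>\<^bsub>M\<^esub> (?a \<odot>\<^bsub>M\<^esub> u)) n = loc_frac p M (j v) n"
      using M'.loc_frac_cancel[of "?a \<odot>\<^bsub>M\<^esub> u" n 0] u by simp
    then have "[(p ^ n)] \<cdot>\<^bsub>M\<^esub> (?a \<odot>\<^bsub>M\<^esub> u) = j v"
      by (rule cancelM[rotated 2]) (use u v j(1) in auto)
    moreover have "[(p ^ n)] \<cdot>\<^bsub>M\<^esub> (?a \<odot>\<^bsub>M\<^esub> u) = [(p ^ (n' + n))] \<cdot>\<^bsub>M\<^esub> u"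
      using u M'.pow_pow[OF u, of n n'] by (simp add: M.nat_smult[OF u, of "p ^ n'"] add.commute)
    ultimately show ?thesis using v by (metis imageI)
  qed
  ultimately show ?thesis by blast
qed

section \<open>Invariance of rank\<close>

lemma (in abelian_monoid) finsum_swap:
  assumes "finite A" "finite B" "\<And>a b. a \<in> A \<Longrightarrow> b \<in> B \<Longrightarrow> f a b \<in> carrier G"
  shows "(\<Oplus>a\<in>A. \<Oplus>b\<in>B. f a b) = (\<Oplus>b\<in>B. \<Oplus>a\<in>A. f a b)"
  using assms(1,3)
proof (induction A)
  case (insert x A)
  have "(\<Oplus>a\<in>insert x A. \<Oplus>b\<in>B. f a b) = (\<Oplus>b\<in>B. f x b) \<oplus> (\<Oplus>a\<in>A. \<Oplus>b\<in>B. f a b)"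
    using insert by (intro finsum_insert) (auto intro!: finsum_closed)
  also have "\<dots> = (\<Oplus>b\<in>B. f x b) \<oplus> (\<Oplus>b\<in>B. \<Oplus>a\<in>A. f a b)"
    using insert by simp
  also have "\<dots> = (\<Oplus>b\<in>B. f x b \<oplus> (\<Oplus>a\<in>A. f a b))"
    using insert by (intro finsum_addf[symmetric]) (auto intro!: finsum_closed)
  also have "\<dots> = (\<Oplus>b\<in>B. \<Oplus>a\<in>insert x A. f a b)"
    using insert by (intro finsum_cong' refl finsum_insert[symmetric]) (auto intro!: finsum_closed)
  finally show ?case .
qed simp

lemma (in abelian_monoid) finsum_lessThan_Times_2:
  fixes k :: nat
  assumes "\<And>t. g t \<in> carrier G"
  shows "(\<Oplus>t\<in>{..<k} \<times> {..<2}. g t) = (\<Oplus>i\<in>{..<k}. g (i, 0::nat) \<oplus> g (i, 1))"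
proof (induction k)
  case (Suc k)
  have "{..<Suc k} \<times> {..<2::nat} = insert (k, 0) (insert (k, 1) ({..<k} \<times> {..<2}))"
    by (auto simp: lessThan_Suc numeral_2_eq_2)
  then show ?case using Suc assms by (simp add: lessThan_Suc a_ac)
qed simp

definition lincomb :: "('r, 'm) module \<Rightarrow> ('i \<Rightarrow> 'r) \<Rightarrow> ('i \<Rightarrow> 'm) \<Rightarrow> 'i set \<Rightarrow> 'm" where
  "lincomb M c v I = (\<Oplus>\<^bsub>M\<^esub>i\<in>I. c i \<odot>\<^bsub>M\<^esub> v i)"

text \<open>Uniqueness of coefficients for families rather than sets: this covers a basis indexed by
  itself and the images of unit vectors indexed by pairs.\<close>

definition independent_family :: "('r, 'x) ring_scheme \<Rightarrow> ('r, 'm) module \<Rightarrow> ('i \<Rightarrow> 'm) \<Rightarrow> 'i set \<Rightarrow> bool" where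
  "independent_family R M v I \<longleftrightarrow> (\<forall>c c'. (\<forall>i. c i \<in> carrier R) \<longrightarrow> (\<forall>i. c' i \<in> carrier R) \<longrightarrow>
     lincomb M c v I = lincomb M c' v I \<longrightarrow> (\<forall>i\<in>I. c i = c' i))"

lemma independent_familyD:
  assumes "independent_family R M v I" "\<And>i. c i \<in> carrier R" "\<And>i. c' i \<in> carrier R"
    "lincomb M c v I = lincomb M c' v I" "i \<in> I"
  shows "c i = c' i"
  using assms unfolding independent_family_def by blast

lemma finsum_smult_rdistr:
  fixes R (structure) and M :: "('a, 'm) module"
  assumes "Module.module R M" "finite I" "\<And>i. i \<in> I \<Longrightarrow> f i \<in> carrier R" "u \<in> carrier M"
  shows "(\<Oplus>i\<in>I. f i) \<odot>\<^bsub>M\<^esub> u = (\<Oplus>\<^bsub>M\<^esub>i\<in>I. f i \<odot>\<^bsub>M\<^esub> u)"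
proof -
  interpret Module.module R M by fact
  show ?thesis using assms(2,3)
  proof (induction I)
    case empty
    then show ?case using assms(4) by simp
  next
    case (insert i I)
    then have "(\<Oplus>i\<in>insert i I. f i) = f i \<oplus> (\<Oplus>i\<in>I. f i)"
      by (intro R.finsum_insert) auto
    moreover have "(\<Oplus>\<^bsub>M\<^esub>i\<in>insert i I. f i \<odot>\<^bsub>M\<^esub> u) = f i \<odot>\<^bsub>M\<^esub> u \<oplus>\<^bsub>M\<^esub> (\<Oplus>\<^bsub>M\<^esub>i\<in>I. f i \<odot>\<^bsub>M\<^esub> u)"
      using insert assms(4) by (intro M.finsum_insert) auto
    ultimately show ?case using insert assms(4) by (simp add: smult_l_distr Pi_def)
  qed
qed

lemma lincomb_lincomb:
  fixes R (structure) and M :: "('a, 'm) module"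
  assumes "Module.module R M" "finite I" "finite J" "\<And>j. j \<in> J \<Longrightarrow> w j \<in> carrier M"
    and "\<And>i. c i \<in> carrier R" "\<And>i j. A i j \<in> carrier R"
  shows "lincomb M c (\<lambda>i. lincomb M (A i) w J) I = lincomb M (\<lambda>j. \<Oplus>i\<in>I. c i \<otimes> A i j) w J"
proof -
  interpret Module.module R M by fact
  have "lincomb M c (\<lambda>i. lincomb M (A i) w J) I = (\<Oplus>\<^bsub>M\<^esub>i\<in>I. \<Oplus>\<^bsub>M\<^esub>j\<in>J. (c i \<otimes> A i j) \<odot>\<^bsub>M\<^esub> w j)"
    unfolding lincomb_def using assms
    by (intro M.finsum_cong' refl) (auto simp: finsum_smult_ldistr smult_assoc1 intro!: M.finsum_closed M.finsum_cong')
  also have "\<dots> = (\<Oplus>\<^bsub>M\<^esub>j\<in>J. \<Oplus>\<^bsub>M\<^esub>i\<in>I. (c i \<otimes> A i j) \<odot>\<^bsub>M\<^esub> w j)"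
    using assms by (intro M.finsum_swap) auto
  also have "\<dots> = lincomb M (\<lambda>j. \<Oplus>i\<in>I. c i \<otimes> A i j) w J"
    unfolding lincomb_def using assms
    by (intro M.finsum_cong' refl) (auto simp: finsum_smult_rdistr[OF assms(1,2)] intro!: R.finsum_closed)
  finally show ?thesis .
qed

lemma lincomb_cong:
  fixes R (structure) and M :: "('a, 'm) module"
  assumes "Module.module R M" "\<And>i. i \<in> I \<Longrightarrow> c i = c' i" "\<And>i. i \<in> I \<Longrightarrow> v i = v' i"
    "\<And>i. i \<in> I \<Longrightarrow> c' i \<in> carrier R" "\<And>i. i \<in> I \<Longrightarrow> v' i \<in> carrier M"
  shows "lincomb M c v I = lincomb M c' v' I"
proof -
  interpret Module.module R M by fact
  show ?thesis unfolding lincomb_def using assms by (intro M.finsum_cong') auto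
qed

text \<open>Comparing the traces of the two products of the transition matrices, which are both \<open>\<rho>\<close> times an
  identity matrix, gives invariance of rank without passing to a quotient field.\<close>

lemma trace_transition:
  fixes R (structure) and M :: "('a, 'm) module"
  assumes M: "Module.module R M" and fin: "finite I" "finite J"
    and v: "\<And>i. i \<in> I \<Longrightarrow> v i \<in> carrier M" and w: "\<And>j. j \<in> J \<Longrightarrow> w j \<in> carrier M"
    and indep: "independent_family R M w J"
    and A: "\<And>i j. A i j \<in> carrier R" and C: "\<And>j i. C j i \<in> carrier R" and \<rho>: "\<rho> \<in> carrier R"
    and vA: "\<And>i. i \<in> I \<Longrightarrow> v i = lincomb M (A i) w J"
    and wC: "\<And>j. j \<in> J \<Longrightarrow> \<rho> \<odot>\<^bsub>M\<^esub> w j = lincomb M (C j) v I"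
  shows "[card J] \<cdot> \<rho> = (\<Oplus>j\<in>J. \<Oplus>i\<in>I. C j i \<otimes> A i j)"
proof -
  interpret Module.module R M by fact
  \<comment> \<open>Expanding \<open>\<rho> \<odot> w j\<close> through the \<open>v i\<close> and
    back gives row \<open>j\<close> of the product matrix; independence identifies its diagonal
    entry with \<rho>, which is all the trace needs.\<close>
  have diag: "\<rho> = (\<Oplus>i\<in>I. C j i \<otimes> A i j)" if j: "j \<in> J" for j
  proof -
    have "lincomb M (\<lambda>j'. if j' = j then \<rho> else \<zero>) w J = \<rho> \<odot>\<^bsub>M\<^esub> w j"
    proof -
      have "lincomb M (\<lambda>j'. if j' = j then \<rho> else \<zero>) w J = (\<Oplus>\<^bsub>M\<^esub>j'\<in>J. if j = j' then \<rho> \<odot>\<^bsub>M\<^esub> w j' else \<zero>\<^bsub>M\<^esub>)"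
        unfolding lincomb_def using w \<rho> by (intro M.finsum_cong') auto
      then show ?thesis using M.finsum_singleton[OF j fin(2), of "\<lambda>j. \<rho> \<odot>\<^bsub>M\<^esub> w j"] w \<rho> by auto
    qed
    also have "\<dots> = lincomb M (C j) (\<lambda>i. lincomb M (A i) w J) I"
      unfolding wC[OF j] using vA v C by (intro lincomb_cong[OF M]) auto
    also have "\<dots> = lincomb M (\<lambda>j'. \<Oplus>i\<in>I. C j i \<otimes> A i j') w J"
      using w A C by (intro lincomb_lincomb[OF M fin]) auto
    finally show ?thesis
      using indep[unfolded independent_family_def, rule_format, of "\<lambda>j'. if j' = j then \<rho> else \<zero>"
          "\<lambda>j'. \<Oplus>i\<in>I. C j i \<otimes> A i j'" j] \<rho> A C j by (simp add: Pi_def)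
  qed
  have "(\<Oplus>j\<in>J. \<Oplus>i\<in>I. C j i \<otimes> A i j) = (\<Oplus>j\<in>J. \<rho>)"
    using diag \<rho> by (intro R.finsum_cong') auto
  then show ?thesis using R.add.finprod_const[OF \<rho>, of J] by simp
qed

lemma card_transition:
  fixes R (structure) and M :: "('a, 'm) module"
  assumes M: "Module.module R M" and fin: "finite I" "finite J"
    and v: "\<And>i. i \<in> I \<Longrightarrow> v i \<in> carrier M" and w: "\<And>j. j \<in> J \<Longrightarrow> w j \<in> carrier M"
    and indep: "independent_family R M v I" "independent_family R M w J" and \<rho>: "\<rho> \<in> carrier R"
    and vA: "\<And>i. i \<in> I \<Longrightarrow> \<exists>a. (\<forall>j. a j \<in> carrier R) \<and> v i = lincomb M a w J"
    and wC: "\<And>j. j \<in> J \<Longrightarrow> \<exists>c. (\<forall>i. c i \<in> carrier R) \<and> \<rho> \<odot>\<^bsub>M\<^esub> w j = lincomb M c v I"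
  shows "[card I] \<cdot> \<rho> = [card J] \<cdot> \<rho>"
proof -
  interpret Module.module R M by fact
  have "\<forall>i. \<exists>a. (\<forall>j. a j \<in> carrier R) \<and> (i \<in> I \<longrightarrow> v i = lincomb M a w J)"
    using vA R.zero_closed by blast
  then obtain A where A: "\<And>i j. A i j \<in> carrier R" "\<And>i. i \<in> I \<Longrightarrow> v i = lincomb M (A i) w J"
    by metis
  have "\<forall>j. \<exists>c. (\<forall>i. c i \<in> carrier R) \<and> (j \<in> J \<longrightarrow> \<rho> \<odot>\<^bsub>M\<^esub> w j = lincomb M c v I)"
    using wC R.zero_closed by blast
  then obtain C where C: "\<And>j i. C j i \<in> carrier R" "\<And>j. j \<in> J \<Longrightarrow> \<rho> \<odot>\<^bsub>M\<^esub> w j = lincomb M (C j) v I"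
    by metis
  \<comment> \<open>To exchange the two families, \<open>w\<close> is replaced by its
    \<rho>-multiples: these are combinations of the \<open>v i\<close>, and the
    \<open>\<rho> \<odot> v i\<close> are combinations of them, with the same matrices.\<close>
  have v': "\<rho> \<odot>\<^bsub>M\<^esub> v i = lincomb M (A i) (\<lambda>j. \<rho> \<odot>\<^bsub>M\<^esub> w j) J" if "i \<in> I" for i
  proof -
    have "\<rho> \<odot>\<^bsub>M\<^esub> v i = (\<Oplus>\<^bsub>M\<^esub>j\<in>J. \<rho> \<odot>\<^bsub>M\<^esub> (A i j \<odot>\<^bsub>M\<^esub> w j))"
      unfolding A(2)[OF that] lincomb_def using \<rho> A(1) w fin by (intro finsum_smult_ldistr) auto
    also have "\<dots> = lincomb M (A i) (\<lambda>j. \<rho> \<odot>\<^bsub>M\<^esub> w j) J"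
      unfolding lincomb_def using \<rho> A(1) w
      by (intro M.finsum_cong') (auto simp: R.m_comm simp flip: smult_assoc1)
    finally show ?thesis .
  qed
  have "[card I] \<cdot> \<rho> = (\<Oplus>i\<in>I. \<Oplus>j\<in>J. A i j \<otimes> C j i)"
    by (rule trace_transition[OF M fin(2,1) _ v indep(1) C(1) A(1) \<rho> C(2) v']) (rule smult_closed[OF \<rho> w])
  also have "\<dots> = (\<Oplus>j\<in>J. \<Oplus>i\<in>I. C j i \<otimes> A i j)"
    using A(1) C(1) fin by (subst R.finsum_swap) (auto simp: R.m_comm)
  also have "\<dots> = [card J] \<cdot> \<rho>"
    by (rule trace_transition[OF M fin v w indep(2) A(1) C(1) \<rho> A(2) C(2), symmetric])
  finally show ?thesis .
qed

section \<open>Natural numbers inside the Witt vectors\<close>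

text \<open>The coordinates of \<open>p x\<close> are the shifted \<open>p\<close>-th powers of
  those of \<open>x\<close>, and a field has no nilpotents.\<close>

lemma Witt_torsion_free:
  fixes x :: "nat \<Rightarrow> 'k::field"
  assumes "prime p" "CHAR('k) = p" "[p] \<cdot>\<^bsub>Witt p\<^esub> x = \<zero>\<^bsub>Witt p\<^esub>"
  shows "x = \<zero>\<^bsub>Witt p\<^esub>"
proof -
  have "case_nat 0 (\<lambda>n. x n ^ p) = (\<zero>\<^bsub>Witt p\<^esub> :: nat \<Rightarrow> 'k)"
    using assms Witt_prime_multiple[OF assms(1), of x] of_nat_CHAR[where 'a = 'k] by simp
  then have "case_nat 0 (\<lambda>n. x n ^ p) (Suc n) = \<zero>\<^bsub>Witt p\<^esub> (Suc n)" for n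
    by simp
  then show ?thesis by (simp add: Witt_def fun_eq_iff)
qed

lemma Witt_of_nat_0:
  "prime p \<Longrightarrow> ([(k::nat)] \<cdot>\<^bsub>Witt p\<^esub> (\<one>\<^bsub>Witt p\<^esub> :: nat \<Rightarrow> 'k::comm_ring_1)) 0 = of_nat k"
proof (induction k)
  case 0
  then show ?case by (simp add: add_pow_0) (simp add: Witt_def)
next
  case (Suc k)
  then show ?case by (simp add: add_pow_Suc Witt_add_0) (simp add: Witt_def)
qed

text \<open>Factors \<open>p\<close> are stripped off by torsion-freeness; a number prime to
  \<open>p\<close> is already nonzero in the zeroth coordinate, its residue in the field.\<close>

lemma Witt_of_nat_neq_0:
  assumes "prime p" "CHAR('k::field) = p" "cring (Witt p :: (nat \<Rightarrow> 'k) ring)" "k > 0"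
  shows "[(k::nat)] \<cdot>\<^bsub>Witt p\<^esub> \<one>\<^bsub>Witt p\<^esub> \<noteq> (\<zero>\<^bsub>Witt p\<^esub> :: nat \<Rightarrow> 'k)"
  using assms(4)
proof (induction k rule: less_induct)
  case (less k)
  interpret cring "Witt p :: (nat \<Rightarrow> 'k) ring" by fact
  show ?case
  proof (cases "p dvd k")
    case True
    then obtain l where l: "k = p * l" by auto
    then have "l > 0" "l < k" using less.prems prime_gt_1_nat[OF assms(1)] by auto
    then have "[l] \<cdot>\<^bsub>Witt p\<^esub> \<one>\<^bsub>Witt p\<^esub> \<noteq> (\<zero>\<^bsub>Witt p\<^esub> :: nat \<Rightarrow> 'k)" using less.IH by blast
    moreover have "[k] \<cdot>\<^bsub>Witt p\<^esub> \<one>\<^bsub>Witt p\<^esub> = [p] \<cdot>\<^bsub>Witt p\<^esub> ([l] \<cdot>\<^bsub>Witt p\<^esub> (\<one>\<^bsub>Witt p\<^esub> :: nat \<Rightarrow> 'k))"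
      using add.nat_pow_pow[OF one_closed, of p l] by (simp add: l mult.commute)
    ultimately show ?thesis using Witt_torsion_free[OF assms(1,2)] by metis
  next
    case False
    then have "([k] \<cdot>\<^bsub>Witt p\<^esub> \<one>\<^bsub>Witt p\<^esub>) 0 \<noteq> (0 :: 'k)"
      using assms by (simp add: Witt_of_nat_0 of_nat_eq_0_iff_char_dvd)
    then show ?thesis by (auto simp: Witt_def)
  qed
qed

text \<open>The trace comparison gives an equality of ranks inside the ring, multiplied by
  \<open>p ^ n\<close>. Characteristic zero turns it into an equality of natural numbers.\<close>

lemma Witt_of_nat_inj:
  assumes "prime p" "CHAR('k::field) = p" "cring (Witt p :: (nat \<Rightarrow> 'k) ring)"
    and eq: "[(k::nat)] \<cdot>\<^bsub>Witt p\<^esub> ([(p ^ n)] \<cdot>\<^bsub>Witt p\<^esub> \<one>\<^bsub>Witt p\<^esub>) = [(l::nat)] \<cdot>\<^bsub>Witt p\<^esub> ([(p ^ n)] \<cdot>\<^bsub>Witt p\<^esub> (\<one>\<^bsub>Witt p\<^esub> :: nat \<Rightarrow> 'k))"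
  shows "k = l"
proof -
  interpret cring "Witt p :: (nat \<Rightarrow> 'k) ring" by fact
  let ?o = "\<one>\<^bsub>Witt p\<^esub> :: nat \<Rightarrow> 'k"
  have less: "\<not> i < j" if "[i] \<cdot>\<^bsub>Witt p\<^esub> ?o = [j] \<cdot>\<^bsub>Witt p\<^esub> ?o" for i j :: nat
  proof
    assume "i < j"
    have "[(j - i)] \<cdot>\<^bsub>Witt p\<^esub> ?o \<oplus>\<^bsub>Witt p\<^esub> [i] \<cdot>\<^bsub>Witt p\<^esub> ?o = [(j - i + i)] \<cdot>\<^bsub>Witt p\<^esub> ?o"
      by (rule add.nat_pow_mult) simp
    also have "\<dots> = [i] \<cdot>\<^bsub>Witt p\<^esub> ?o" using \<open>i < j\<close> that by simp
    finally have "[(j - i)] \<cdot>\<^bsub>Witt p\<^esub> ?o \<oplus>\<^bsub>Witt p\<^esub> [i] \<cdot>\<^bsub>Witt p\<^esub> ?o = [i] \<cdot>\<^bsub>Witt p\<^esub> ?o" .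
    then have "[(j - i)] \<cdot>\<^bsub>Witt p\<^esub> ?o = \<zero>\<^bsub>Witt p\<^esub>" by (simp add: add.r_cancel_one)
    then show False using Witt_of_nat_neq_0[OF assms(1-3)] \<open>i < j\<close> by (meson zero_less_diff)
  qed
  have "[(k * p ^ n)] \<cdot>\<^bsub>Witt p\<^esub> ?o = [(l * p ^ n)] \<cdot>\<^bsub>Witt p\<^esub> ?o"
    using eq by (simp add: add.nat_pow_pow mult.commute)
  then have "k * p ^ n = l * p ^ n" using less by (metis linorder_neqE_nat)
  then show ?thesis using prime_gt_0_nat[OF assms(1)] by simp
qed

section \<open>The standard modules\<close>

definition std_unit :: "nat \<Rightarrow> (nat \<times> nat) list \<Rightarrow> nat \<times> nat \<Rightarrow> nat \<times> nat \<Rightarrow> nat \<Rightarrow> 'k::comm_ring_1" where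
  "std_unit p rs t = (\<lambda>u\<in>std_index rs. if u = t then \<one>\<^bsub>Witt p\<^esub> else \<zero>\<^bsub>Witt p\<^esub>)"

lemma finite_std_index: "finite (std_index rs)"
proof -
  have "std_index rs = (SIGMA i:{..<length rs}. {..<snd (rs ! i)})" by (auto simp: std_index_def)
  then show ?thesis by simp
qed

lemma std_index_replicate: "std_index (replicate d (r, s)) = {..<d} \<times> {..<s}"
  by (auto simp: std_index_def)

lemma std_simps:
  "carrier (std_module p rs) = extensional (std_index rs)"
  "\<zero>\<^bsub>std_module p rs\<^esub> = (\<lambda>t\<in>std_index rs. \<zero>\<^bsub>Witt p\<^esub>)"
  "f \<oplus>\<^bsub>std_module p rs\<^esub> g = (\<lambda>t\<in>std_index rs. f t \<oplus>\<^bsub>Witt p\<^esub> g t)"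
  "a \<odot>\<^bsub>std_module p rs\<^esub> f = (\<lambda>t\<in>std_index rs. a \<otimes>\<^bsub>Witt p\<^esub> f t)"
  by (auto simp: std_module_def PiE_def)

lemma module_std_module:
  assumes "cring (Witt p :: (nat \<Rightarrow> 'k::comm_ring_1) ring)"
  shows "Module.module (Witt p) (std_module p rs :: (nat \<Rightarrow> 'k, _) module)"
proof -
  interpret cring "Witt p :: (nat \<Rightarrow> 'k) ring" by fact
  let ?N = "std_module p rs :: (nat \<Rightarrow> 'k, _) module"
  show ?thesis
  proof (rule moduleI)
    show "abelian_group ?N"
    proof (rule abelian_groupI)
      fix f assume "f \<in> carrier ?N"
      then have "(\<lambda>t\<in>std_index rs. \<ominus>\<^bsub>Witt p\<^esub> f t) \<oplus>\<^bsub>?N\<^esub> f = \<zero>\<^bsub>?N\<^esub>"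
        by (auto simp: std_simps l_neg intro!: restrict_ext)
      then show "\<exists>g\<in>carrier ?N. g \<oplus>\<^bsub>?N\<^esub> f = \<zero>\<^bsub>?N\<^esub>"
        by (intro bexI[of _ "\<lambda>t\<in>std_index rs. \<ominus>\<^bsub>Witt p\<^esub> f t"]) (auto simp: std_simps)
    qed (auto simp: std_simps a_ac extensional_restrict intro!: restrict_ext extensionalityI[of _ "std_index rs"])
  qed (use assms in \<open>auto simp: std_simps l_distr r_distr m_assoc intro!: restrict_ext extensionalityI[of _ "std_index rs"]\<close>)
qed

lemma ring_hom_witt_frob:
  assumes "prime p" "CHAR('k::comm_ring_1) = p"
  shows "witt_frob p \<in> ring_hom (Witt p :: (nat \<Rightarrow> 'k) ring) (Witt p)"
  using assms by (intro ring_hom_memI) (auto simp: witt_frob_add witt_frob_mult witt_frob_one prime_gt_0_nat)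

lemma std_frob_semilinear:
  assumes p: "prime p" "CHAR('k::comm_ring_1) = p" and R: "cring (Witt p :: (nat \<Rightarrow> 'k) ring)"
  shows "std_frob p rs \<in> semilinear_maps (Witt p :: (nat \<Rightarrow> 'k) ring) (witt_frob p) (std_module p rs) (std_module p rs)"
proof -
  interpret cring "Witt p :: (nat \<Rightarrow> 'k) ring" by fact
  show ?thesis
  proof (rule semilinear_mapsI)
    fix u v :: "nat \<times> nat \<Rightarrow> nat \<Rightarrow> 'k"
    assume "u \<in> carrier (std_module p rs)" "v \<in> carrier (std_module p rs)"
    show "std_frob p rs (u \<oplus>\<^bsub>std_module p rs\<^esub> v) = std_frob p rs u \<oplus>\<^bsub>std_module p rs\<^esub> std_frob p rs v"
      unfolding std_frob_def std_simps
      by (rule restrict_ext) (auto simp: std_index_def witt_frob_add[OF p] add.nat_pow_distrib)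
  next
    fix a and u :: "nat \<times> nat \<Rightarrow> nat \<Rightarrow> 'k"
    assume "u \<in> carrier (std_module p rs)"
    show "std_frob p rs (a \<odot>\<^bsub>std_module p rs\<^esub> u) = witt_frob p a \<odot>\<^bsub>std_module p rs\<^esub> std_frob p rs u"
      unfolding std_frob_def std_simps
      by (rule restrict_ext) (auto simp: std_index_def witt_frob_mult[OF p] add_pow_rdistr)
  qed (auto simp: std_simps std_frob_def)
qed

text \<open>Partial sums of the coordinate expansion: enlarging \<open>F\<close> by one index adds
  one multiple of a unit vector, which turns statements about all coordinates into inductions over
  finite sets.\<close>

definition std_restrict ::
  "nat \<Rightarrow> (nat \<times> nat) list \<Rightarrow> (nat \<times> nat \<Rightarrow> nat \<Rightarrow> 'k::comm_ring_1) \<Rightarrow> (nat \<times> nat) set \<Rightarrow> nat \<times> nat \<Rightarrow> nat \<Rightarrow> 'k" where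
  "std_restrict p rs v F = (\<lambda>u\<in>std_index rs. if u \<in> F then v u else \<zero>\<^bsub>Witt p\<^esub>)"

lemma std_restrict_closed: "std_restrict p rs v F \<in> carrier (std_module p rs)"
  by (simp add: std_restrict_def std_simps)

lemma std_restrict_empty: "std_restrict p rs v {} = \<zero>\<^bsub>std_module p rs\<^esub>"
  unfolding std_restrict_def std_simps by (rule restrict_ext) simp

lemma std_restrict_all:
  "v \<in> carrier (std_module p rs) \<Longrightarrow> std_restrict p rs v (std_index rs) = v"
  unfolding std_restrict_def std_simps by (rule extensionalityI[of _ "std_index rs"]) auto

lemma std_restrict_insert:
  assumes "cring (Witt p :: (nat \<Rightarrow> 'k::comm_ring_1) ring)" "t \<in> std_index rs" "t \<notin> F"
  shows "std_restrict p rs (v :: _ \<Rightarrow> nat \<Rightarrow> 'k) (insert t F) =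
    v t \<odot>\<^bsub>std_module p rs\<^esub> std_unit p rs t \<oplus>\<^bsub>std_module p rs\<^esub> std_restrict p rs v F"
proof -
  interpret cring "Witt p :: (nat \<Rightarrow> 'k) ring" by fact
  show ?thesis using assms(2,3) unfolding std_simps std_unit_def std_restrict_def by (intro restrict_ext) auto
qed

lemma std_unit_closed: "std_unit p rs t \<in> carrier (std_module p rs)"
  by (simp add: std_unit_def std_simps)

lemma generates_std_module:
  assumes R: "cring (Witt p :: (nat \<Rightarrow> 'k::comm_ring_1) ring)"
  shows "generates (Witt p :: (nat \<Rightarrow> 'k) ring) (std_module p rs) (std_unit p rs ` std_index rs)"
proof -
  let ?N = "std_module p rs :: (nat \<Rightarrow> 'k, _) module"
  interpret N: Module.module "Witt p" ?N by (rule module_std_module) fact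
  have span: "v \<in> S" if S: "\<zero>\<^bsub>?N\<^esub> \<in> S" "\<And>u v. u \<in> S \<inter> carrier ?N \<Longrightarrow> v \<in> S \<inter> carrier ?N \<Longrightarrow> u \<oplus>\<^bsub>?N\<^esub> v \<in> S"
    "\<And>a u. u \<in> S \<inter> carrier ?N \<Longrightarrow> a \<odot>\<^bsub>?N\<^esub> u \<in> S" "std_unit p rs ` std_index rs \<subseteq> S"
    and v: "v \<in> carrier ?N" for S v
  proof -
    have *: "finite F \<Longrightarrow> F \<subseteq> std_index rs \<Longrightarrow> std_restrict p rs v F \<in> S" for F
    proof (induction F rule: finite_induct)
      case (insert t F)
      then have t: "t \<in> std_index rs" by simp
      have "v t \<odot>\<^bsub>?N\<^esub> std_unit p rs t \<in> S \<inter> carrier ?N"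
        using S(3,4) t std_unit_closed[of p rs t] by (auto intro!: N.smult_closed)
      moreover have "std_restrict p rs v F \<in> S \<inter> carrier ?N"
        using insert std_restrict_closed by auto
      ultimately show ?case
        unfolding std_restrict_insert[OF R t insert.hyps(2)] by (rule S(2))
    qed (use S(1) in \<open>simp add: std_restrict_empty\<close>)
    show ?thesis using *[OF finite_std_index order_refl] std_restrict_all[OF v] by simp
  qed
  show ?thesis
    unfolding generates_def
  proof (intro conjI allI impI subsetI)
    show "finite (std_unit p rs ` std_index rs)" using finite_std_index by (rule finite_imageI)
    show "v \<in> carrier ?N" if "v \<in> std_unit p rs ` std_index rs" for v
      using that std_unit_closed by blast
    fix S v
    assume S: "\<zero>\<^bsub>?N\<^esub> \<in> S" "\<forall>u\<in>S \<inter> carrier ?N. \<forall>v\<in>S \<inter> carrier ?N. u \<oplus>\<^bsub>?N\<^esub> v \<in> S"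
      "\<forall>a\<in>carrier (Witt p). \<forall>u\<in>S \<inter> carrier ?N. a \<odot>\<^bsub>?N\<^esub> u \<in> S"
      "std_unit p rs ` std_index rs \<subseteq> S" "v \<in> carrier ?N"
    show "v \<in> S"
    proof (rule span[OF S(1) _ _ S(4,5)])
      show "u \<oplus>\<^bsub>?N\<^esub> v \<in> S" if "u \<in> S \<inter> carrier ?N" "v \<in> S \<inter> carrier ?N" for u v
        using S(2) that by blast
      show "a \<odot>\<^bsub>?N\<^esub> u \<in> S" if "u \<in> S \<inter> carrier ?N" for a u
        using S(3) that carrier_Witt by blast
    qed
  qed
qed

lemma linear_std_module:
  assumes M: "Module.module (Witt p) M" and j: "j \<in> linear_maps (Witt p) (std_module p rs) M"
    and v: "v \<in> carrier (std_module p rs)"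
  shows "j v = lincomb M v (\<lambda>t. j (std_unit p rs t :: nat \<times> nat \<Rightarrow> nat \<Rightarrow> 'k::comm_ring_1)) (std_index rs)"
proof -
  let ?N = "std_module p rs :: (nat \<Rightarrow> 'k, _) module"
  interpret M: Module.module "Witt p" M by fact
  interpret N: Module.module "Witt p" ?N by (rule module_std_module) (rule M.R.is_cring)
  note j' = semilinear_mapsD[OF j]
  have j0: "j \<zero>\<^bsub>?N\<^esub> = \<zero>\<^bsub>M\<^esub>"
    using j'(3)[of "\<zero>\<^bsub>Witt p\<^esub>" "\<zero>\<^bsub>?N\<^esub>"] j'(1)[of "\<zero>\<^bsub>?N\<^esub>"] by simp
  have unit: "j (std_unit p rs t) \<in> carrier M" for t using j'(1) std_unit_closed by blast
  have *: "finite F \<Longrightarrow> F \<subseteq> std_index rs \<Longrightarrow> j (std_restrict p rs v F) =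
    lincomb M v (\<lambda>t. j (std_unit p rs t)) F" for F
  proof (induction F rule: finite_induct)
    case empty
    then show ?case using j0 by (simp add: lincomb_def std_restrict_empty)
  next
    case (insert t F)
    then have t: "t \<in> std_index rs" by simp
    let ?w = "std_restrict p rs v F"
    have w: "?w \<in> carrier ?N" by (rule std_restrict_closed)
    have "j (v t \<odot>\<^bsub>?N\<^esub> std_unit p rs t \<oplus>\<^bsub>?N\<^esub> ?w) = v t \<odot>\<^bsub>M\<^esub> j (std_unit p rs t) \<oplus>\<^bsub>M\<^esub> j ?w"
      using j'(2)[OF N.smult_closed w, of "v t" "std_unit p rs t"] j'(3)[of "v t" "std_unit p rs t"]
        std_unit_closed[of p rs t] by simp
    also have "\<dots> = lincomb M v (\<lambda>t. j (std_unit p rs t)) (insert t F)"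
      using insert unit by (simp add: lincomb_def)
    finally show ?case unfolding std_restrict_insert[OF M.R.is_cring t insert.hyps(2)] .
  qed
  show ?thesis using *[OF finite_std_index order_refl] std_restrict_all[OF v] by simp
qed

lemma lin_indep_std_units:
  assumes M: "Module.module (Witt p) M" and j: "j \<in> linear_maps (Witt p) (std_module p rs) M"
    and inj: "inj_on j (carrier (std_module p rs))"
  shows "independent_family (Witt p) M (\<lambda>t. j (std_unit p rs t :: nat \<times> nat \<Rightarrow> nat \<Rightarrow> 'k::comm_ring_1)) (std_index rs)"
  unfolding independent_family_def
proof (intro allI impI)
  interpret M: Module.module "Witt p" M by fact
  fix c c' :: "nat \<times> nat \<Rightarrow> nat \<Rightarrow> 'k"
  assume eq: "lincomb M c (\<lambda>t. j (std_unit p rs t)) (std_index rs) = lincomb M c' (\<lambda>t. j (std_unit p rs t)) (std_index rs)"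
  have unit: "j (std_unit p rs t) \<in> carrier M" for t
    using semilinear_mapsD(1)[OF j] std_unit_closed by blast
  have cl: "restrict c (std_index rs) \<in> carrier (std_module p rs)" for c :: "nat \<times> nat \<Rightarrow> nat \<Rightarrow> 'k"
    by (simp add: std_simps)
  have "j (restrict c (std_index rs)) = lincomb M c (\<lambda>t. j (std_unit p rs t)) (std_index rs)" for c
    unfolding linear_std_module[OF M j cl] using unit by (intro lincomb_cong[OF M]) auto
  then have "restrict c (std_index rs) = restrict c' (std_index rs)"
    using eq inj cl by (metis inj_onD)
  then show "\<forall>t\<in>std_index rs. c t = c' t" by (metis restrict_apply')
qed

section \<open>Bases: generation, independence and torsion\<close>

lemma generates_basis:
  fixes R (structure) and M :: "('a, 'm) module"
  assumes M: "Module.module R M" and B: "is_basis R M B"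
  shows "generates R M B"
proof -
  interpret Module.module R M by fact
  have fin: "finite B" "B \<subseteq> carrier M" using B by (auto simp: is_basis_def)
  have "u \<in> S" if S: "\<zero>\<^bsub>M\<^esub> \<in> S" "\<forall>u\<in>S \<inter> carrier M. \<forall>v\<in>S \<inter> carrier M. u \<oplus>\<^bsub>M\<^esub> v \<in> S"
    "\<forall>a\<in>carrier R. \<forall>u\<in>S \<inter> carrier M. a \<odot>\<^bsub>M\<^esub> u \<in> S" "B \<subseteq> S" "u \<in> carrier M" for S u
  proof -
    obtain c where c: "c \<in> B \<rightarrow>\<^sub>E carrier R" "u = (\<Oplus>\<^bsub>M\<^esub>b\<in>B. c b \<odot>\<^bsub>M\<^esub> b)"
      using B \<open>u \<in> carrier M\<close> by (auto simp: is_basis_def)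
    have cl: "c b \<in> carrier R" if "b \<in> B" for b using c(1) that by (auto simp: PiE_def Pi_def)
    have "finite F \<Longrightarrow> F \<subseteq> B \<Longrightarrow> (\<Oplus>\<^bsub>M\<^esub>b\<in>F. c b \<odot>\<^bsub>M\<^esub> b) \<in> S \<inter> carrier M" for F
    proof (induction F rule: finite_induct)
      case (insert b F)
      have "c b \<odot>\<^bsub>M\<^esub> b \<in> S \<inter> carrier M" using insert.prems S(3,4) fin cl by auto
      moreover have "(\<Oplus>\<^bsub>M\<^esub>b\<in>insert b F. c b \<odot>\<^bsub>M\<^esub> b) = c b \<odot>\<^bsub>M\<^esub> b \<oplus>\<^bsub>M\<^esub> (\<Oplus>\<^bsub>M\<^esub>b\<in>F. c b \<odot>\<^bsub>M\<^esub> b)"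
        using insert fin cl by (intro M.finsum_insert) auto
      ultimately show ?case using insert S(2) by auto
    qed (use S(1) in simp)
    then show ?thesis using c(2) fin by blast
  qed
  then show ?thesis using fin unfolding generates_def by blast
qed

lemma
  fixes R (structure) and M :: "('a, 'm) module"
  assumes M: "Module.module R M" and B: "is_basis R M B"
  shows independent_family_basis: "independent_family R M (\<lambda>b. b) B"
    and ex_lincomb_basis: "u \<in> carrier M \<Longrightarrow> \<exists>c. (\<forall>b. c b \<in> carrier R) \<and> u = lincomb M c (\<lambda>b. b) B"
proof -
  interpret Module.module R M by fact
  have fin: "finite B" "B \<subseteq> carrier M" using B by (auto simp: is_basis_def)
  have restr: "lincomb M c (\<lambda>b. b) B = (\<Oplus>\<^bsub>M\<^esub>b\<in>B. restrict c B b \<odot>\<^bsub>M\<^esub> b)" if "\<And>b. b \<in> B \<Longrightarrow> c b \<in> carrier R" for c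
    unfolding lincomb_def using fin that by (intro M.finsum_cong') auto
  show "independent_family R M (\<lambda>b. b) B"
    unfolding independent_family_def
  proof (intro allI impI)
    fix c c' assume c: "\<forall>b. c b \<in> carrier R" "\<forall>b. c' b \<in> carrier R" "lincomb M c (\<lambda>b. b) B = lincomb M c' (\<lambda>b. b) B"
    have "lincomb M c (\<lambda>b. b) B \<in> carrier M" unfolding lincomb_def using c fin by (intro M.finsum_closed) auto
    then have "\<exists>!k. k \<in> B \<rightarrow>\<^sub>E carrier R \<and> lincomb M c (\<lambda>b. b) B = (\<Oplus>\<^bsub>M\<^esub>b\<in>B. k b \<odot>\<^bsub>M\<^esub> b)"
      using B by (auto simp: is_basis_def)
    then obtain k where k: "\<And>k'. k' \<in> B \<rightarrow>\<^sub>E carrier R \<and> lincomb M c (\<lambda>b. b) B = (\<Oplus>\<^bsub>M\<^esub>b\<in>B. k' b \<odot>\<^bsub>M\<^esub> b) \<Longrightarrow> k' = k"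
      by (elim ex1E) blast
    have "restrict c B = k" by (rule k) (intro conjI restr, use c in auto)
    moreover have "restrict c' B = k" by (rule k, unfold c(3)) (intro conjI restr, use c in auto)
    ultimately have "restrict c B = restrict c' B" by simp
    then show "\<forall>b\<in>B. c b = c' b" by (metis restrict_apply')
  qed
  assume "u \<in> carrier M"
  then obtain c where c: "c \<in> B \<rightarrow>\<^sub>E carrier R" "u = (\<Oplus>\<^bsub>M\<^esub>b\<in>B. c b \<odot>\<^bsub>M\<^esub> b)"
    using B by (auto simp: is_basis_def)
  \<comment> \<open>Coefficient functions from \<open>is_basis\<close> are \<open>undefined\<close>
    off \<open>B\<close>; extension by zero keeps all values in the ring.\<close>
  let ?c = "\<lambda>b. if b \<in> B then c b else \<zero>"
  have cl: "?c b \<in> carrier R" for b using c(1) by (auto simp: PiE_def Pi_def)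
  have u: "u = lincomb M ?c (\<lambda>b. b) B"
    unfolding c(2) lincomb_def using fin cl c(1) by (intro M.finsum_cong') (auto simp: PiE_def Pi_def)
  show "\<exists>c. (\<forall>b. c b \<in> carrier R) \<and> u = lincomb M c (\<lambda>b. b) B"
    by (intro exI[of _ ?c] conjI allI cl u)
qed

lemma basis_torsion_free:
  fixes R (structure) and M :: "('a, 'm) module"
  assumes M: "Module.module R M" and B: "is_basis R M B"
    and \<rho>: "\<rho> \<in> carrier R" "\<And>a. a \<in> carrier R \<Longrightarrow> \<rho> \<otimes> a = \<zero> \<Longrightarrow> a = \<zero>"
    and u: "u \<in> carrier M" "\<rho> \<odot>\<^bsub>M\<^esub> u = \<zero>\<^bsub>M\<^esub>"
  shows "u = \<zero>\<^bsub>M\<^esub>"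
proof -
  interpret Module.module R M by fact
  have fin: "finite B" "B \<subseteq> carrier M" using B by (auto simp: is_basis_def)
  obtain c where c: "\<And>b. c b \<in> carrier R" "u = lincomb M c (\<lambda>b. b) B" using ex_lincomb_basis[OF M B u(1)] by auto
  have z: "lincomb M (\<lambda>_. \<zero>) (\<lambda>b. b) B = \<zero>\<^bsub>M\<^esub>"
    unfolding lincomb_def using fin by (subst M.finsum_cong'[of B B "\<lambda>_. \<zero>\<^bsub>M\<^esub>"]) auto
  have "lincomb M (\<lambda>b. \<rho> \<otimes> c b) (\<lambda>b. b) B = \<rho> \<odot>\<^bsub>M\<^esub> u"
    unfolding c(2) lincomb_def using c(1) fin \<rho>
    by (subst finsum_smult_ldistr) (auto simp: smult_assoc1 intro!: M.finsum_cong')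
  then have "lincomb M (\<lambda>b. \<rho> \<otimes> c b) (\<lambda>b. b) B = lincomb M (\<lambda>_. \<zero>) (\<lambda>b. b) B" using u z by simp
  note eq = this
  have "\<rho> \<otimes> c b = \<zero>" if "b \<in> B" for b
    by (rule independent_familyD[OF independent_family_basis[OF M B] _ _ eq that]) (use \<rho> c(1) in auto)
  then have "c b = \<zero>" if "b \<in> B" for b using that \<rho>(2) c(1) by blast
  then have "lincomb M c (\<lambda>b. b) B = lincomb M (\<lambda>_. \<zero>) (\<lambda>b. b) B"
    using fin by (intro lincomb_cong[OF M]) auto
  then show ?thesis using z c(2) by simp
qed

section \<open>Dieudonne modules\<close>

lemma (in cring) add_pow_one_mult: "a \<in> carrier R \<Longrightarrow> ([(k::nat)] \<cdot> \<one>) \<otimes> a = [k] \<cdot> a"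
  by (simp add: add_pow_ldistr)

lemma (in cring) add_pow_one_pow: "([(k::nat)] \<cdot> \<one>) [^] (n::nat) = [(k ^ n)] \<cdot> \<one>"
proof (induction n)
  case (Suc n)
  then show ?case by (simp add: add_pow_one_mult m_comm add.nat_pow_pow mult.commute)
qed (simp add: add_pow_Suc add_pow_0)

lemma witt_frob_prime:
  assumes "prime p" "CHAR('k::comm_ring_1) = p"
  shows "witt_frob p ([(n::nat)] \<cdot>\<^bsub>Witt p\<^esub> \<one>\<^bsub>Witt p\<^esub>) = [n] \<cdot>\<^bsub>Witt p\<^esub> (\<one>\<^bsub>Witt p\<^esub> :: nat \<Rightarrow> 'k)"
  using comm_ring_map.map_Witt_add_pow[OF comm_ring_map_power_char[OF assms], of p n "\<one>\<^bsub>Witt p\<^esub>"]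
    witt_frob_one[of p, where 'a = 'k] prime_gt_0_nat[OF assms(1)] by (simp add: witt_frob_def)

lemma std_frob_units:
  assumes p: "prime p" "CHAR('k::comm_ring_1) = p" and R: "cring (Witt p :: (nat \<Rightarrow> 'k) ring)" and i: "i < d"
  defines "rs \<equiv> replicate d (1, 2)"
  shows "std_frob p rs (std_unit p rs (i, 0)) = (std_unit p rs (i, 1) :: _ \<Rightarrow> nat \<Rightarrow> 'k)"
    and "std_frob p rs (std_unit p rs (i, 1)) =
      ([p] \<cdot>\<^bsub>Witt p\<^esub> \<one>\<^bsub>Witt p\<^esub>) \<odot>\<^bsub>std_module p rs\<^esub> (std_unit p rs (i, 0) :: _ \<Rightarrow> nat \<Rightarrow> 'k)"
proof -
  interpret cring "Witt p :: (nat \<Rightarrow> 'k) ring" by fact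
  have \<sigma>: "witt_frob p \<one>\<^bsub>Witt p\<^esub> = (\<one>\<^bsub>Witt p\<^esub> :: nat \<Rightarrow> 'k)" "witt_frob p \<zero>\<^bsub>Witt p\<^esub> = (\<zero>\<^bsub>Witt p\<^esub> :: nat \<Rightarrow> 'k)"
    using ring_hom_one[OF ring_hom_witt_frob[OF p]] ring_hom_zero[OF ring_hom_witt_frob[OF p] ring_axioms ring_axioms] by auto
  show "std_frob p rs (std_unit p rs (i, 0)) = (std_unit p rs (i, 1) :: _ \<Rightarrow> nat \<Rightarrow> 'k)"
  proof (rule extensionalityI[of _ "std_index rs"])
    fix t assume "t \<in> std_index rs"
    then obtain a b where t: "t = (a, b)" "a < d" "b = 0 \<or> b = 1"
      by (auto simp: rs_def std_index_replicate less_2_cases_iff)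
    from t(3) show "std_frob p rs (std_unit p rs (i, 0)) t = (std_unit p rs (i, 1) t :: nat \<Rightarrow> 'k)"
      by (elim disjE) (use t(1,2) i in \<open>simp_all add: std_frob_def std_unit_def rs_def std_index_replicate \<sigma>\<close>)
  qed (simp_all add: std_frob_def std_unit_def)
  show "std_frob p rs (std_unit p rs (i, 1)) =
      ([p] \<cdot>\<^bsub>Witt p\<^esub> \<one>\<^bsub>Witt p\<^esub>) \<odot>\<^bsub>std_module p rs\<^esub> (std_unit p rs (i, 0) :: _ \<Rightarrow> nat \<Rightarrow> 'k)"
  proof (rule extensionalityI[of _ "std_index rs"])
    fix t assume "t \<in> std_index rs"
    then obtain a b where t: "t = (a, b)" "a < d" "b = 0 \<or> b = 1"
      by (auto simp: rs_def std_index_replicate less_2_cases_iff)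
    from t(3) show "std_frob p rs (std_unit p rs (i, 1)) t =
      ((([p] \<cdot>\<^bsub>Witt p\<^esub> \<one>\<^bsub>Witt p\<^esub>) \<odot>\<^bsub>std_module p rs\<^esub> std_unit p rs (i, 0)) (t :: nat \<times> nat) :: nat \<Rightarrow> 'k)"
      by (elim disjE) (use t(1,2) i in \<open>simp_all add: std_frob_def std_simps std_unit_def rs_def std_index_replicate \<sigma>\<close>)
  qed (simp_all add: std_frob_def std_simps)
qed

lemma (in abelian_group) torsion_free_pow:
  assumes "\<And>u. u \<in> carrier G \<Longrightarrow> [(p::nat)] \<cdot> u = \<zero> \<Longrightarrow> u = \<zero>"
    and "u \<in> carrier G" "[(p ^ n)] \<cdot> u = \<zero>"
  shows "u = \<zero>"
  using assms(2,3)
proof (induction n arbitrary: u)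
  case (Suc n)
  then have "[(p ^ n)] \<cdot> ([p] \<cdot> u) = \<zero>" by (simp add: add.nat_pow_pow)
  then have "[p] \<cdot> u = \<zero>" using Suc.prems(1) by (intro Suc.IH[of "[p] \<cdot> u"]) simp_all
  then show ?case by (rule assms(1)[OF Suc.prems(1)])
qed simp

lemma std_torsion_free:
  assumes p: "prime p" "CHAR('k::field) = p" and R: "cring (Witt p :: (nat \<Rightarrow> 'k) ring)"
    and u: "u \<in> carrier (std_module p rs)" "[p] \<cdot>\<^bsub>std_module p rs\<^esub> u = \<zero>\<^bsub>std_module p rs\<^esub>"
  shows "u = (\<zero>\<^bsub>std_module p rs\<^esub> :: nat \<times> nat \<Rightarrow> nat \<Rightarrow> 'k)"
proof (rule extensionalityI[of _ "std_index rs"])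
  interpret cring "Witt p :: (nat \<Rightarrow> 'k) ring" by fact
  interpret N: Module.module "Witt p" "std_module p rs :: (nat \<Rightarrow> 'k, _) module"
    by (rule module_std_module) fact
  fix t assume t: "t \<in> std_index rs"
  have "([p] \<cdot>\<^bsub>Witt p\<^esub> \<one>\<^bsub>Witt p\<^esub>) \<odot>\<^bsub>std_module p rs\<^esub> u = \<zero>\<^bsub>std_module p rs\<^esub>"
    using u by (simp add: N.nat_smult)
  then have "(([p] \<cdot>\<^bsub>Witt p\<^esub> \<one>\<^bsub>Witt p\<^esub>) \<odot>\<^bsub>std_module p rs\<^esub> u) t = \<zero>\<^bsub>std_module p rs\<^esub> t" by simp
  then have "[p] \<cdot>\<^bsub>Witt p\<^esub> u t = \<zero>\<^bsub>Witt p\<^esub>" using t by (simp add: std_simps add_pow_one_mult)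
  then show "u t = \<zero>\<^bsub>std_module p rs\<^esub> t" using t Witt_torsion_free[OF p] by (simp add: std_simps)
qed (use u in \<open>simp_all add: std_simps\<close>)

locale dieudonne =
  fixes p :: nat and M :: "(nat \<Rightarrow> 'k::alg_closed_field, 'm) module" and \<phi> :: "'m \<Rightarrow> 'm"
  assumes p: "prime p" "CHAR('k) = p" and dieudonne: "dieudonne_module p M \<phi>"
begin

sublocale Module.module "Witt p" M
  using dieudonne by (simp add: dieudonne_module_def)

abbreviation \<pi> :: "nat \<Rightarrow> 'k" where
  "\<pi> \<equiv> [p] \<cdot>\<^bsub>Witt p\<^esub> \<one>\<^bsub>Witt p\<^esub>"

lemma \<phi>_semilinear: "\<phi> \<in> semilinear_maps (Witt p) (witt_frob p) M M"
  using dieudonne by (simp add: dieudonne_module_def)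

lemma \<pi>_mult: "\<pi> \<otimes>\<^bsub>Witt p\<^esub> a = [p] \<cdot>\<^bsub>Witt p\<^esub> a"
  by (rule R.add_pow_one_mult) simp

lemma \<pi>_pow: "\<pi> [^]\<^bsub>Witt p\<^esub> (n::nat) = [(p ^ n)] \<cdot>\<^bsub>Witt p\<^esub> \<one>\<^bsub>Witt p\<^esub>"
  by (rule R.add_pow_one_pow)

lemma \<pi>_pow_smult: "u \<in> carrier M \<Longrightarrow> \<pi> [^]\<^bsub>Witt p\<^esub> (n::nat) \<odot>\<^bsub>M\<^esub> u = [(p ^ n)] \<cdot>\<^bsub>M\<^esub> u"
  unfolding \<pi>_pow by (rule nat_smult[symmetric])

lemma \<pi>_smult: "u \<in> carrier M \<Longrightarrow> \<pi> \<odot>\<^bsub>M\<^esub> u = [p] \<cdot>\<^bsub>M\<^esub> u"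
  by (rule nat_smult[symmetric])

lemma \<pi>_regular: "\<pi> \<otimes>\<^bsub>Witt p\<^esub> a = \<zero>\<^bsub>Witt p\<^esub> \<Longrightarrow> a = \<zero>\<^bsub>Witt p\<^esub>"
  unfolding \<pi>_mult by (rule Witt_torsion_free[OF p])

lemma \<pi>_torsion_free: "u \<in> carrier M \<Longrightarrow> \<pi> \<odot>\<^bsub>M\<^esub> u = \<zero>\<^bsub>M\<^esub> \<Longrightarrow> u = \<zero>\<^bsub>M\<^esub>"
proof -
  obtain B where B: "is_basis (Witt p) M B"
    using dieudonne by (auto simp: dieudonne_module_def free_of_rank_def)
  show "u \<in> carrier M \<Longrightarrow> \<pi> \<odot>\<^bsub>M\<^esub> u = \<zero>\<^bsub>M\<^esub> \<Longrightarrow> u = \<zero>\<^bsub>M\<^esub>"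
    by (rule basis_torsion_free[OF module_axioms B]) (auto dest: \<pi>_regular)
qed

end

section \<open>A Dieudonne module with an embedded \<open>N_pow\<close>\<close>

locale dieudonne_mono = dieudonne p M \<phi>
  for p :: nat and M :: "(nat \<Rightarrow> 'k::alg_closed_field, 'm) module" and \<phi> :: "'m \<Rightarrow> 'm" +
  fixes d :: nat and j :: "(nat \<times> nat \<Rightarrow> nat \<Rightarrow> 'k) \<Rightarrow> 'm"
  assumes j: "j \<in> monomorphisms p (N_pow p d) (N_pow_frob p d) M \<phi>"
begin

abbreviation N :: "(nat \<Rightarrow> 'k, nat \<times> nat \<Rightarrow> nat \<Rightarrow> 'k) module" where
  "N \<equiv> N_pow p d"

text \<open>Padded with zero from \<open>d\<close> on, since \<open>frob_lattice\<close> asks for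
  closedness and the Frobenius relations at every index.\<close>

definition X :: "nat \<Rightarrow> 'm" where
  "X i = (if i < d then j (std_unit p (replicate d (1, 2)) (i, 0)) else \<zero>\<^bsub>M\<^esub>)"

definition Y :: "nat \<Rightarrow> 'm" where
  "Y i = (if i < d then j (std_unit p (replicate d (1, 2)) (i, 1)) else \<zero>\<^bsub>M\<^esub>)"

lemma j_linear: "j \<in> linear_maps (Witt p) N M" and j_inj: "inj_on j (carrier N)"
  and j_frob: "x \<in> carrier N \<Longrightarrow> j (N_pow_frob p d x) = \<phi> (j x)"
  using j by (auto simp: monomorphisms_def)

sublocale N: Module.module "Witt p" N
  by (rule module_std_module) (rule R.is_cring)

lemma j_unit_closed: "j (std_unit p (replicate d (1, 2)) t) \<in> carrier M"
  using semilinear_mapsD(1)[OF j_linear] std_unit_closed by blast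

lemma XY_closed: "X i \<in> carrier M" "Y i \<in> carrier M"
  using j_unit_closed by (auto simp: X_def Y_def)

lemma j_eq_comb:
  assumes "v \<in> carrier N"
  shows "j v = (\<Oplus>\<^bsub>M\<^esub>i\<in>{..<d}. v (i, 0) \<odot>\<^bsub>M\<^esub> X i \<oplus>\<^bsub>M\<^esub> v (i, 1) \<odot>\<^bsub>M\<^esub> Y i)"
proof -
  have "j v = (\<Oplus>\<^bsub>M\<^esub>t\<in>{..<d} \<times> {..<2}. v t \<odot>\<^bsub>M\<^esub> j (std_unit p (replicate d (1, 2)) t))"
    using linear_std_module[OF module_axioms j_linear assms] by (simp add: lincomb_def std_index_replicate)
  also have "\<dots> = (\<Oplus>\<^bsub>M\<^esub>i\<in>{..<d}. v (i, 0) \<odot>\<^bsub>M\<^esub> j (std_unit p (replicate d (1, 2)) (i, 0)) \<oplus>\<^bsub>M\<^esub>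
      v (i, 1) \<odot>\<^bsub>M\<^esub> j (std_unit p (replicate d (1, 2)) (i, 1)))"
    using j_unit_closed by (intro M.finsum_lessThan_Times_2) auto
  also have "\<dots> = (\<Oplus>\<^bsub>M\<^esub>i\<in>{..<d}. v (i, 0) \<odot>\<^bsub>M\<^esub> X i \<oplus>\<^bsub>M\<^esub> v (i, 1) \<odot>\<^bsub>M\<^esub> Y i)"
    using j_unit_closed by (intro M.finsum_cong') (auto simp: X_def Y_def)
  finally show ?thesis .
qed

definition vec :: "(nat \<Rightarrow> nat \<Rightarrow> 'k) \<Rightarrow> (nat \<Rightarrow> nat \<Rightarrow> 'k) \<Rightarrow> nat \<times> nat \<Rightarrow> nat \<Rightarrow> 'k" where
  "vec a b = (\<lambda>(i, k)\<in>std_index (replicate d (1, 2)). if k = 0 then a i else b i)"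

lemma vec_closed: "vec a b \<in> carrier N"
  by (simp add: vec_def std_simps)

lemma vec_apply: "i < d \<Longrightarrow> vec a b (i, 0) = a i" "i < d \<Longrightarrow> vec a b (i, 1) = b i"
  by (simp_all add: vec_def std_index_replicate)

lemma j_vec: "j (vec a b) = (\<Oplus>\<^bsub>M\<^esub>i\<in>{..<d}. a i \<odot>\<^bsub>M\<^esub> X i \<oplus>\<^bsub>M\<^esub> b i \<odot>\<^bsub>M\<^esub> Y i)"
proof -
  have "vec a b (i, 0) \<odot>\<^bsub>M\<^esub> X i \<oplus>\<^bsub>M\<^esub> vec a b (i, 1) \<odot>\<^bsub>M\<^esub> Y i = a i \<odot>\<^bsub>M\<^esub> X i \<oplus>\<^bsub>M\<^esub> b i \<odot>\<^bsub>M\<^esub> Y i" if "i < d" for i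
    unfolding vec_apply[OF that] ..
  then show ?thesis
    unfolding j_eq_comb[OF vec_closed] using XY_closed by (intro M.finsum_cong') auto
qed

lemma j_zero: "j \<zero>\<^bsub>N\<^esub> = \<zero>\<^bsub>M\<^esub>"
proof -
  have "j \<zero>\<^bsub>N\<^esub> = j (\<zero>\<^bsub>Witt p\<^esub> \<odot>\<^bsub>N\<^esub> \<zero>\<^bsub>N\<^esub>)" by (simp only: N.smult_r_null R.zero_closed)
  also have "\<dots> = \<zero>\<^bsub>Witt p\<^esub> \<odot>\<^bsub>M\<^esub> j \<zero>\<^bsub>N\<^esub>"
    by (rule semilinear_mapsD(3)[OF j_linear R.zero_closed N.M.zero_closed])
  also have "\<dots> = \<zero>\<^bsub>M\<^esub>" by (rule smult_l_null[OF semilinear_mapsD(1)[OF j_linear N.M.zero_closed]])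
  finally show ?thesis .
qed

text \<open>Independence of the images is injectivity of \<open>j\<close> at the vectors
  \<open>vec a b\<close>. The inverse of \<sigma> exists because an algebraically closed field is
  perfect.\<close>

sublocale frob_lattice "Witt p" M "witt_frob p" "inv_into UNIV (witt_frob p)" \<pi> \<phi> d X Y
proof
  note bij = bij_witt_frob[OF p]
  show "witt_frob p \<in> ring_hom (Witt p :: (nat \<Rightarrow> 'k) ring) (Witt p)" by (rule ring_hom_witt_frob[OF p])
  show "witt_frob p (inv_into UNIV (witt_frob p) a) = a" for a :: "nat \<Rightarrow> 'k"
    using bij by (simp add: bij_is_surj surj_f_inv_f)
  show "inv_into UNIV (witt_frob p) (witt_frob p a) = a" for a :: "nat \<Rightarrow> 'k"
    using bij by (simp add: bij_is_inj)
  show "witt_frob p \<pi> = \<pi>" by (rule witt_frob_prime[OF p])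
  show "a = \<zero>\<^bsub>Witt p\<^esub>" if "\<pi> \<otimes>\<^bsub>Witt p\<^esub> a = \<zero>\<^bsub>Witt p\<^esub>" for a using that by (rule \<pi>_regular)
  show "u = \<zero>\<^bsub>M\<^esub>" if "u \<in> carrier M" "\<pi> \<odot>\<^bsub>M\<^esub> u = \<zero>\<^bsub>M\<^esub>" for u using that by (rule \<pi>_torsion_free)
  show "\<phi> \<in> semilinear_maps (Witt p) (witt_frob p) M M" by (rule \<phi>_semilinear)
  \<comment> \<open>Needed at the padded indices, where both sides of the Frobenius relations are
    zero.\<close>
  have \<phi>0: "\<phi> \<zero>\<^bsub>M\<^esub> = \<zero>\<^bsub>M\<^esub>"
    using semilinear_mapsD(2)[OF \<phi>_semilinear, of "\<zero>\<^bsub>M\<^esub>" "\<zero>\<^bsub>M\<^esub>"] semilinear_mapsD(1)[OF \<phi>_semilinear, of "\<zero>\<^bsub>M\<^esub>"]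
    by (simp add: M.add.r_cancel_one')
  note units = std_frob_units[OF p R.is_cring]
  show "\<phi> (X i) = Y i" for i
  proof (cases "i < d")
    case True
    then have "\<phi> (X i) = j (N_pow_frob p d (std_unit p (replicate d (1, 2)) (i, 0)))"
      using j_frob[OF std_unit_closed] by (simp only: X_def if_True)
    then show ?thesis using True by (simp only: units(1) Y_def if_True)
  qed (use \<phi>0 in \<open>simp add: X_def Y_def\<close>)
  show "\<phi> (Y i) = \<pi> \<odot>\<^bsub>M\<^esub> X i" for i
  proof (cases "i < d")
    case True
    then have "\<phi> (Y i) = j (N_pow_frob p d (std_unit p (replicate d (1, 2)) (i, 1)))"
      using j_frob[OF std_unit_closed] by (simp only: Y_def if_True)
    also have "\<dots> = j (\<pi> \<odot>\<^bsub>N\<^esub> std_unit p (replicate d (1, 2)) (i, 0))"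
      using True by (simp only: units(2))
    also have "\<dots> = \<pi> \<odot>\<^bsub>M\<^esub> j (std_unit p (replicate d (1, 2)) (i, 0))"
      by (rule semilinear_mapsD(3)[OF j_linear _ std_unit_closed]) simp
    finally show ?thesis using True by (simp only: X_def if_True)
  qed (use \<phi>0 in \<open>simp add: X_def Y_def\<close>)
  show "a i = \<zero>\<^bsub>Witt p\<^esub> \<and> b i = \<zero>\<^bsub>Witt p\<^esub>"
    if "(\<Oplus>\<^bsub>M\<^esub>i\<in>{..<d}. a i \<odot>\<^bsub>M\<^esub> X i \<oplus>\<^bsub>M\<^esub> b i \<odot>\<^bsub>M\<^esub> Y i) = \<zero>\<^bsub>M\<^esub>" "i < d" for a b i
  proof -
    have "j (vec a b) = j \<zero>\<^bsub>N\<^esub>" using that(1) by (simp only: j_vec j_zero)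
    then have "vec a b = \<zero>\<^bsub>N\<^esub>" using j_inj vec_closed N.M.zero_closed by (meson inj_onD)
    then have "vec a b (i, 0) = \<zero>\<^bsub>N\<^esub> (i, 0)" "vec a b (i, 1) = \<zero>\<^bsub>N\<^esub> (i, 1)" by (simp_all only:)
    then show ?thesis using that(2) vec_apply[OF that(2), of a b] by (simp add: std_simps std_index_replicate)
  qed
qed (use XY_closed in auto)

lemma mem_image_j_iff: "u \<in> j ` carrier N \<longleftrightarrow> (\<exists>a\<in>scalars. \<exists>b\<in>scalars. u = comb a b)"
proof
  assume "u \<in> j ` carrier N"
  then obtain v where "v \<in> carrier N" "u = j v" by auto
  then have "u = comb (\<lambda>i. v (i, 0)) (\<lambda>i. v (i, 1))" using j_eq_comb by (simp add: comb_def)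
  then show "\<exists>a\<in>scalars. \<exists>b\<in>scalars. u = comb a b" by (auto simp: scalars_def)
next
  assume "\<exists>a\<in>scalars. \<exists>b\<in>scalars. u = comb a b"
  then obtain a b where "u = j (vec a b)" by (auto simp only: comb_def j_vec)
  then show "u \<in> j ` carrier N" using vec_closed by (rule image_eqI)
qed

end

section \<open>Existence of an admissible exponent and the inclusion in the span\<close>

context dieudonne
begin

lemma \<phi>_closed: "u \<in> carrier M \<Longrightarrow> \<phi> u \<in> carrier M"
  and \<phi>_add: "u \<in> carrier M \<Longrightarrow> v \<in> carrier M \<Longrightarrow> \<phi> (u \<oplus>\<^bsub>M\<^esub> v) = \<phi> u \<oplus>\<^bsub>M\<^esub> \<phi> v"
  using semilinear_mapsD[OF \<phi>_semilinear] by auto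

lemma multiples_in_range: "multiples p M \<subseteq> \<phi> ` carrier M"
  using dieudonne by (simp add: dieudonne_module_def)

text \<open>The unit vectors map to an independent family whose span lies between
  \<open>p ^ n\<close> times \<open>M\<close> and \<open>M\<close>. Transition matrices to and from
  \<open>B\<close> then exist up to the scalar \<open>p ^ n\<close>, and the trace argument compares
  the cardinalities.\<close>

lemma rank_unique:
  assumes "j \<in> linear_maps (Witt p) (std_module p rs) M" "inj_on j (carrier (std_module p rs))"
    and n: "\<And>u. u \<in> carrier M \<Longrightarrow> [(p ^ n)] \<cdot>\<^bsub>M\<^esub> u \<in> j ` carrier (std_module p rs)"
    and B: "is_basis (Witt p) M B"
  shows "card (std_index rs) = card B"
proof (rule Witt_of_nat_inj[OF p R.is_cring])
  let ?v = "\<lambda>t. j (std_unit p rs t)"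
  have unit: "?v t \<in> carrier M" for t using semilinear_mapsD(1)[OF assms(1)] std_unit_closed by blast
  have fin: "finite B" "B \<subseteq> carrier M" using B by (auto simp: is_basis_def)
  show "[card (std_index rs)] \<cdot>\<^bsub>Witt p\<^esub> ([(p ^ n)] \<cdot>\<^bsub>Witt p\<^esub> (\<one>\<^bsub>Witt p\<^esub> :: nat \<Rightarrow> 'k)) =
    [card B] \<cdot>\<^bsub>Witt p\<^esub> ([(p ^ n)] \<cdot>\<^bsub>Witt p\<^esub> \<one>\<^bsub>Witt p\<^esub>)"
  proof (rule card_transition[OF module_axioms finite_std_index fin(1) _ _
        lin_indep_std_units[OF module_axioms assms(1,2)] independent_family_basis[OF module_axioms B]])
    show "\<exists>a. (\<forall>b. a b \<in> carrier (Witt p)) \<and> ?v t = lincomb M a (\<lambda>b. b) B" for t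
      by (rule ex_lincomb_basis[OF module_axioms B unit])
    show "\<exists>c. (\<forall>t. c t \<in> carrier (Witt p)) \<and>
      ([(p ^ n)] \<cdot>\<^bsub>Witt p\<^esub> \<one>\<^bsub>Witt p\<^esub>) \<odot>\<^bsub>M\<^esub> b = lincomb M c ?v (std_index rs)" if "b \<in> B" for b
    proof -
      have b: "b \<in> carrier M" using that fin(2) by blast
      obtain v where v: "v \<in> carrier (std_module p rs)" "[(p ^ n)] \<cdot>\<^bsub>M\<^esub> b = j v" using n[OF b] by auto
      then have "([(p ^ n)] \<cdot>\<^bsub>Witt p\<^esub> \<one>\<^bsub>Witt p\<^esub>) \<odot>\<^bsub>M\<^esub> b = lincomb M v ?v (std_index rs)"
        using linear_std_module[OF module_axioms assms(1) v(1)] nat_smult[OF b, of "p ^ n"] by simp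
      then show ?thesis by (intro exI[of _ v]) simp
    qed
  qed (use unit fin in auto)
qed

text \<open>Coprimality leaves \<open>(1, 2)\<close> as the only pair of slope one half, so the
  decomposition consists of copies of \<open>N\<close>. Clearing denominators gives the embedding,
  and comparing ranks shows that there are \<open>d\<close> copies.\<close>

lemma ex_monomorphism:
  assumes "free_of_rank (Witt p) M (2 * d)" "supersingular p M \<phi>"
  shows "\<exists>j n. j \<in> monomorphisms p (N_pow p d) (N_pow_frob p d) M \<phi> \<and>
    (\<forall>u\<in>carrier M. [(p ^ n)] \<cdot>\<^bsub>M\<^esub> u \<in> j ` carrier (N_pow p d))"
proof -
  obtain rs where rs: "slope_decomposition p M \<phi> rs" "\<And>r s. (r, s) \<in> set rs \<Longrightarrow> of_nat r / of_nat s = (1 / 2 :: rat)"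
    using assms(2) by (auto simp: supersingular_def)
  have "(r, s) = (1, 2)" if "(r, s) \<in> set rs" for r s
  proof -
    have rs': "s > 0" "coprime r s" using rs(1) that by (auto simp: slope_decomposition_def)
    then have "rat_of_nat (2 * r) = rat_of_nat s" using rs(2)[OF that] by (simp add: field_simps)
    then have "s = 2 * r" by (simp only: of_nat_eq_iff)
    then show ?thesis using rs'(2) by simp
  qed
  then have "\<forall>x\<in>set rs. x = (1, 2)" by (metis surj_pair)
  then have "rs = replicate (length rs) (1, 2)" by (rule replicate_length_same[symmetric])
  then obtain d' where d': "rs = replicate d' (1, 2)" by blast
  let ?N = "N_pow p d' :: (nat \<Rightarrow> 'k, _) module"
  obtain f where f: "f \<in> linear_maps (Witt p) (loc p ?N) (loc p M)"
    "bij_betw f (carrier (loc p ?N)) (carrier (loc p M))"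
    "\<And>v. v \<in> carrier (loc p ?N) \<Longrightarrow> f (loc_map p ?N ?N (N_pow_frob p d') v) = loc_map p M M \<phi> (f v)"
    using rs(1) unfolding slope_decomposition_def isocrystal_iso_def d' by blast
  obtain B where B: "is_basis (Witt p) M B" "card B = 2 * d"
    using assms(1) by (auto simp: free_of_rank_def)
  interpret N: Module.module "Witt p" ?N by (rule module_std_module) (rule R.is_cring)
  have tM: "u = \<zero>\<^bsub>M\<^esub>" if "u \<in> carrier M" "[(p ^ n)] \<cdot>\<^bsub>M\<^esub> u = \<zero>\<^bsub>M\<^esub>" for u n
    by (rule M.torsion_free_pow[OF _ that]) (simp add: \<pi>_torsion_free \<pi>_smult)
  have tN: "u = \<zero>\<^bsub>?N\<^esub>" if "u \<in> carrier ?N" "[(p ^ n)] \<cdot>\<^bsub>?N\<^esub> u = \<zero>\<^bsub>?N\<^esub>" for u n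
    by (rule N.M.torsion_free_pow[OF _ that]) (rule std_torsion_free[OF p R.is_cring])
  have "\<exists>j n. j \<in> linear_maps (Witt p) ?N M \<and> inj_on j (carrier ?N) \<and>
    (\<forall>x\<in>carrier ?N. j (N_pow_frob p d' x) = \<phi> (j x)) \<and>
    (\<forall>u\<in>carrier M. [(p ^ n)] \<cdot>\<^bsub>M\<^esub> u \<in> j ` carrier ?N)"
    by (rule ex_embedding_of_loc_iso[OF N.module_axioms module_axioms generates_std_module[OF R.is_cring]
          generates_basis[OF module_axioms B(1)] _ _ std_frob_semilinear[OF p R.is_cring] \<phi>_semilinear f(1,2)])
      (rule tN tM f(3); assumption)+
  then obtain j n where j: "j \<in> linear_maps (Witt p) ?N M" "inj_on j (carrier ?N)"
    "\<And>x. x \<in> carrier ?N \<Longrightarrow> j (N_pow_frob p d' x) = \<phi> (j x)"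
    "\<And>u. u \<in> carrier M \<Longrightarrow> [(p ^ n)] \<cdot>\<^bsub>M\<^esub> u \<in> j ` carrier ?N"
    by blast
  have "d' = d"
    using rank_unique[OF j(1,2,4) B(1)] B(2) by (simp add: std_index_replicate)
  moreover have "j \<in> monomorphisms p ?N (N_pow_frob p d') M \<phi>"
    using j(1-3) unfolding monomorphisms_def by blast
  ultimately show ?thesis using j(4) by blast
qed

text \<open>If \<open>p ^ n\<close> carries \<open>M\<close> into the image, the exponent
  \<open>2 * n\<close> is admissible.\<close>

lemma ex_\<phi>_pow_in_image:
  assumes "free_of_rank (Witt p) M (2 * d)" "supersingular p M \<phi>"
  shows "\<exists>q. \<exists>j \<in> monomorphisms p (N_pow p d) (N_pow_frob p d) M \<phi>.
    (\<phi> ^^ q) ` carrier M \<subseteq> j ` carrier (N_pow p d)"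
proof -
  obtain j n where jn: "j \<in> monomorphisms p (N_pow p d) (N_pow_frob p d) M \<phi>"
    "\<And>u. u \<in> carrier M \<Longrightarrow> [(p ^ n)] \<cdot>\<^bsub>M\<^esub> u \<in> j ` carrier (N_pow p d)"
    using ex_monomorphism[OF assms] by blast
  interpret dieudonne_mono p M \<phi> d j by unfold_locales (rule jn(1))
  have "\<exists>a\<in>scalars. \<exists>b\<in>scalars. \<pi> [^]\<^bsub>Witt p\<^esub> n \<odot>\<^bsub>M\<^esub> u = comb a b" if "u \<in> carrier M" for u
    using jn(2)[OF that] unfolding mem_image_j_iff \<pi>_pow_smult[OF that] .
  then have "(\<phi> ^^ (2 * n)) ` carrier M \<subseteq> j ` carrier N"
    using \<phi>_pow_in_comb[of n] by (auto simp only: mem_image_j_iff)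
  then show ?thesis using jn(1) by blast
qed

text \<open>A Teichmueller vector has all its coordinates after the zeroth equal to zero, so the
  coordinatewise Frobenius acts on it as on \<zeta> and has period two. The difference is invertible
  because its zeroth coordinate is \<open>\<zeta> - \<zeta> ^ p\<close>.\<close>

lemma ex_Teichmueller_unit:
  "\<exists>z c :: nat \<Rightarrow> 'k. witt_frob p (witt_frob p z) = z \<and>
     c \<otimes>\<^bsub>Witt p\<^esub> (z \<ominus>\<^bsub>Witt p\<^esub> witt_frob p z) = \<one>\<^bsub>Witt p\<^esub>"
proof -
  obtain \<zeta> :: 'k where \<zeta>: "(\<zeta> ^ p) ^ p = \<zeta>" "\<zeta> ^ p \<noteq> \<zeta>" using ex_frobenius_order_two[OF p] by blast
  define z :: "nat \<Rightarrow> 'k" where "z = (\<lambda>n. if n = 0 then \<zeta> else 0)"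
  have "witt_frob p (witt_frob p z) = z"
    using \<zeta>(1) prime_gt_0_nat[OF p(1)] by (auto simp: witt_frob_def z_def power_0_left)
  moreover
  let ?w = "z \<ominus>\<^bsub>Witt p\<^esub> witt_frob p z"
  \<comment> \<open>Only sums have a coordinate formula here, so the zeroth coordinate of the
    difference is found by adding \<open>witt_frob p z\<close> back.\<close>
  have "?w \<oplus>\<^bsub>Witt p\<^esub> witt_frob p z = z"
    by (simp add: R.minus_eq R.a_assoc R.l_neg)
  then have "?w 0 + \<zeta> ^ p = \<zeta>"
    using Witt_add_0[OF p(1), of ?w "witt_frob p z"] by (simp add: z_def witt_frob_def)
  then have "?w 0 \<noteq> 0" using \<zeta>(2) by auto
  then obtain c where "?w \<otimes>\<^bsub>Witt p\<^esub> c = \<one>\<^bsub>Witt p\<^esub>"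
    using Witt_right_inverse[OF p(1), of ?w "\<one>\<^bsub>Witt p\<^esub>"] of_nat_CHAR[where 'a = 'k] p(2) by auto
  then have "c \<otimes>\<^bsub>Witt p\<^esub> ?w = \<one>\<^bsub>Witt p\<^esub>" using R.m_comm[of c ?w] by simp
  ultimately show ?thesis by blast
qed

lemma multiples_in_invariant_span:
  assumes j: "j \<in> monomorphisms p (N_pow p d) (N_pow_frob p d) M \<phi>"
    and q: "(\<phi> ^^ q) ` carrier M \<subseteq> j ` carrier (N_pow p d)"
  shows "multiples (p ^ (q + 1)) (End_module (Witt p) M) \<subseteq> invariant_span p M \<phi>"
proof -
  interpret dieudonne_mono p M \<phi> d j by unfold_locales (rule j)
  interpret frob_lattice_bound "Witt p" M "witt_frob p" "inv_into UNIV (witt_frob p)" \<pi> \<phi> d X Y q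
  proof
    show "\<exists>v\<in>carrier M. \<pi> \<odot>\<^bsub>M\<^esub> u = \<phi> v" if "u \<in> carrier M" for u
      using multiples_in_range that by (auto simp: multiples_def \<pi>_smult)
    show "\<exists>a\<in>scalars. \<exists>b\<in>scalars. (\<phi> ^^ q) u = comb a b" if "u \<in> carrier M" for u
      using q that by (simp only: mem_image_j_iff[symmetric]) blast
  qed
  interpret E: Module.module "Witt p" E by (rule module_E)
  obtain z c :: "nat \<Rightarrow> 'k" where zc: "witt_frob p (witt_frob p z) = z"
    "c \<otimes>\<^bsub>Witt p\<^esub> (z \<ominus>\<^bsub>Witt p\<^esub> witt_frob p z) = \<one>\<^bsub>Witt p\<^esub>" using ex_Teichmueller_unit by blast
  \<comment> \<open>The span is an intersection, so membership is tested against each submodule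
    \<open>H\<close> containing the invariant endomorphisms.\<close>
  have "[(p ^ (q + 1))] \<cdot>\<^bsub>E\<^esub> e \<in> H"
    if e: "e \<in> carrier E" and H: "submodule H (Witt p) E"
      "{e \<in> carrier E. frob_conj p M \<phi> (loc_map p M M e) = loc_map p M M e} \<subseteq> H" for e H
  proof -
    have "\<pi> [^]\<^bsub>Witt p\<^esub> (q + 1) \<odot>\<^bsub>E\<^esub> e \<in> H"
    proof (rule \<pi>_pow_End_in_submodule[OF H(1) _ _ zc(1) _ zc(2) e])
      fix g assume g: "g \<in> carrier E" "\<And>u. u \<in> carrier M \<Longrightarrow> g (\<phi> u) = \<phi> (g u)"
      have "frob_conj p M \<phi> (loc_map p M M g) = loc_map p M M g"
        by (rule frob_conj_loc_map[OF M.abelian_group_axioms multiples_in_range \<phi>_closed \<phi>_add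
              End_memD(2,3)[OF g(1)] g(2)])
      then show "g \<in> H" using g(1) H(2) by blast
    qed auto
    then show ?thesis using E.nat_smult[OF e, of "p ^ (q + 1)"] by (simp only: \<pi>_pow)
  qed
  then show ?thesis by (auto simp only: multiples_def invariant_span_def module_span_def)
qed

lemma invariant_span_subset: "invariant_span p M \<phi> \<subseteq> carrier (End_module (Witt p) M)"
proof -
  interpret E: Module.module "Witt p" "End_module (Witt p) M" by (rule module_End) (rule module_axioms)
  show ?thesis using E.carrier_is_submodule by (auto simp: invariant_span_def module_span_def)
qed

end

theorem theorem3p1:
  fixes p d q m :: nat
    and M :: "(nat \<Rightarrow> 'k::alg_closed_field, 'm) module"
    and \<phi> :: "'m \<Rightarrow> 'm"
    and E :: "(nat \<Rightarrow> 'k, 'm \<Rightarrow> 'm) module"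
    and O_M :: "('m \<Rightarrow> 'm) set"
  assumes "prime p" and "CHAR('k) = p"
    and "dieudonne_module p M \<phi>"
    and "free_of_rank (Witt p) M (2 * d)"
    and "supersingular p M \<phi>"
    and "E = End_module (Witt p) M"
    and "O_M = invariant_span p M \<phi>"
    and "q = (LEAST q. \<exists>j \<in> monomorphisms p (N_pow p d) (N_pow_frob p d) M \<phi>.
                (\<phi> ^^ q) ` carrier M \<subseteq> j ` carrier (N_pow p d))"
    and "m = (LEAST m. multiples (p ^ m) E \<subseteq> O_M)"
  shows "multiples (p ^ (q + 1)) E \<subseteq> O_M \<and> O_M \<subseteq> carrier E \<and> m \<le> q + 1"
proof -
  interpret dieudonne p M \<phi> using assms(1-3) by unfold_locales
  \<comment> \<open>The least exponent satisfies its defining condition because an admissible one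
    exists.\<close>
  have "\<exists>j \<in> monomorphisms p (N_pow p d) (N_pow_frob p d) M \<phi>.
      (\<phi> ^^ q) ` carrier M \<subseteq> j ` carrier (N_pow p d)"
    unfolding assms(8) by (rule LeastI_ex) (rule ex_\<phi>_pow_in_image[OF assms(4,5)])
  then have "multiples (p ^ (q + 1)) E \<subseteq> O_M"
    unfolding assms(6,7) using multiples_in_invariant_span by blast
  moreover have "m \<le> q + 1"
    unfolding assms(9) by (rule Least_le) (rule calculation)
  ultimately show ?thesis
    using invariant_span_subset assms(6,7) by simp
qed

end
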